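(* Let $0\le\ell(x,\xi)\le\ell^\infty(x):=\sup_{\xi\in\Sigma}\ell(x,\xi)$, let $d$ be a lower semicontinuous function with $d(\xi,\xi)=0$ for all $\xi\in\Sigma$, and let $\ell(x,\xi)$ be an upper semicontinuous function in $\xi\in\Sigma$ for all $x\in X$. Then for all $x\in X$, $\hat P\in\mathcal{P}(\Sigma)$, $r>0$ and $\epsilon\ge0$, $$\hat c^{\epsilon}_{f,d,r}(x,\hat P)=\inf\left\{\int\left[\sup_{\delta\in\Delta}\ \lambda f^\star\!\left(\frac{\ell^\delta(x,\xi)-\eta}{\lambda}\right)-\delta\gamma\right]\mathrm{d}\hat P(\xi)+r\lambda+\eta+\epsilon\gamma\ :\ \eta\in\mathbb{R},\ \lambda\in\mathbb{R}_+,\ \gamma\in\mathbb{R}_+,\ \ell^\infty(x)-\eta\le f^\infty\lambda\right\}.$$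
   Context: $\Sigma\subset\mathbb{R}^n$ is compact, $\|\cdot\|$ is the Euclidean norm on $\mathbb{R}^n$, $X\subseteq\mathbb{R}^m$ is the set of decisions, $\ell:X\times\Sigma\to\mathbb{R}$ is the loss, $\mathcal{P}(\Sigma)$ is the set of Borel probability measures on $\Sigma$. $f$-divergence: $f:[0,\infty)\to\mathbb{R}\cup\{+\infty\}$ is convex, lower semicontinuous, finite on $(0,\infty)$, $f(1)=0$; $f^\infty:=\lim_{u\to\infty}f(u)/u\in\mathbb{R}\cup\{+\infty\}$. $D_f(P',P):=\int f\left(\frac{\mathrm{d}P_c}{\mathrm{d}P'}\right)\mathrm{d}P'+f^\infty P_s(\Sigma)$, where $P=P_c+P_s$ is the Lebesgue decomposition with $P_c\ll P'$, $P_s\perp P'$ (and $0\cdot\infty=0$). Conjugate: $f^\star(s):=\sup_{t\ge0}\{st-f(t)\}$. Perspective: for $\lambda\ge0$, $\lambda f^\star(a/\lambda):=\sup_{t\ge0}\{at-\lambda f(t)\}$ (so for $\lambda=0$ it equals $0$ if $a\le0$ and $+\infty$ if $a>0$). If $f^\infty=+\infty$, the constraint involving $f^\infty\lambda$ is understood as void. Transport: $d:\Sigma\times\Sigma\to\mathbb{R}_+$ is the transport cost; $W_d(P',P)=\inf\{\int d(\xi',\xi)\,\mathrm{d}\gamma(\xi',\xi):\gamma\in\Gamma(P',P)\}$ with $\Gamma(P',P)$ the set of couplings of $P'$ and $P$. $\mathrm{diam}(\Sigma):=\sup_{\xi,\xi'\in\Sigma}\|\xi-\xi'\|$ and $\Delta:=[0,\mathrm{diam}(\Sigma)]$.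 Inflated loss: $\ell^\delta(x,\xi):=\sup\{\ell(x,\xi'):\xi'\in\Sigma,\ d(\xi,\xi')\le\delta\}$. Smoothed divergence and predictor: $D^{\epsilon}_{f,d}(P',P)=\inf\{D_f(Q,P):Q\in\mathcal{P}(\Sigma),\ W_d(P',Q)\le\epsilon\}$ and $\hat c^{\epsilon}_{f,d,r}(x,\hat P)=\sup\{\int\ell(x,\xi)\,\mathrm{d}P(\xi):P\in\mathcal{P}(\Sigma),\ D^{\epsilon}_{f,d}(\hat P,P)\le r\}$.
   Formalization: The formula with Δ=[0,diam(Σ)] can fail when d takes values above the Euclidean diam(Σ); it is proved with this Δ when d ≤ diam(Σ) on Σ×Σ, and for every d with δ ranging over [0,∞) in place of Δ. *)

theory Defs
  imports "HOL-Probability.Probability"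
begin

definition lsc_on :: "'a::topological_space set \<Rightarrow> ('a \<Rightarrow> 'b::linorder) \<Rightarrow> bool" where
  "lsc_on S f \<longleftrightarrow> (\<forall>x\<in>S. \<forall>c<f x. \<forall>\<^sub>F y in at x within S. c < f y)"

definition usc_on :: "'a::topological_space set \<Rightarrow> ('a \<Rightarrow> 'b::linorder) \<Rightarrow> bool" where
  "usc_on S f \<longleftrightarrow> (\<forall>x\<in>S. \<forall>c>f x. \<forall>\<^sub>F y in at x within S. f y < c)"

definition borel_probs :: "'a::topological_space set \<Rightarrow> 'a measure set" where
  "borel_probs S = space (prob_algebra (restrict_space borel S))"

(* Integral of an extended-real function: positive part minus negative part.
   Every use below has an integrand with integrable negative part. *)
definition ereal_integral :: "'a measure \<Rightarrow> ('a \<Rightarrow> ereal) \<Rightarrow> ereal" where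
  "ereal_integral M g =
     enn2ereal (\<integral>\<^sup>+ x. e2ennreal (g x) \<partial>M) - enn2ereal (\<integral>\<^sup>+ x. e2ennreal (- g x) \<partial>M)"

(* Only the values of f on [0, \<infinity>) are constrained, and only these are used. *)
definition divergence_generator :: "(real \<Rightarrow> ereal) \<Rightarrow> bool" where
  "divergence_generator f \<longleftrightarrow>
     (\<forall>t\<ge>0. f t \<noteq> -\<infinity>) \<and>
     (\<forall>t>0. \<bar>f t\<bar> \<noteq> \<infinity>) \<and>
     f 1 = 0 \<and>
     lsc_on {0..} f \<and>
     (\<forall>s\<ge>0. \<forall>t\<ge>0. \<forall>u\<in>{0..1}.
        f (u * s + (1 - u) * t) \<le> ereal u * f s + ereal (1 - u) * f t)"

definition recession :: "(real \<Rightarrow> ereal) \<Rightarrow> ereal" where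
  "recession f = Lim at_top (\<lambda>u. f u / ereal u)"

definition lebesgue_decomposition ::
  "'a measure \<Rightarrow> 'a measure \<Rightarrow> 'a measure \<Rightarrow> 'a measure \<Rightarrow> bool" where
  "lebesgue_decomposition P' P Pc Ps \<longleftrightarrow>
     sets Pc = sets P \<and> sets Ps = sets P \<and>
     (\<forall>A\<in>sets P. emeasure P A = emeasure Pc A + emeasure Ps A) \<and>
     absolutely_continuous P' Pc \<and>
     (\<exists>N\<in>null_sets P'. N \<in> sets Ps \<and> emeasure Ps (space Ps - N) = 0)"

(* For finite measures with the same sigma-algebra the pair (Pc, Ps) exists and is unique,
   so SOME makes no choice. *)
definition f_divergence :: "(real \<Rightarrow> ereal) \<Rightarrow> 'a measure \<Rightarrow> 'a measure \<Rightarrow> ereal" where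
  "f_divergence f P' P =
     (let (Pc, Ps) = (SOME (Pc, Ps). lebesgue_decomposition P' P Pc Ps)
      in ereal_integral P' (\<lambda>\<xi>. f (enn2real (RN_deriv P' Pc \<xi>)))
         + recession f * ereal (measure Ps (space Ps)))"

definition couplings :: "'a measure \<Rightarrow> 'a measure \<Rightarrow> ('a \<times> 'a) measure set" where
  "couplings P' P =
     {\<pi>. sets \<pi> = sets (P' \<Otimes>\<^sub>M P) \<and> distr \<pi> P' fst = P' \<and> distr \<pi> P snd = P}"

definition transport_cost ::
  "('a \<Rightarrow> 'a \<Rightarrow> real) \<Rightarrow> 'a measure \<Rightarrow> 'a measure \<Rightarrow> ennreal" where
  "transport_cost d P' P = (INF \<pi>\<in>couplings P' P. \<integral>\<^sup>+ (\<xi>', \<xi>). ennreal (d \<xi>' \<xi>) \<partial>\<pi>)"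

definition smoothed_divergence ::
  "'a::topological_space set \<Rightarrow> (real \<Rightarrow> ereal) \<Rightarrow> ('a \<Rightarrow> 'a \<Rightarrow> real) \<Rightarrow> real
     \<Rightarrow> 'a measure \<Rightarrow> 'a measure \<Rightarrow> ereal" where
  "smoothed_divergence S f d \<epsilon> P' P =
     Inf {f_divergence f Q P | Q. Q \<in> borel_probs S \<and> transport_cost d P' Q \<le> ennreal \<epsilon>}"

definition predictor ::
  "'a::topological_space set \<Rightarrow> (real \<Rightarrow> ereal) \<Rightarrow> ('a \<Rightarrow> 'a \<Rightarrow> real) \<Rightarrow> real \<Rightarrow> real
     \<Rightarrow> ('x \<Rightarrow> 'a \<Rightarrow> real) \<Rightarrow> 'x \<Rightarrow> 'a measure \<Rightarrow> ereal" where
  "predictor S f d \<epsilon> r loss x P' =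
     Sup {ereal (\<integral>\<xi>. loss x \<xi> \<partial>P) | P.
            P \<in> borel_probs S \<and> smoothed_divergence S f d \<epsilon> P' P \<le> ereal r}"

definition max_loss :: "'a set \<Rightarrow> ('x \<Rightarrow> 'a \<Rightarrow> real) \<Rightarrow> 'x \<Rightarrow> real" where
  "max_loss S loss x = (SUP \<xi>\<in>S. loss x \<xi>)"

definition inflated_loss ::
  "'a set \<Rightarrow> ('a \<Rightarrow> 'a \<Rightarrow> real) \<Rightarrow> ('x \<Rightarrow> 'a \<Rightarrow> real) \<Rightarrow> real \<Rightarrow> 'x \<Rightarrow> 'a \<Rightarrow> real" where
  "inflated_loss S d loss \<delta> x \<xi> = Sup {loss x \<xi>' | \<xi>'. \<xi>' \<in> S \<and> d \<xi> \<xi>' \<le> \<delta>}"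

(* The perspective "lam f*(a / lam)" of the convex conjugate, including lam = 0: since
   0 * \<infinity> = 0 in ereal, the value there is 0 for a \<le> 0 and \<infinity> for a > 0. *)
definition conjugate_perspective :: "(real \<Rightarrow> ereal) \<Rightarrow> real \<Rightarrow> real \<Rightarrow> ereal" where
  "conjugate_perspective f lam a = (SUP t\<in>{0..}. ereal (a * t) - ereal lam * f t)"

(* The constraint is spelled out as void for an infinite recession slope, because
   \<infinity> * 0 = 0 in ereal. The range \<Delta> of the inflation radius is a parameter. *)
definition dual_value ::
  "real set \<Rightarrow> 'a set \<Rightarrow> (real \<Rightarrow> ereal) \<Rightarrow> ('a \<Rightarrow> 'a \<Rightarrow> real) \<Rightarrow> real \<Rightarrow> real
     \<Rightarrow> ('x \<Rightarrow> 'a \<Rightarrow> real) \<Rightarrow> 'x \<Rightarrow> 'a measure \<Rightarrow> ereal" where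
  "dual_value \<Delta> S f d \<epsilon> r loss x P' =
     Inf {ereal_integral P' (\<lambda>\<xi>. SUP \<delta>\<in>\<Delta>.
              conjugate_perspective f lam (inflated_loss S d loss \<delta> x \<xi> - \<eta>) - ereal (\<delta> * \<gamma>))
            + ereal (r * lam + \<eta> + \<epsilon> * \<gamma>)
          | \<eta> lam \<gamma>. 0 \<le> lam \<and> 0 \<le> \<gamma> \<and>
              (recession f = \<infinity> \<or> ereal (max_loss S loss x - \<eta>) \<le> recession f * ereal lam)}"

end

theory Submission
  imports Defs
begin

text \<open>
  Both sides are compared through \<open>W t \<xi> \<xi>' = (l \<xi>' - \<eta>) t - \<lambda> f t - \<gamma> d \<xi> \<xi>'\<close>: the dual integrand is the
  supremum of \<open>W\<close> over \<open>t \<ge> 0\<close> and \<open>\<xi>' \<in> \<Sigma>\<close>, and by convexity of \<open>f\<close> positive rational \<open>t\<close> suffice.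

  For weak duality, integrate \<open>W\<close> at \<open>t = dP\<^sub>c/dQ\<close> against a nearly optimal coupling of the
  reference measure and \<open>Q\<close>; the constraint on \<open>\<eta>\<close> and \<open>\<lambda>\<close> absorbs the singular part of \<open>P\<close>.

  For strong duality, a primal candidate is given by a transport map \<open>T\<close>, a bounded density \<open>h\<close>
  and a mass \<open>m\<close> at a maximiser of the loss. Jensen's inequality, in the form of a subgradient of \<open>f\<close> at
  the actual density, shows that finite mixtures of candidates do not increase the divergence, so the
  attainable quadruples (objective, mass, divergence, cost) may be convexified and separated by a
  hyperplane in four dimensions; \<open>r > 0\<close> and \<open>\<epsilon> > 0\<close> provide the Slater point. Since \<open>W\<close> is upper
  semicontinuous in \<open>(\<xi>, \<xi>')\<close>, measurable maximisers of \<open>W t \<xi>\<close> exist, and letting finitely many of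
  them compete turns the separating inequality into a bound on the dual integral by monotone convergence.
\<close>

section \<open>Semicontinuity and measurable selection\<close>

text \<open>The primal unknowns are measures, but no compactness or minimax theorem on spaces of
  measures is used: convexity is needed only for the four recorded numbers, and the multipliers of
  mass, divergence and cost are \<open>\<eta>\<close>, \<open>lam\<close> and
  \<open>\<gamma>\<close>. The constraint on \<open>\<eta>\<close> and \<open>lam\<close> is what
  separation yields when the singular mass \<open>m\<close> may grow freely. Since \<open>f\<close>
  may be infinite at 0 and superlinear at infinity, candidate densities are kept between two
  positive constants; nothing is lost, because each positive rational \<open>t\<close> is admissible
  and these exhaust the dual integrand.

  Two obstacles remain. The point carrying \<open>m\<close> may also be charged by \<open>Q\<close>,
  and then \<open>m\<close> belongs to the absolutely continuous part; slopes of \<open>f\<close>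
  lie below its recession slope, so the price \<open>\<rho> * m\<close> still suffices. For
  \<open>\<epsilon> = 0\<close> there is no Slater point: zero-cost transport is given a fictitious
  budget 1, and the infimum may be approached only for large \<open>\<gamma>\<close>, after a small
  perturbation of \<open>\<eta>\<close> and \<open>lam\<close>.\<close>

lemma closed_sublevel_lsc:
  fixes f :: "'a::topological_space \<Rightarrow> 'b::linorder"
  assumes "closed S" "lsc_on S f"
  shows "closed {x\<in>S. f x \<le> c}"
proof -
  have "\<exists>T. open T \<and> x \<in> T \<and> T \<subseteq> - {x\<in>S. f x \<le> c}" if x: "x \<in> - {x\<in>S. f x \<le> c}" for x
  proof (cases "x \<in> S")
    case True
    then have "c < f x" using x by auto
    then have "\<forall>\<^sub>F y in at x within S. c < f y"
      using True assms(2) by (auto simp: lsc_on_def)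
    then obtain T where "open T" "x \<in> T" "\<forall>y\<in>T. y \<noteq> x \<longrightarrow> y \<in> S \<longrightarrow> c < f y"
      by (auto simp: eventually_at_topological)
    then show ?thesis using \<open>c < f x\<close> by (intro exI[of _ T]) (auto simp: not_le)
  next
    case False
    then show ?thesis using assms(1) by (intro exI[of _ "- S"]) auto
  qed
  then show ?thesis unfolding closed_def by (rule iffD2[OF open_subopen, OF ballI])
qed

lemma closed_superlevel_usc:
  fixes f :: "'a::topological_space \<Rightarrow> 'b::linorder"
  assumes "closed S" "usc_on S f"
  shows "closed {x\<in>S. c \<le> f x}"
proof -
  have "\<exists>T. open T \<and> x \<in> T \<and> T \<subseteq> - {x\<in>S. c \<le> f x}" if x: "x \<in> - {x\<in>S. c \<le> f x}" for x
  proof (cases "x \<in> S")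
    case True
    then have "f x < c" using x by auto
    then have "\<forall>\<^sub>F y in at x within S. f y < c"
      using True assms(2) by (auto simp: usc_on_def)
    then obtain T where "open T" "x \<in> T" "\<forall>y\<in>T. y \<noteq> x \<longrightarrow> y \<in> S \<longrightarrow> f y < c"
      by (auto simp: eventually_at_topological)
    then show ?thesis using \<open>f x < c\<close> by (intro exI[of _ T]) (auto simp: not_le)
  next
    case False
    then show ?thesis using assms(1) by (intro exI[of _ "- S"]) auto
  qed
  then show ?thesis unfolding closed_def by (rule iffD2[OF open_subopen, OF ballI])
qed

lemma closed_superlevel_scale:
  fixes u :: "'a::topological_space \<Rightarrow> real"
  assumes "\<And>c. closed {x\<in>S. c \<le> u x}" "0 < t"
  shows "closed {x\<in>S. c \<le> u x * t + b}"
proof -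
  have "{x\<in>S. c \<le> u x * t + b} = {x\<in>S. (c - b) / t \<le> u x}" using assms(2) by (auto simp: field_simps)
  then show ?thesis using assms(1) by simp
qed

text \<open>\<open>c \<le> u x + v x\<close> fails exactly when some real \<open>a\<close> lies
  strictly between \<open>u x\<close> and \<open>c - v x\<close>. The superlevel set of a sum is
  therefore an intersection, over all \<open>a\<close>, of unions of two closed superlevel
  sets.\<close>

lemma closed_superlevel_add:
  fixes u v :: "'a::topological_space \<Rightarrow> real"
  assumes u: "\<And>c. closed {x\<in>S. c \<le> u x}" and v: "\<And>c. closed {x\<in>S. c \<le> v x}"
  shows "closed {x\<in>S. c \<le> u x + v x}"
proof -
  have "{x\<in>S. c \<le> u x + v x} = (\<Inter>a. {x\<in>S. a \<le> u x} \<union> {x\<in>S. c - a \<le> v x})"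
  proof (intro equalityI subsetI)
    fix x assume "x \<in> {x\<in>S. c \<le> u x + v x}"
    then have "x \<in> S" "\<And>a. a \<le> u x \<or> c - a \<le> v x" by auto
    then show "x \<in> (\<Inter>a. {x\<in>S. a \<le> u x} \<union> {x\<in>S. c - a \<le> v x})" by blast
  next
    fix x assume x: "x \<in> (\<Inter>a. {x\<in>S. a \<le> u x} \<union> {x\<in>S. c - a \<le> v x})"
    then have "x \<in> S" by auto
    moreover have "c \<le> u x + v x"
    proof (rule ccontr)
      assume "\<not> c \<le> u x + v x"
      then obtain a where "u x < a" "a < c - v x"
        using dense[of "u x" "c - v x"] by auto
      moreover have "a \<le> u x \<or> c - a \<le> v x" using x by blast
      ultimately show False by linarith
    qed
    ultimately show "x \<in> {x\<in>S. c \<le> u x + v x}" by auto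
  qed
  then show ?thesis using u v by (auto intro!: closed_INT closed_Un)
qed

text \<open>The sets \<open>{x\<in>K. u y \<le> u x}\<close> are closed, and finitely many of them
  share the best of the finitely many \<open>y\<close>, so compactness gives a common point. Only
  superlevel sets enter, hence the values may lie in any linear order.\<close>

lemma attains_max:
  fixes u :: "'a::t2_space \<Rightarrow> 'b::linorder"
  assumes "compact K" "K \<noteq> {}" and cl: "\<And>c. closed {x\<in>K. c \<le> u x}"
  shows "\<exists>x\<in>K. \<forall>y\<in>K. u y \<le> u x"
proof -
  have "K \<inter> (\<Inter>y\<in>K. {x\<in>K. u y \<le> u x}) \<noteq> {}"
  proof (rule compact_imp_fip_image[OF assms(1)])
    show "closed {x\<in>K. u y \<le> u x}" if "y \<in> K" for y by (rule cl)
  next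
    fix I assume I: "finite I" "I \<subseteq> K"
    show "K \<inter> (\<Inter>y\<in>I. {x\<in>K. u y \<le> u x}) \<noteq> {}"
    proof (cases "I = {}")
      case False
      then have "Max (u ` I) \<in> u ` I" using I(1) by (intro Max_in) simp_all
      then obtain m where "Max (u ` I) = u m" "m \<in> I" by (rule imageE)
      then have "u y \<le> u m" if "y \<in> I" for y using Max_ge[of "u ` I" "u y"] I that by simp
      then have "m \<in> K \<inter> (\<Inter>y\<in>I. {x\<in>K. u y \<le> u x})" using I \<open>m \<in> I\<close> by blast
      then show ?thesis by (rule ex_in_conv[THEN iffD1, OF exI])
    qed (simp add: assms(2))
  qed
  then obtain x where "x \<in> K" "x \<in> (\<Inter>y\<in>K. {x\<in>K. u y \<le> u x})" by (meson IntE ex_in_conv)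
  then show ?thesis by (intro bexI[of _ x]) simp_all
qed

section \<open>Measurable selection from compact-valued correspondences\<close>

text \<open>Measurability is tested on closed sets because the argmin step cuts with closed
  half-spaces and the selection step uses complements of open sets.\<close>

definition compact_correspondence :: "'b measure \<Rightarrow> ('b \<Rightarrow> 'a::topological_space set) \<Rightarrow> bool" where
  "compact_correspondence M A \<longleftrightarrow> (\<forall>x\<in>space M. A x \<noteq> {} \<and> compact (A x)) \<and>
     (\<forall>K. closed K \<longrightarrow> {x\<in>space M. A x \<inter> K = {}} \<in> sets M)"

text \<open>The minimisers miss \<open>K\<close> iff the minimum of \<open>y \<bullet> b\<close>
  over \<open>A x\<close> is strictly below its minimum over \<open>A x \<inter> K\<close>, the
  latter counting as infinite when the intersection is empty. A rational \<open>q\<close> in the gap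
  turns this into a countable condition on how \<open>A x\<close> meets the closed sets
  \<open>K \<inter> H q\<close> and \<open>H q\<close>.\<close>

lemma compact_correspondence_argmin:
  fixes A :: "'b \<Rightarrow> 'a::euclidean_space set"
  assumes A: "compact_correspondence M A"
  shows "compact_correspondence M (\<lambda>x. {y\<in>A x. \<forall>z\<in>A x. y \<bullet> b \<le> z \<bullet> b})"
proof -
  have ne: "A x \<noteq> {}" and cp: "compact (A x)" if "x \<in> space M" for x
    using A that unfolding compact_correspondence_def by blast+
  have ms: "{x\<in>space M. A x \<inter> K = {}} \<in> sets M" if "closed K" for K
    using A that unfolding compact_correspondence_def by blast
  define B where "B x = {y\<in>A x. \<forall>z\<in>A x. y \<bullet> b \<le> z \<bullet> b}" for x
  define H where "H q = {y::'a. y \<bullet> b \<le> q}" for q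
  have clH: "closed (H q)" for q
    unfolding H_def by (intro closed_Collect_le continuous_intros)
  have min_ex: "\<exists>y\<in>C. \<forall>z\<in>C. y \<bullet> b \<le> z \<bullet> b" if "compact C" "C \<noteq> {}" for C :: "'a set"
  proof (rule continuous_attains_inf[OF that])
    show "continuous_on C (\<lambda>y. y \<bullet> b)" by (intro continuous_intros)
  qed
  have neB: "B x \<noteq> {}" if "x \<in> space M" for x
    using min_ex[OF cp[OF that] ne[OF that]] by (auto simp: B_def)
  have cpB: "compact (B x)" if "x \<in> space M" for x
  proof -
    have "B x = A x \<inter> (\<Inter>z\<in>A x. H (z \<bullet> b))" by (auto simp: B_def H_def)
    then show ?thesis using cp[OF that] clH by (simp add: compact_Int_closed closed_INT)
  qed
  have "{x\<in>space M. B x \<inter> K = {}} \<in> sets M" if K: "closed K" for K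
  proof -
    have iff: "B x \<inter> K = {} \<longleftrightarrow> (\<exists>q\<in>\<rat>. A x \<inter> (K \<inter> H q) = {} \<and> A x \<inter> H q \<noteq> {})"
      if xs: "x \<in> space M" for x
    proof
      assume x: "B x \<inter> K = {}"
      obtain y where y: "y \<in> A x" "\<And>z. z \<in> A x \<Longrightarrow> y \<bullet> b \<le> z \<bullet> b"
        using min_ex[OF cp[OF xs] ne[OF xs]] by blast
      have yB: "y \<in> B x" using y by (simp add: B_def)
      show "\<exists>q\<in>\<rat>. A x \<inter> (K \<inter> H q) = {} \<and> A x \<inter> H q \<noteq> {}"
      proof (cases "A x \<inter> K = {}")
        case True
        obtain q where "q \<in> \<rat>" "y \<bullet> b < q" "q < y \<bullet> b + 1"
          using Rats_dense_in_real[of "y \<bullet> b" "y \<bullet> b + 1"] by auto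
        moreover have "y \<in> A x \<inter> H q" using y(1) calculation by (simp add: H_def)
        ultimately show ?thesis using True by blast
      next
        case False
        have "compact (A x \<inter> K)" using cp[OF xs] K by (rule compact_Int_closed)
        then obtain w where w: "w \<in> A x \<inter> K" "\<And>z. z \<in> A x \<inter> K \<Longrightarrow> w \<bullet> b \<le> z \<bullet> b"
          using min_ex[OF _ False] by blast
        have "y \<bullet> b < w \<bullet> b"
        proof (rule ccontr)
          assume "\<not> y \<bullet> b < w \<bullet> b"
          then have "\<And>z. z \<in> A x \<Longrightarrow> w \<bullet> b \<le> z \<bullet> b" using y(2) by (meson not_less order_trans)
          then have "w \<in> B x \<inter> K" using w(1) by (simp add: B_def)
          then show False using x by blast
        qed
        then obtain q where q: "q \<in> \<rat>" "y \<bullet> b < q" "q < w \<bullet> b"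
          using Rats_dense_in_real by blast
        have "z \<notin> A x \<inter> (K \<inter> H q)" for z using w(2)[of z] q(3) by (auto simp: H_def)
        moreover have "y \<in> A x \<inter> H q" using y q by (simp add: H_def)
        ultimately show ?thesis using q(1) by blast
      qed
    next
      assume "\<exists>q\<in>\<rat>. A x \<inter> (K \<inter> H q) = {} \<and> A x \<inter> H q \<noteq> {}"
      then obtain q z where q: "A x \<inter> (K \<inter> H q) = {}" "z \<in> A x" "z \<in> H q" by blast
      have "y \<notin> K" if "y \<in> B x" for y
      proof -
        have "y \<in> A x" "y \<bullet> b \<le> z \<bullet> b" using that q(2) by (simp_all add: B_def)
        then have "y \<in> A x \<inter> H q" using q(3) by (simp add: H_def)
        then show ?thesis using q(1) by blast
      qed
      then show "B x \<inter> K = {}" by blast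
    qed
    have "{x\<in>space M. B x \<inter> K = {}} =
      {x\<in>space M. \<exists>q\<in>\<rat>. A x \<inter> (K \<inter> H q) = {} \<and> A x \<inter> H q \<noteq> {}}"
      by (intro Collect_cong conj_cong refl iff)
    also have "\<dots> = (\<Union>q\<in>\<rat>. {x\<in>space M. A x \<inter> (K \<inter> H q) = {}} - {x\<in>space M. A x \<inter> H q = {}})"
      by blast
    also have "\<dots> \<in> sets M"
      by (intro sets.countable_UN'[OF countable_rat] image_subsetI sets.Diff ms closed_Int K clH)
    finally show ?thesis .
  qed
  then show ?thesis using neB cpB unfolding compact_correspondence_def B_def by blast
qed

text \<open>Successively minimising the coordinates along all basis vectors shrinks each fibre to a
  single point.\<close>

lemma compact_correspondence_selection:
  fixes A :: "'b \<Rightarrow> 'a::euclidean_space set"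
  assumes "compact_correspondence M A"
  obtains T where "T \<in> borel_measurable M" "\<And>x. x \<in> space M \<Longrightarrow> T x \<in> A x"
proof -
  have "\<exists>A'. compact_correspondence M A' \<and> (\<forall>x. A' x \<subseteq> A x) \<and>
          (\<forall>x y z b. y \<in> A' x \<longrightarrow> z \<in> A' x \<longrightarrow> b \<in> B \<longrightarrow> y \<bullet> b = z \<bullet> b)" if "finite B" for B
    using that
  proof (induction B rule: finite_induct)
    case empty
    show ?case using assms by blast
  next
    case (insert b B)
    then obtain A' where A': "compact_correspondence M A'" "\<And>x. A' x \<subseteq> A x"
      and eq: "\<And>x y z b. y \<in> A' x \<Longrightarrow> z \<in> A' x \<Longrightarrow> b \<in> B \<Longrightarrow> y \<bullet> b = z \<bullet> b"
      by metis
    show ?case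
    proof (intro exI[of _ "\<lambda>x. {y\<in>A' x. \<forall>z\<in>A' x. y \<bullet> b \<le> z \<bullet> b}"] conjI allI impI)
      fix x y z c
      assume "y \<in> {y\<in>A' x. \<forall>z\<in>A' x. y \<bullet> b \<le> z \<bullet> b}" "z \<in> {y\<in>A' x. \<forall>z\<in>A' x. y \<bullet> b \<le> z \<bullet> b}"
        and c: "c \<in> insert b B"
      then have "y \<in> A' x" "z \<in> A' x" "y \<bullet> b \<le> z \<bullet> b" "z \<bullet> b \<le> y \<bullet> b" by blast+
      then show "y \<bullet> c = z \<bullet> c" using c eq[of y x z c] by (auto intro: antisym)
    qed (use A'(2) compact_correspondence_argmin[OF A'(1)] in blast)+
  qed
  from this[OF finite_Basis] obtain A' where A': "compact_correspondence M A'" "\<And>x. A' x \<subseteq> A x"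
    and eq: "\<And>x y z b. y \<in> A' x \<Longrightarrow> z \<in> A' x \<Longrightarrow> b \<in> Basis \<Longrightarrow> y \<bullet> b = z \<bullet> b"
    by metis
  define T where "T x = (SOME y. y \<in> A' x)" for x
  have T: "T x \<in> A' x" if "x \<in> space M" for x
    using A'(1) that unfolding T_def some_in_eq compact_correspondence_def by blast
  have uniq: "y = T x" if "x \<in> space M" "y \<in> A' x" for x y
    by (rule euclidean_eqI) (rule eq[OF that(2) T[OF that(1)]])
  have "T \<in> borel_measurable M"
  proof (rule borel_measurableI)
    fix U :: "'a set" assume "open U"
    have "T -` U \<inter> space M = {x\<in>space M. A' x \<inter> - U = {}}"
    proof (intro equalityI subsetI)
      fix x assume "x \<in> T -` U \<inter> space M"
      then have "x \<in> space M" "T x \<in> U" by auto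
      then show "x \<in> {x\<in>space M. A' x \<inter> - U = {}}" using uniq by blast
    qed (use T in blast)
    then show "T -` U \<inter> space M \<in> sets M"
      using A'(1) \<open>open U\<close> unfolding compact_correspondence_def by (simp add: closed_Compl)
  qed
  then show ?thesis using T A'(2) by (intro that[of T]) blast+
qed

section \<open>Extended real integrals and decompositions of measures\<close>

lemma enn2ereal_eq_top_iff: "enn2ereal a = \<infinity> \<longleftrightarrow> a = top"
  by (cases a) auto

lemma ereal_integral_cong_AE:
  assumes "AE x in M. g x = h x"
  shows "ereal_integral M g = ereal_integral M h"
  unfolding ereal_integral_def
  by (intro arg_cong2[of _ _ _ _ "(-)"] arg_cong[of _ _ enn2ereal] nn_integral_cong_AE)
     (use assms in \<open>auto elim: eventually_mono\<close>)

lemma ereal_integral_ereal: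
  assumes "integrable M u"
  shows "ereal_integral M (\<lambda>x. ereal (u x)) = ereal (\<integral>x. u x \<partial>M)"
proof -
  have fin: "(\<integral>\<^sup>+x. ennreal (u x) \<partial>M) \<noteq> \<infinity>" "(\<integral>\<^sup>+x. ennreal (- u x) \<partial>M) \<noteq> \<infinity>"
    using assms unfolding real_integrable_def by simp_all
  obtain a b where ab: "a \<ge> 0" "(\<integral>\<^sup>+x. ennreal (u x) \<partial>M) = ennreal a"
      "b \<ge> 0" "(\<integral>\<^sup>+x. ennreal (- u x) \<partial>M) = ennreal b"
    using fin by (metis ennreal_cases infinity_ennreal_def)
  then have "(\<integral>x. u x \<partial>M) = a - b"
    using real_lebesgue_integral_def[OF assms] by simp
  then show ?thesis
    using ab unfolding ereal_integral_def by (simp add: enn2ereal_ennreal)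
qed

text \<open>Turns an extended-valued integrand into a real integrable one. The minorant
  \<open>u\<close> bounds the negative part, so an infinite positive part would make the extended
  integral \<open>\<infinity>\<close>, contrary to \<open>fin\<close>.\<close>

lemma ereal_integral_bounded_below:
  assumes g: "g \<in> borel_measurable M" and u: "integrable M u"
    and le: "AE x in M. ereal (u x) \<le> g x" and fin: "ereal_integral M g \<noteq> \<infinity>"
  obtains v where "integrable M v" "AE x in M. g x = ereal (v x)"
    "ereal_integral M g = ereal (\<integral>x. v x \<partial>M)"
proof -
  have "(\<integral>\<^sup>+x. e2ennreal (- g x) \<partial>M) \<le> (\<integral>\<^sup>+x. ennreal (- u x) \<partial>M)"
  proof (rule nn_integral_mono_AE, use le in eventually_elim)
    fix x assume "ereal (u x) \<le> g x"
    then have "e2ennreal (- g x) \<le> e2ennreal (- ereal (u x))"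
      by (intro e2ennreal_mono) (cases "g x", auto)
    then show "e2ennreal (- g x) \<le> ennreal (- u x)" by simp
  qed
  also have "\<dots> < \<infinity>" using u unfolding real_integrable_def by (simp add: top.not_eq_extremum)
  finally have neg: "(\<integral>\<^sup>+x. e2ennreal (- g x) \<partial>M) \<noteq> \<infinity>" by simp
  have pos: "(\<integral>\<^sup>+x. e2ennreal (g x) \<partial>M) \<noteq> \<infinity>"
  proof
    assume "(\<integral>\<^sup>+x. e2ennreal (g x) \<partial>M) = \<infinity>"
    moreover have "enn2ereal (\<integral>\<^sup>+x. e2ennreal (- g x) \<partial>M) \<noteq> \<infinity>"
      using neg by (simp add: enn2ereal_eq_top_iff)
    ultimately show False using fin unfolding ereal_integral_def
      by (cases "enn2ereal (\<integral>\<^sup>+x. e2ennreal (- g x) \<partial>M)") auto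
  qed
  have meas: "(\<lambda>x. e2ennreal (g x)) \<in> borel_measurable M" using g by measurable
  define v where "v x = real_of_ereal (g x)" for x
  have "AE x in M. e2ennreal (g x) \<noteq> \<infinity>" by (rule nn_integral_noteq_infinite[OF meas pos])
  with le have eq: "AE x in M. g x = ereal (v x)"
  proof eventually_elim
    fix x assume "ereal (u x) \<le> g x" "e2ennreal (g x) \<noteq> \<infinity>"
    then show "g x = ereal (v x)" unfolding v_def by (cases "g x") auto
  qed
  have eqI: "(\<integral>\<^sup>+x. ennreal (v x) \<partial>M) = (\<integral>\<^sup>+x. e2ennreal (g x) \<partial>M)"
    "(\<integral>\<^sup>+x. ennreal (- v x) \<partial>M) = (\<integral>\<^sup>+x. e2ennreal (- g x) \<partial>M)"
    by (rule nn_integral_cong_AE, use eq in \<open>auto elim!: eventually_mono\<close>)+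
  have "v \<in> borel_measurable M" unfolding v_def using g by measurable
  then have v: "integrable M v" unfolding real_integrable_def using pos neg eqI by simp
  show ?thesis
  proof (rule that[OF v eq])
    show "ereal_integral M g = ereal (\<integral>x. v x \<partial>M)"
      using ereal_integral_cong_AE[OF eq] ereal_integral_ereal[OF v] by simp
  qed
qed

text \<open>Monotone convergence is applied to the nonnegative increments \<open>G n - G 0\<close>.
  The bound \<open>B\<close> makes their supremum almost everywhere finite, so \<open>g\<close>
  agrees almost everywhere with a real function and the real-valued theorem applies.\<close>

lemma ereal_integral_SUP_le:
  fixes G :: "nat \<Rightarrow> 'a \<Rightarrow> real"
  assumes int: "\<And>n. integrable M (G n)" and mono: "\<And>x. x \<in> space M \<Longrightarrow> mono (\<lambda>n. G n x)"
    and le: "\<And>n. (\<integral>x. G n x \<partial>M) \<le> B"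
    and g: "\<And>x. x \<in> space M \<Longrightarrow> g x = (SUP n. ereal (G n x))"
  shows "ereal_integral M g \<le> ereal B"
proof -
  note [measurable] = borel_measurable_integrable[OF int]
  have inc: "G 0 x \<le> G n x" if "x \<in> space M" for n x using monoD[OF mono[OF that], of 0 n] by simp
  have incI: "(\<integral>x. G m x \<partial>M) \<le> (\<integral>x. G n x \<partial>M)" if "m \<le> n" for m n
    using monoD[OF mono that] by (intro integral_mono int) simp
  have "(\<integral>\<^sup>+x. (SUP n. ennreal (G n x - G 0 x)) \<partial>M) = (SUP n. \<integral>\<^sup>+x. ennreal (G n x - G 0 x) \<partial>M)"
    by (rule nn_integral_monotone_convergence_SUP_AE)
       (auto intro!: AE_I2 ennreal_leI simp: monoD[OF mono])
  also have "\<dots> \<le> ennreal (B - (\<integral>x. G 0 x \<partial>M))"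
  proof (rule SUP_least)
    fix n
    have "(\<integral>\<^sup>+x. ennreal (G n x - G 0 x) \<partial>M) = ennreal (\<integral>x. G n x - G 0 x \<partial>M)"
      using int inc by (intro nn_integral_eq_integral) (auto intro!: AE_I2)
    also have "(\<integral>x. G n x - G 0 x \<partial>M) = (\<integral>x. G n x \<partial>M) - (\<integral>x. G 0 x \<partial>M)"
      by (rule Bochner_Integration.integral_diff[OF int int])
    finally show "(\<integral>\<^sup>+x. ennreal (G n x - G 0 x) \<partial>M) \<le> ennreal (B - (\<integral>x. G 0 x \<partial>M))"
      using le[of n] by (simp add: ennreal_leI)
  qed
  also have "\<dots> < \<infinity>" by simp
  finally have fin: "(\<integral>\<^sup>+x. (SUP n. ennreal (G n x - G 0 x)) \<partial>M) \<noteq> \<infinity>" by simp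
  have "AE x in M. (SUP n. ennreal (G n x - G 0 x)) \<noteq> \<infinity>"
    by (rule nn_integral_noteq_infinite[OF _ fin]) measurable
  then have lim: "AE x in M. g x = ereal (real_of_ereal (g x)) \<and> (\<lambda>n. G n x) \<longlonglongrightarrow> real_of_ereal (g x)"
  proof (rule AE_mp, intro AE_I2 impI)
    fix x assume x: "x \<in> space M" and "(SUP n. ennreal (G n x - G 0 x)) \<noteq> \<infinity>"
    then obtain b where b: "b \<ge> 0" "(SUP n. ennreal (G n x - G 0 x)) = ennreal b"
      by (metis ennreal_cases infinity_ennreal_def)
    have "G n x \<le> b + G 0 x" for n
    proof -
      have "ennreal (G n x - G 0 x) \<le> ennreal b"
        using SUP_upper[of n UNIV "\<lambda>n. ennreal (G n x - G 0 x)"] b by simp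
      then show ?thesis using b(1) by (simp add: ennreal_le_iff)
    qed
    then have "g x \<le> ereal (b + G 0 x)" unfolding g[OF x] by (intro SUP_least) simp
    moreover have "ereal (G 0 x) \<le> g x" unfolding g[OF x] by (intro SUP_upper) simp
    ultimately have e: "g x = ereal (real_of_ereal (g x))" by (cases "g x") auto
    have "(\<lambda>n. ereal (G n x)) \<longlonglongrightarrow> g x"
      unfolding g[OF x] using mono[OF x] by (intro LIMSEQ_SUP) (auto simp: mono_def)
    then have "(\<lambda>n. ereal (G n x)) \<longlonglongrightarrow> ereal (real_of_ereal (g x))" by (simp only: e[symmetric])
    from lim_real_of_ereal[OF this]
    show "g x = ereal (real_of_ereal (g x)) \<and> (\<lambda>n. G n x) \<longlonglongrightarrow> real_of_ereal (g x)"
      by (intro conjI e) simp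
  qed
  have gm: "g \<in> borel_measurable M"
  proof (subst measurable_cong[OF g])
    show "(\<lambda>x. SUP n. ereal (G n x)) \<in> borel_measurable M" by measurable
  qed
  define I where "I = (SUP n. \<integral>x. G n x \<partial>M)"
  have bdd: "bdd_above (range (\<lambda>n. \<integral>x. G n x \<partial>M))" using le by (auto simp: bdd_above_def)
  have I: "(\<lambda>n. \<integral>x. G n x \<partial>M) \<longlonglongrightarrow> I"
    unfolding I_def using incI by (intro LIMSEQ_incseq_SUP[OF bdd]) (auto simp: incseq_def)
  have 1: "AE x in M. mono (\<lambda>n. G n x)" using mono by (intro AE_I2)
  have 2: "AE x in M. (\<lambda>n. G n x) \<longlonglongrightarrow> real_of_ereal (g x)" using lim by eventually_elim blast
  have 3: "(\<lambda>x. real_of_ereal (g x)) \<in> borel_measurable M" using gm by measurable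
  note integrable_monotone_convergence[OF int 1 2 I 3] integral_monotone_convergence[OF int 1 2 I 3]
  moreover have "ereal_integral M g = ereal_integral M (\<lambda>x. ereal (real_of_ereal (g x)))"
    by (rule ereal_integral_cong_AE, use lim in eventually_elim) blast
  moreover have "I \<le> B" unfolding I_def using le by (intro cSUP_least) auto
  ultimately show ?thesis by (simp add: ereal_integral_ereal)
qed

section \<open>Lebesgue decomposition and the divergence\<close>

text \<open>Exhaustion: among the \<open>Q\<close>-null sets there is one with the largest
  \<open>P\<close>-mass, and \<open>P\<close> is split along it.\<close>

lemma lebesgue_decomposition_exists:
  assumes "finite_measure Q" "finite_measure P" and sets: "sets P = sets Q"
  shows "\<exists>Pc Ps. lebesgue_decomposition Q P Pc Ps"
proof -
  interpret Q: finite_measure Q by fact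
  interpret P: finite_measure P by fact
  define s where "s = (SUP N\<in>null_sets Q. measure P N)"
  have bdd: "bdd_above (measure P ` null_sets Q)"
    using P.bounded_measure by (auto simp: bdd_above_def)
  have ne: "null_sets Q \<noteq> {}" by auto
  have up: "measure P N \<le> s" if "N \<in> null_sets Q" for N
    unfolding s_def by (rule cSUP_upper[OF that bdd])
  have "\<exists>N\<in>null_sets Q. s - inverse (real (Suc n)) < measure P N" for n
    using less_cSUP_iff[OF ne bdd, of "s - inverse (real (Suc n))"] by (simp add: s_def[symmetric])
  then obtain Nn where Nn: "\<And>n. Nn n \<in> null_sets Q" "\<And>n. s - inverse (real (Suc n)) < measure P (Nn n)"
    by metis
  \<comment> \<open>A countable union of null sets is null, so the union of a maximising sequence
    attains the supremum \<open>s\<close>.\<close>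
  define N where "N = (\<Union>n. Nn n)"
  have N: "N \<in> null_sets Q" unfolding N_def using Nn by (intro null_sets_UN) auto
  then have NP: "N \<in> sets P" using sets by auto
  have "s \<le> measure P N"
  proof (rule field_le_epsilon)
    fix e :: real assume "0 < e"
    then obtain n where n: "inverse (real (Suc n)) < e" using reals_Archimedean by blast
    have "measure P (Nn n) \<le> measure P N"
      using NP by (intro P.finite_measure_mono) (auto simp: N_def)
    then show "s \<le> measure P N + e" using Nn(2)[of n] n by linarith
  qed
  \<comment> \<open>A null set charging the complement of \<open>N\<close> could be added to
    \<open>N\<close> and would exceed \<open>s\<close>; this is the absolute continuity of
    \<open>P\<close> off \<open>N\<close>.\<close>
  then have max: "measure P (A - N) = 0" if "A \<in> null_sets Q" for A
  proof -
    have A: "A - N \<in> sets P" using that NP sets by auto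
    have "N \<union> (A - N) \<in> null_sets Q" using that N null_sets.Un[OF N, of A] by (simp add: Un_commute)
    moreover have "measure P (N \<union> (A - N)) = measure P N + measure P (A - N)"
      by (intro P.finite_measure_Union NP A) auto
    ultimately show ?thesis using up[of "N \<union> (A - N)"] \<open>s \<le> measure P N\<close>
        measure_nonneg[of P "A - N"] by linarith
  qed
  define Pc where "Pc = density P (indicator (space P - N))"
  define Ps where "Ps = density P (indicator N)"
  have Pc: "emeasure Pc A = emeasure P (A - N)" if "A \<in> sets P" for A
    using that NP sets.sets_into_space[OF that] unfolding Pc_def
    by (subst emeasure_restricted) (auto intro!: arg_cong[of _ _ "emeasure P"])
  have Ps: "emeasure Ps A = emeasure P (N \<inter> A)" if "A \<in> sets P" for A
    using that NP unfolding Ps_def by (subst emeasure_restricted) auto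
  have "lebesgue_decomposition Q P Pc Ps"
    unfolding lebesgue_decomposition_def
  proof (intro conjI ballI bexI[OF _ N])
    show "emeasure P A = emeasure Pc A + emeasure Ps A" if "A \<in> sets P" for A
      using that NP by (simp add: Pc Ps plus_emeasure)
         (subst plus_emeasure, auto intro!: arg_cong[of _ _ "emeasure P"])
    show "absolutely_continuous Q Pc" unfolding absolutely_continuous_def
    proof
      fix A assume A: "A \<in> null_sets Q"
      then have "A \<in> sets P" using sets by auto
      moreover have "emeasure P (A - N) = 0" using max[OF A] by (simp add: P.emeasure_eq_measure)
      ultimately show "A \<in> null_sets Pc" using Pc[of A] by (auto simp: null_sets_def Pc_def)
    qed
    show "N \<in> sets Ps" using NP by (simp add: Ps_def)
    have "emeasure Ps (space P - N) = emeasure P (N \<inter> (space P - N))" using NP by (intro Ps) auto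
    also have "N \<inter> (space P - N) = {}" by auto
    finally show "emeasure Ps (space Ps - N) = 0" by (simp add: Ps_def)
  qed (simp_all add: Pc_def Ps_def)
  then show ?thesis by blast
qed

text \<open>\<open>f_divergence\<close> uses whichever pair \<open>SOME\<close> returns, so the
  shape is derived for an arbitrary decomposition. The \<open>Q\<close>-null set carrying
  \<open>Ps\<close> is also null for \<open>Pc\<close>; hence \<open>Pc\<close> is \<open>P\<close>
  restricted to its complement and \<open>Ps\<close> has the mass of \<open>P\<close> on it.\<close>

lemma lebesgue_decomposition_restrict:
  assumes dec: "lebesgue_decomposition Q P Pc Ps" and "finite_measure P" and sets: "sets P = sets Q"
  obtains N where "N \<in> null_sets Q" "Pc = density P (indicator (space P - N))"
    "measure Ps (space Ps) = measure P N"
proof -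
  interpret P: finite_measure P by fact
  have sets_c: "sets Pc = sets P" and sets_s: "sets Ps = sets P"
    and add: "\<And>A. A \<in> sets P \<Longrightarrow> emeasure P A = emeasure Pc A + emeasure Ps A"
    and ac: "absolutely_continuous Q Pc"
    using dec unfolding lebesgue_decomposition_def by auto
  obtain N where N: "N \<in> null_sets Q" "N \<in> sets Ps" "emeasure Ps (space Ps - N) = 0"
    using dec unfolding lebesgue_decomposition_def by auto
  have NP: "N \<in> sets P" using N(2) sets_s by simp
  have sp: "space Ps = space P" "space Pc = space P" using sets_c sets_s by (auto dest: sets_eq_imp_space_eq)
  have Pc_N: "emeasure Pc N = 0"
    using ac N(1) unfolding absolutely_continuous_def by (auto dest: null_setsD1)
  have Ps_off: "emeasure Ps (A - N) = 0" if "A \<in> sets P" for A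
  proof -
    have "emeasure Ps (A - N) \<le> emeasure Ps (space Ps - N)"
      using that NP sets_s sets.sets_into_space[OF that] sp by (intro emeasure_mono) auto
    then show ?thesis using N(3) by simp
  qed
  have Pc: "emeasure Pc A = emeasure P ((space P - N) \<inter> A)" if A: "A \<in> sets P" for A
  proof -
    have eq: "(space P - N) \<inter> A = A - N" using sets.sets_into_space[OF A] by auto
    have "emeasure Pc (A - N) = emeasure Pc A"
      using A NP sets_c Pc_N by (intro emeasure_Diff_null_set) (auto simp: null_sets_def)
    moreover have "emeasure P (A - N) = emeasure Pc (A - N) + emeasure Ps (A - N)"
      using A NP by (intro add) auto
    ultimately show ?thesis using Ps_off[OF A] eq by simp
  qed
  have "emeasure Ps (space Ps) = emeasure Ps (N \<union> (space Ps - N))"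
    using sets.sets_into_space[OF N(2)] by (intro arg_cong[of _ _ "emeasure Ps"]) auto
  also have "\<dots> = emeasure Ps N + emeasure Ps (space Ps - N)"
    using N(2) by (intro plus_emeasure[symmetric]) auto
  also have "\<dots> = emeasure P N" using N(3) add[OF NP] Pc_N by simp
  finally have "measure Ps (space Ps) = measure P N" by (simp add: measure_def)
  moreover have "Pc = density P (indicator (space P - N))"
  proof (rule measure_eqI)
    fix A assume "A \<in> sets Pc"
    then show "emeasure Pc A = emeasure (density P (indicator (space P - N))) A"
      using Pc[of A] NP sets_c by (subst emeasure_restricted) auto
  qed (simp add: sets_c)
  ultimately show ?thesis using N(1) by (intro that)
qed

lemma f_divergence_decomposition:
  assumes "finite_measure Q" "finite_measure P" "sets P = sets Q"
  obtains N Pc where "N \<in> null_sets Q" "Pc = density P (indicator (space P - N))"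
    "absolutely_continuous Q Pc" "f_divergence f Q P =
      ereal_integral Q (\<lambda>\<xi>. f (enn2real (RN_deriv Q Pc \<xi>))) + recession f * ereal (measure P N)"
proof -
  define p where "p = (SOME (Pc, Ps). lebesgue_decomposition Q P Pc Ps)"
  have "\<exists>p. case p of (Pc, Ps) \<Rightarrow> lebesgue_decomposition Q P Pc Ps"
    using lebesgue_decomposition_exists[OF assms] by auto
  then have "case p of (Pc, Ps) \<Rightarrow> lebesgue_decomposition Q P Pc Ps"
    unfolding p_def by (rule someI_ex)
  moreover obtain Pc Ps where p: "p = (Pc, Ps)" by (cases p)
  ultimately have dec: "lebesgue_decomposition Q P Pc Ps" by simp
  obtain N where N: "N \<in> null_sets Q" "Pc = density P (indicator (space P - N))"
    "measure Ps (space Ps) = measure P N"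
    using lebesgue_decomposition_restrict[OF dec assms(2,3)] .
  show ?thesis
  proof (rule that[OF N(1,2)])
    show "absolutely_continuous Q Pc" using dec by (simp add: lebesgue_decomposition_def)
    show "f_divergence f Q P = ereal_integral Q (\<lambda>\<xi>. f (enn2real (RN_deriv Q Pc \<xi>))) + recession f * ereal (measure P N)"
      unfolding f_divergence_def p_def[symmetric] p using N(3) by simp
  qed
qed

section \<open>Sums of two measures\<close>

text \<open>Serves to build a primal candidate out of a pushforward with density and an
  atom.\<close>

lemma measure_sum_exists:
  assumes sets: "sets N2 = sets N1"
  obtains P where "sets P = sets N1" "\<And>A. A \<in> sets N1 \<Longrightarrow> emeasure P A = emeasure N1 A + emeasure N2 A"
proof
  let ?P = "measure_of (space N1) (sets N1) (\<lambda>A. emeasure N1 A + emeasure N2 A)"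
  show "sets ?P = sets N1" by simp
  show "emeasure ?P A = emeasure N1 A + emeasure N2 A" if "A \<in> sets N1" for A
  proof (rule emeasure_measure_of_sigma[OF sets.sigma_algebra_axioms _ _ that])
    show "countably_additive (sets N1) (\<lambda>A. emeasure N1 A + emeasure N2 A)"
    proof (rule countably_additiveI)
      fix A :: "nat \<Rightarrow> 'a set"
      assume A: "range A \<subseteq> sets N1" "disjoint_family A"
      then show "(\<Sum>i. emeasure N1 (A i) + emeasure N2 (A i)) = emeasure N1 (\<Union>i. A i) + emeasure N2 (\<Union>i. A i)"
        using sets by (subst suminf_add[symmetric]) (auto simp: suminf_emeasure)
    qed
  qed (simp add: positive_def)
qed

lemma nn_integral_measure_sum:
  assumes sets: "sets N1 = sets P" "sets N2 = sets P"
    and sum: "\<And>A. A \<in> sets P \<Longrightarrow> emeasure P A = emeasure N1 A + emeasure N2 A"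
    and u: "u \<in> borel_measurable P"
  shows "(\<integral>\<^sup>+x. u x \<partial>P) = (\<integral>\<^sup>+x. u x \<partial>N1) + (\<integral>\<^sup>+x. u x \<partial>N2)"
proof -
  have space: "space N1 = space P" "space N2 = space P" using sets by (auto dest: sets_eq_imp_space_eq)
  have m: "v \<in> borel_measurable N1" "v \<in> borel_measurable N2" if "v \<in> borel_measurable P" for v :: "'a \<Rightarrow> ennreal"
    using that by (simp_all add: measurable_cong_sets[OF sets(1) refl] measurable_cong_sets[OF sets(2) refl])
  show ?thesis using u
  proof (induction rule: borel_measurable_induct)
    case (cong v w)
    have "(\<integral>\<^sup>+x. v x \<partial>N) = (\<integral>\<^sup>+x. w x \<partial>N)" if "space N = space P" for N
      using cong(3) that by (intro nn_integral_cong) auto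
    then show ?case using space cong(4) by simp
  next
    case (set A)
    then show ?case using sets sum by simp
  next
    case (mult v c)
    then show ?case using m[OF mult(2)] by (simp add: nn_integral_cmult distrib_left)
  next
    case (add v w)
    have e: "(\<integral>\<^sup>+x. w x + v x \<partial>N) = (\<integral>\<^sup>+x. w x \<partial>N) + (\<integral>\<^sup>+x. v x \<partial>N)"
      if "v \<in> borel_measurable N" "w \<in> borel_measurable N" for N
      by (rule nn_integral_add[OF that(2,1)])
    show ?case
      unfolding e[OF add.hyps(1,3)] e[OF m(1)[OF add.hyps(1)] m(1)[OF add.hyps(3)]]
        e[OF m(2)[OF add.hyps(1)] m(2)[OF add.hyps(3)]] add.IH by (simp only: ac_simps)
  next
    case (seq U)
    have mono: "incseq (\<lambda>i. \<integral>\<^sup>+x. U i x \<partial>N)" for N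
      using seq(3) by (auto simp: incseq_def le_fun_def intro!: nn_integral_mono)
    have eq: "(\<integral>\<^sup>+x. (SUP i. U i) x \<partial>N) = (SUP i. \<integral>\<^sup>+x. U i x \<partial>N)" if "\<And>i. U i \<in> borel_measurable N" for N
      unfolding SUP_apply by (rule nn_integral_monotone_convergence_SUP[OF seq(3) that])
    have "(SUP i. \<integral>\<^sup>+x. U i x \<partial>P) = (SUP i. (\<integral>\<^sup>+x. U i x \<partial>N1) + (\<integral>\<^sup>+x. U i x \<partial>N2))"
      by (simp only: seq.IH)
    also have "\<dots> = (SUP i. \<integral>\<^sup>+x. U i x \<partial>N1) + (SUP i. \<integral>\<^sup>+x. U i x \<partial>N2)"
      by (rule ennreal_SUP_add[OF mono mono])
    finally show ?case
      unfolding \<open>u = (SUP i. U i)\<close> eq[OF seq(1)] eq[OF m(1)[OF seq(1)]] eq[OF m(2)[OF seq(1)]] .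
  qed
qed

lemma integral_measure_sum:
  fixes u :: "'a \<Rightarrow> real"
  assumes sets: "sets N1 = sets P" "sets N2 = sets P"
    and sum: "\<And>A. A \<in> sets P \<Longrightarrow> emeasure P A = emeasure N1 A + emeasure N2 A"
    and u: "integrable N1 u" "integrable N2 u"
  shows "integrable P u" "(\<integral>x. u x \<partial>P) = (\<integral>x. u x \<partial>N1) + (\<integral>x. u x \<partial>N2)"
proof -
  have [measurable]: "u \<in> borel_measurable P"
    using borel_measurable_integrable[OF u(1)] by (simp add: measurable_cong_sets[OF sets(1) refl])
  have eq: "(\<integral>\<^sup>+x. ennreal (v x) \<partial>P) = (\<integral>\<^sup>+x. ennreal (v x) \<partial>N1) + (\<integral>\<^sup>+x. ennreal (v x) \<partial>N2)"
    if [measurable]: "v \<in> borel_measurable P" for v :: "'a \<Rightarrow> real"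
    by (rule nn_integral_measure_sum[OF sets sum]) auto
  have fin: "(\<integral>\<^sup>+x. ennreal (u x) \<partial>N1) < top" "(\<integral>\<^sup>+x. ennreal (u x) \<partial>N2) < top"
     "(\<integral>\<^sup>+x. ennreal (- u x) \<partial>N1) < top" "(\<integral>\<^sup>+x. ennreal (- u x) \<partial>N2) < top"
    using u unfolding real_integrable_def by (simp_all add: less_top)
  show "integrable P u" using fin unfolding real_integrable_def by (simp add: eq less_top)
  then show "(\<integral>x. u x \<partial>P) = (\<integral>x. u x \<partial>N1) + (\<integral>x. u x \<partial>N2)"
    using fin u by (simp add: real_lebesgue_integral_def eq enn2real_plus)
qed

section \<open>Lagrange multipliers\<close>

lemma nonneg_slope_if_ray_nonneg:
  fixes a b :: real
  assumes "\<And>s. 0 \<le> s \<Longrightarrow> 0 \<le> b + s * a"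
  shows "0 \<le> a"
proof (rule ccontr)
  assume "\<not> 0 \<le> a"
  \<comment> \<open>At this multiple the ray takes the value \<open>b - \<bar>b\<bar> - 1\<close>,
    which is negative.\<close>
  then have "0 \<le> b + ((\<bar>b\<bar> + 1) / (- a)) * a" by (intro assms divide_nonneg_pos) auto
  also have "((\<bar>b\<bar> + 1) / (- a)) * a = - (\<bar>b\<bar> + 1)" using \<open>\<not> 0 \<le> a\<close> by (simp add: field_simps)
  finally show False by linarith
qed

text \<open>The attainable vectors record objective, mass, divergence and transport cost; \<open>m\<close> is the
  singular mass, which is unavailable (flag \<open>b\<close>) when the recession slope is infinite.\<close>

lemma lagrange_multipliers:
  fixes C :: "(real \<times> real \<times> real \<times> real) set" and ob \<phi> :: "real \<Rightarrow> real"
  assumes conv: "convex C" and slater: "\<And>t. 0 < t \<Longrightarrow> (ob t, t, \<phi> t, 0) \<in> C" "\<phi> 1 = 0"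
    and r: "0 < r" and e: "0 < e"
    and bound: "\<And>x q v c m. (x, q, v, c) \<in> C \<Longrightarrow> 0 \<le> m \<Longrightarrow> (b \<longrightarrow> m = 0) \<Longrightarrow> q + m = 1 \<Longrightarrow>
      v + \<rho> * m \<le> r \<Longrightarrow> c \<le> e \<Longrightarrow> x + L * m \<le> V"
  obtains \<eta> lam \<gamma> where "0 \<le> lam" "0 \<le> \<gamma>" "\<not> b \<Longrightarrow> L - \<eta> \<le> \<rho> * lam"
    "\<And>x q v c. (x, q, v, c) \<in> C \<Longrightarrow> x - \<eta> * q - lam * v - \<gamma> * c + (r * lam + \<eta> + e * \<gamma>) \<le> V"
proof -
  \<comment> \<open>The first coordinate is the shortfall from \<open>V\<close>, the others are
    constraint residuals. The slacks make \<open>A\<close> upward closed in the coordinates of the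
    inequalities, and \<open>s3\<close> is strictly positive so that \<open>0 \<in> A\<close> would
    be a feasible point with value above \<open>V\<close>.\<close>
  define A where "A = {(V - x - L * m + s3, q - 1 + m, v - r + \<rho> * m + s1, c - e + s2) | x q v c m s1 s2 s3.
    (x, q, v, c) \<in> C \<and> 0 \<le> m \<and> (b \<longrightarrow> m = 0) \<and> 0 \<le> s1 \<and> 0 \<le> s2 \<and> 0 < s3}"
  have "convex A"
  proof (rule convexI)
    fix y y' u u' assume y: "y \<in> A" "y' \<in> A" and u: "0 \<le> (u::real)" "0 \<le> u'" "u + u' = 1"
    obtain x q v c m s1 s2 s3 where 1: "y = (V - x - L * m + s3, q - 1 + m, v - r + \<rho> * m + s1, c - e + s2)"
      "(x, q, v, c) \<in> C" "0 \<le> m" "b \<longrightarrow> m = 0" "0 \<le> s1" "0 \<le> s2" "0 < s3" using y(1) unfolding A_def by blast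
    obtain x' q' v' c' m' s1' s2' s3' where 2: "y' = (V - x' - L * m' + s3', q' - 1 + m', v' - r + \<rho> * m' + s1', c' - e + s2')"
      "(x', q', v', c') \<in> C" "0 \<le> m'" "b \<longrightarrow> m' = 0" "0 \<le> s1'" "0 \<le> s2'" "0 < s3'" using y(2) unfolding A_def by blast
    have u': "u' = 1 - u" using u by simp
    have s3: "0 < u * s3 + u' * s3'"
    proof (cases "u = 0")
      case False
      then show ?thesis using u 1(7) 2(7) by (intro add_pos_nonneg) auto
    qed (use u 2(7) in simp)
    have "u *\<^sub>R (x, q, v, c) + u' *\<^sub>R (x', q', v', c') \<in> C" using convexD[OF conv 1(2) 2(2) u] .
    then have C: "(u * x + u' * x', u * q + u' * q', u * v + u' * v', u * c + u' * c') \<in> C" by simp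
    have eq: "u *\<^sub>R y + u' *\<^sub>R y' =
      (V - (u * x + u' * x') - L * (u * m + u' * m') + (u * s3 + u' * s3'), (u * q + u' * q') - 1 + (u * m + u' * m'),
       (u * v + u' * v') - r + \<rho> * (u * m + u' * m') + (u * s1 + u' * s1'), (u * c + u' * c') - e + (u * s2 + u' * s2'))"
      unfolding 1(1) 2(1) u' by (simp add: algebra_simps)
    show "u *\<^sub>R y + u' *\<^sub>R y' \<in> A"
      unfolding eq A_def
    proof (intro CollectI exI conjI, rule refl)
      show "(u * x + u' * x', u * q + u' * q', u * v + u' * v', u * c + u' * c') \<in> C" by fact
      show "b \<longrightarrow> u * m + u' * m' = 0" using 1(4) 2(4) by simp
    qed (use u 1 2 s3 in \<open>simp_all\<close>)
  qed
  moreover have "0 \<notin> A"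
  proof
    assume "0 \<in> A"
    then obtain x q v c m s1 s2 s3 where
      0: "0 = (V - x - L * m + s3, q - 1 + m, v - r + \<rho> * m + s1, c - e + s2)" and
      1: "(x, q, v, c) \<in> C" "0 \<le> m" "b \<longrightarrow> m = 0" "0 \<le> s1" "0 \<le> s2" "0 < s3" unfolding A_def by blast
    have 2: "V - x - L * m + s3 = 0" "q - 1 + m = 0" "v - r + \<rho> * m + s1 = 0" "c - e + s2 = 0"
      using 0 by (simp_all only: zero_prod_def prod.inject)
    have "x + L * m \<le> V" by (rule bound[OF 1(1,2,3)]) (use 1(2,4-6) 2 in linarith)+
    then show False using 1(6) 2(1) by linarith
  qed
  ultimately obtain a where a: "a \<noteq> 0" "\<forall>y\<in>A. 0 \<le> inner a y" using separating_hyperplane_set_0 by blast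
  obtain \<tau> \<alpha> \<beta> \<kappa> where a_eq: "a = (\<tau>, \<alpha>, \<beta>, \<kappa>)" by (cases a)
  have main: "0 \<le> \<tau> * (V - x - L * m + s3) + \<alpha> * (q - 1 + m) + \<beta> * (v - r + \<rho> * m + s1) + \<kappa> * (c - e + s2)"
    if "(x, q, v, c) \<in> C" "0 \<le> m" "b \<longrightarrow> m = 0" "0 \<le> s1" "0 \<le> s2" "0 < s3" for x q v c m s1 s2 s3
  proof -
    have "(V - x - L * m + s3, q - 1 + m, v - r + \<rho> * m + s1, c - e + s2) \<in> A" unfolding A_def using that by blast
    then show ?thesis using a(2) by (fastforce simp: a_eq)
  qed
  have C1: "(ob 1, 1, 0, 0) \<in> C" using slater(1)[of 1] slater(2) by simp
  \<comment> \<open>Each sign follows by letting one slack tend to infinity at the Slater point of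
    density 1.\<close>
  have \<tau>: "0 \<le> \<tau>"
    by (rule nonneg_slope_if_ray_nonneg[of "\<tau> * (V - ob 1 + 1) + \<beta> * (- r) + \<kappa> * (- e)"])
       (use main[OF C1, of 0 0 0 "1 + _"] in \<open>simp add: algebra_simps\<close>)
  have \<beta>: "0 \<le> \<beta>"
    by (rule nonneg_slope_if_ray_nonneg[of "\<tau> * (V - ob 1 + 1) + \<beta> * (- r) + \<kappa> * (- e)"])
       (use main[OF C1, of 0 _ 0 1] in \<open>simp add: algebra_simps\<close>)
  have \<kappa>: "0 \<le> \<kappa>"
    by (rule nonneg_slope_if_ray_nonneg[of "\<tau> * (V - ob 1 + 1) + \<beta> * (- r) + \<kappa> * (- e)"])
       (use main[OF C1, of 0 0 _ 1] in \<open>simp add: algebra_simps\<close>)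
  \<comment> \<open>A vertical hyperplane is excluded: with \<open>\<tau> = 0\<close> the Slater
    slacks \<open>r\<close> and \<open>e\<close> force \<open>\<beta> = \<kappa> = 0\<close>, and
    the constant densities 2 and 1/2, whose masses lie on both sides of 1, force
    \<open>\<alpha> = 0\<close>.\<close>
  have \<tau>_pos: "0 < \<tau>"
  proof (rule ccontr)
    assume "\<not> 0 < \<tau>"
    then have \<tau>0: "\<tau> = 0" using \<tau> by simp
    have "0 \<le> - (\<beta> * r) - \<kappa> * e" using main[OF C1, of 0 0 0 1] \<tau>0 by simp
    moreover have "0 \<le> \<beta> * r" "0 \<le> \<kappa> * e" using \<beta> \<kappa> r e by simp_all
    ultimately have "\<beta> * r = 0" "\<kappa> * e = 0" by linarith+
    then have 0: "\<beta> = 0" "\<kappa> = 0" using r e by simp_all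
    have "0 \<le> \<alpha> * (2 - 1)" using main[OF slater(1)[of 2], of 0 0 0 1] \<tau>0 0 by simp
    moreover have "0 \<le> \<alpha> * (1/2 - 1)" using main[OF slater(1)[of "1/2"], of 0 0 0 1] \<tau>0 0 by simp
    ultimately have "\<alpha> = 0" by simp
    then show False using a(1) \<tau>0 0 by (simp add: a_eq zero_prod_def)
  qed
  define \<eta> where "\<eta> = \<alpha> / \<tau>"
  define lam where "lam = \<beta> / \<tau>"
  define \<gamma> where "\<gamma> = \<kappa> / \<tau>"
  have eqs: "\<alpha> = \<tau> * \<eta>" "\<beta> = \<tau> * lam" "\<kappa> = \<tau> * \<gamma>" using \<tau>_pos by (simp_all add: \<eta>_def lam_def \<gamma>_def)
  \<comment> \<open>After division by \<open>\<tau>\<close>, the strict slack \<open>s3\<close> is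
    removed by letting it tend to 0.\<close>
  have main': "0 \<le> V - x - L * m + \<eta> * (q - 1 + m) + lam * (v - r + \<rho> * m) + \<gamma> * (c - e)"
    if "(x, q, v, c) \<in> C" "0 \<le> m" "b \<longrightarrow> m = 0" for x q v c m
  proof (rule field_le_epsilon)
    fix s :: real assume "0 < s"
    then have "0 \<le> \<tau> * (V - x - L * m + \<eta> * (q - 1 + m) + lam * (v - r + \<rho> * m) + \<gamma> * (c - e) + s)"
      using main[OF that, of 0 0 s] unfolding eqs by (simp add: algebra_simps)
    then show "0 \<le> V - x - L * m + \<eta> * (q - 1 + m) + lam * (v - r + \<rho> * m) + \<gamma> * (c - e) + s"
      using \<tau>_pos by (simp add: zero_le_mult_iff)
  qed
  show ?thesis
  proof (rule that[of lam \<gamma> \<eta>])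
    show "0 \<le> lam" "0 \<le> \<gamma>" using \<beta> \<kappa> \<tau>_pos by (simp_all add: lam_def \<gamma>_def)
    show "L - \<eta> \<le> \<rho> * lam" if "\<not> b"
    proof -
      \<comment> \<open>Here \<open>m\<close> is unbounded, so its coefficient in the separating
        inequality cannot be negative.\<close>
      have "0 \<le> \<rho> * lam + \<eta> - L"
        by (rule nonneg_slope_if_ray_nonneg[of "V - ob 1 - lam * r - \<gamma> * e"])
           (use main'[OF C1] that in \<open>simp add: algebra_simps\<close>)
      then show ?thesis by simp
    qed
    show "x - \<eta> * q - lam * v - \<gamma> * c + (r * lam + \<eta> + e * \<gamma>) \<le> V" if "(x, q, v, c) \<in> C" for x q v c
      using main'[OF that, of 0] by (simp add: algebra_simps)
  qed
qed

section \<open>Divergence generators\<close>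

locale generator =
  fixes f :: "real \<Rightarrow> ereal"
  assumes gen: "divergence_generator f"
begin

definition F :: "real \<Rightarrow> real" where "F t = real_of_ereal (f t)"

text \<open>The right derivative, as the infimum of the difference quotients to the right. A
  definite choice of subgradient is wanted that also exists at kinks of \<open>F\<close> and is
  monotone, hence measurable.\<close>

definition slope :: "real \<Rightarrow> real" where
  "slope x = Inf ((\<lambda>t. (F x - F t) / (x - t)) ` ({x<..} \<inter> {0<..}))"

lemma f_eq_F: "0 < t \<Longrightarrow> f t = ereal (F t)"
  using gen unfolding divergence_generator_def F_def by (auto simp: ereal_real)

lemma F_1 [simp]: "F 1 = 0"
  using gen unfolding divergence_generator_def F_def by simp

lemma f_convex:
  "0 \<le> s \<Longrightarrow> 0 \<le> t \<Longrightarrow> 0 \<le> u \<Longrightarrow> u \<le> 1 \<Longrightarrow>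
    f (u * s + (1 - u) * t) \<le> ereal u * f s + ereal (1 - u) * f t"
  using gen unfolding divergence_generator_def by auto

lemma f_not_minf: "0 \<le> t \<Longrightarrow> f t \<noteq> -\<infinity>"
  using gen unfolding divergence_generator_def by auto

lemma convex_on_F: "convex_on {0<..} F"
proof (rule convex_onI)
  fix t x y :: real assume t: "0 < t" "t < 1" "x \<in> {0<..}" "y \<in> {0<..}"
  then have "0 < (1 - t) * x + t * y" by (simp add: add_pos_pos)
  then show "F ((1 - t) *\<^sub>R x + t *\<^sub>R y) \<le> (1 - t) * F x + t * F y"
    using f_convex[of x y "1 - t"] t by (simp add: f_eq_F)
qed simp

lemma F_subgradient: "0 < x \<Longrightarrow> 0 < y \<Longrightarrow> F x + slope x * (y - x) \<le> F y"
  unfolding slope_def by (rule convex_le_Inf_differential[OF convex_on_F]) (simp_all add: interior_open)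

lemma slope_mono: "0 < x \<Longrightarrow> x \<le> y \<Longrightarrow> slope x \<le> slope y"
proof (cases "x = y")
  case False
  assume "0 < x" "x \<le> y"
  then have "slope x * (y - x) \<le> slope y * (y - x)" "0 < y - x"
    using F_subgradient[of x y] F_subgradient[of y x] False by (auto simp: algebra_simps)
  then show ?thesis by (simp add: mult_le_cancel_right)
qed simp

text \<open>At \<open>y = 0\<close>, where \<open>f\<close> may be infinite, the tangent inequality
  at \<open>x/2\<close> is combined with convexity at the midpoint of 0 and
  \<open>x\<close>.\<close>

lemma f_subgradient:
  assumes "0 < x" "0 \<le> y"
  shows "ereal (F x + slope x * (y - x)) \<le> f y"
proof (cases "y = 0")
  case True
  have "ereal (F (x/2)) \<le> ereal (1/2) * f 0 + ereal (1/2) * ereal (F x)"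
    using f_convex[of 0 x "1/2"] assms(1) f_eq_F[of x] f_eq_F[of "x/2"] by simp
  moreover have "F x + slope x * (x/2 - x) \<le> F (x/2)"
    using assms(1) by (intro F_subgradient) auto
  ultimately show ?thesis
    using True f_not_minf[of 0] by (cases "f 0") (auto simp: algebra_simps)
next
  case False
  then show ?thesis using assms F_subgradient[of x y] by (simp add: f_eq_F)
qed

text \<open>The tangent at \<open>s\<close> bounds \<open>f u / u\<close> asymptotically from below
  by \<open>slope s\<close>. Conversely the tangent at \<open>u\<close>, evaluated at 1 where
  \<open>f\<close> vanishes, gives \<open>F u \<le> slope u * (u - 1)\<close>. This shows that the
  limit behind \<open>recession\<close> exists and identifies it.\<close>

lemma recession_tendsto: "((\<lambda>u. f u / ereal u) \<longlongrightarrow> (SUP s\<in>{0<..}. ereal (slope s))) at_top"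
proof (rule order_tendstoI)
  fix c assume "c < (SUP s\<in>{0<..}. ereal (slope s))"
  then obtain s where s: "0 < s" "c < ereal (slope s)" by (auto simp: less_SUP_iff)
  then obtain c' where c': "c < ereal c'" "c' < slope s" using ereal_dense2 by force
  have "((\<lambda>u. (F s - slope s * s) / u) \<longlongrightarrow> 0) at_top"
    by (intro tendsto_divide_0[OF tendsto_const] filterlim_at_top_imp_at_infinity filterlim_ident)
  then have "\<forall>\<^sub>F u in at_top. c' - slope s < (F s - slope s * s) / u"
    using c' by (intro order_tendstoD) auto
  then show "\<forall>\<^sub>F u in at_top. c < f u / ereal u"
    using eventually_gt_at_top[of 0]
  proof eventually_elim
    fix u :: real assume u: "c' - slope s < (F s - slope s * s) / u" "0 < u"
    then have "c' * u < F s - slope s * s + slope s * u" by (simp add: field_simps)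
    also have "\<dots> \<le> F u" using F_subgradient[OF s(1) u(2)] by (simp add: algebra_simps)
    finally have "c' < F u / u" using u(2) by (simp add: field_simps)
    then show "c < f u / ereal u" using c'(1) u(2) by (simp add: f_eq_F) (metis less_ereal.simps(1) less_trans)
  qed
next
  fix c assume c: "(SUP s\<in>{0<..}. ereal (slope s)) < c"
  have up: "ereal (slope s) \<le> (SUP s\<in>{0<..}. ereal (slope s))" if "0 < s" for s
    using that by (intro SUP_upper) auto
  obtain R where R: "(SUP s\<in>{0<..}. ereal (slope s)) = ereal R"
    using c up[of 1] by (cases "(SUP s\<in>{0<..}. ereal (slope s))") auto
  have le: "slope s \<le> R" if "0 < s" for s using up[OF that] R by simp
  obtain c' where c': "R < c'" "ereal c' < c" using c R ereal_dense2 by force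
  have "((\<lambda>u. - R / u) \<longlongrightarrow> 0) at_top"
    by (intro tendsto_divide_0[OF tendsto_const] filterlim_at_top_imp_at_infinity filterlim_ident)
  then have "\<forall>\<^sub>F u in at_top. - R / u < c' - R"
    using c' by (intro order_tendstoD) auto
  then show "\<forall>\<^sub>F u in at_top. f u / ereal u < c"
    using eventually_gt_at_top[of 1]
  proof eventually_elim
    fix u :: real assume u: "- R / u < c' - R" "1 < u"
    have "F u \<le> slope u * (u - 1)" using F_subgradient[of u 1] u(2) by (simp add: algebra_simps)
    also have "\<dots> \<le> R * (u - 1)" using le[of u] u(2) by (intro mult_right_mono) auto
    also have "\<dots> < c' * u" using u by (simp add: field_simps)
    finally have "F u / u < c'" using u(2) by (simp add: field_simps)
    then show "f u / ereal u < c" using c'(2) u(2) by (simp add: f_eq_F) (metis less_ereal.simps(1) less_trans)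
  qed
qed

lemma recession_eq: "recession f = (SUP s\<in>{0<..}. ereal (slope s))"
  unfolding recession_def by (rule tendsto_Lim[OF _ recession_tendsto]) simp

lemma slope_le_recession: "0 < s \<Longrightarrow> ereal (slope s) \<le> recession f"
  unfolding recession_eq by (intro SUP_upper) auto

lemma recession_not_minf: "recession f \<noteq> -\<infinity>"
  using slope_le_recession[of 1] by auto

text \<open>Strictness provides a tangent of \<open>f\<close> with slope above
  \<open>a / lam\<close>; the bound is \<open>-lam\<close> times the value of that tangent at 0. At
  equality the conjugate may be infinite, for instance for
  \<open>f t = t - 1 - ln t\<close>.\<close>

lemma conjugate_bounded:
  assumes "0 < lam" "ereal a < recession f * ereal lam"
  obtains B where "\<And>t. 0 \<le> t \<Longrightarrow> ereal (a * t) - ereal lam * f t \<le> ereal B"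
proof -
  have "ereal (a / lam) < recession f"
    using assms recession_not_minf by (cases "recession f") (auto simp: field_simps)
  then obtain s where s: "0 < s" "a / lam < slope s" unfolding recession_eq by (auto simp: less_SUP_iff)
  show ?thesis
  proof (rule that[of "lam * (slope s * s - F s)"])
    fix t :: real assume t: "0 \<le> t"
    have "a * t \<le> lam * slope s * t" using s(2) assms(1) t by (intro mult_right_mono) (auto simp: field_simps)
    moreover have "ereal (lam * (F s + slope s * (t - s))) \<le> ereal lam * f t"
      using ereal_mult_left_mono[OF f_subgradient[OF s(1) t], of "ereal lam"] assms(1) by simp
    ultimately show "ereal (a * t) - ereal lam * f t \<le> ereal (lam * (slope s * s - F s))"
      by (cases "ereal lam * f t") (auto simp: algebra_simps)
  qed
qed

lemma continuous_on_F: "continuous_on {0<..} F"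
  by (rule convex_on_continuous[OF _ convex_on_F]) auto

lemma F_bounded:
  assumes "0 < c"
  obtains B where "\<And>t. c \<le> t \<Longrightarrow> t \<le> H \<Longrightarrow> \<bar>F t\<bar> \<le> B"
proof -
  have "compact (F ` {c..H})"
    using assms by (intro compact_continuous_image continuous_on_subset[OF continuous_on_F]) auto
  then obtain B where "\<forall>y\<in>F ` {c..H}. norm y \<le> B"
    using compact_imp_bounded bounded_iff by metis
  then show ?thesis by (intro that[of B]) auto
qed

text \<open>Continuity of \<open>F\<close> handles positive \<open>t\<close>. At
  \<open>t = 0\<close>, since \<open>f 1 = 0\<close>, the chord from 0 to 1 gives
  \<open>F u \<le> (1 - u) * f 0\<close>, so small positive \<open>u\<close> do almost as well as
  0.\<close>

lemma positive_rational_approx: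
  assumes "0 \<le> t" "0 \<le> lam" and y: "y < ereal (a * t) - ereal lam * f t"
  shows "\<exists>q\<in>\<rat>. 0 < q \<and> y < ereal (a * q - lam * F q)"
proof -
  have "\<exists>q>0. y < ereal (a * q - lam * F q)"
  proof (cases "t = 0")
    case False
    then show ?thesis using assms by (intro exI[of _ t]) (simp add: f_eq_F)
  next
    case True
    have "ereal lam * f t \<noteq> \<infinity>" using y by auto
    moreover have "ereal lam * f t \<noteq> -\<infinity>" using f_not_minf[OF assms(1)] assms(2) by (cases "f t") auto
    ultimately obtain p where p: "ereal lam * f t = ereal p" by (cases "ereal lam * f t") auto
    have "((\<lambda>u. a * u - (1 - u) * p) \<longlongrightarrow> a * 0 - (1 - 0) * p) (at_right 0)"
      by (intro tendsto_intros)
    then have "((\<lambda>u. ereal (a * u - (1 - u) * p)) \<longlongrightarrow> ereal (- p)) (at_right 0)" by simp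
    moreover have "y < ereal (- p)" using y p True by simp
    ultimately have "\<forall>\<^sub>F u in at_right 0. y < ereal (a * u - (1 - u) * p)" by (rule order_tendstoD)
    moreover have "\<forall>\<^sub>F u in at_right (0::real). u < 1"
      by (rule eventually_at_right_real[of 0 1, THEN eventually_mono]) auto
    moreover have "\<forall>\<^sub>F u in at_right (0::real). 0 < u"
      by (simp add: eventually_at_right_less)
    ultimately have "\<forall>\<^sub>F u in at_right 0. 0 < u \<and> y < ereal (a * u - lam * F u)"
    proof eventually_elim
      fix u :: real assume u: "y < ereal (a * u - (1 - u) * p)" "u < 1" "0 < u"
      have "ereal (F u) \<le> ereal (1 - u) * f 0"
        using f_convex[of 1 0 u] u f_eq_F[of u] f_eq_F[of 1] by simp
      then have "ereal lam * ereal (F u) \<le> ereal lam * (ereal (1 - u) * f 0)"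
        using assms(2) by (intro ereal_mult_left_mono) auto
      also have "\<dots> = ereal (1 - u) * (ereal lam * f 0)" by (simp only: mult.left_commute)
      also have "\<dots> = ereal (1 - u) * ereal p" using p True by simp
      finally have "lam * F u \<le> (1 - u) * p" by simp
      then show "0 < u \<and> y < ereal (a * u - lam * F u)"
        using u by (auto intro: less_le_trans)
    qed
    then show ?thesis using eventually_happens[of _ "at_right (0::real)"] by auto
  qed
  then obtain x where x: "0 < x" "y < ereal (a * x - lam * F x)" by auto
  have "continuous (at x) (\<lambda>x. a * x - lam * F x)"
    using continuous_on_F x(1)
    by (intro continuous_intros) (auto simp: continuous_on_eq_continuous_at)
  then have "((\<lambda>x. ereal (a * x - lam * F x)) \<longlongrightarrow> ereal (a * x - lam * F x)) (at x)"
    by (simp add: continuous_at)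
  then have "\<forall>\<^sub>F z in at x. y < ereal (a * z - lam * F z)" using x(2) by (rule order_tendstoD)
  then obtain e where e: "e > 0" "\<And>z. z \<noteq> x \<Longrightarrow> dist z x < e \<Longrightarrow> y < ereal (a * z - lam * F z)"
    unfolding eventually_at by auto
  obtain q where "q \<in> \<rat>" "x < q" "q < x + e" using Rats_dense_in_real[of x "x + e"] e(1) by auto
  then show ?thesis using e(2)[of q] x(1) by (intro bexI[of _ q]) (auto simp: dist_real_def)
qed

lemma f_measurable:
  assumes [measurable]: "k \<in> borel_measurable M" and k: "\<And>x. 0 \<le> k x"
  shows "(\<lambda>x. f (k x)) \<in> borel_measurable M"
proof -
  have lsc: "lsc_on {0..} f" using gen unfolding divergence_generator_def by auto
  have "{x \<in> space M. f (k x) \<le> c} \<in> sets M" for c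
  proof -
    have [measurable]: "{t\<in>{0..}. f t \<le> c} \<in> sets borel"
      using closed_sublevel_lsc[OF _ lsc, of c] by (intro borel_closed) auto
    have "{x \<in> space M. f (k x) \<le> c} = {x \<in> space M. k x \<in> {t\<in>{0..}. f t \<le> c}}" using k by auto
    also have "\<dots> \<in> sets M" by measurable
    finally show ?thesis .
  qed
  then show ?thesis by (rule borel_measurableI_le)
qed

lemma F_measurable [measurable]:
  assumes "k \<in> borel_measurable M" "\<And>x. 0 \<le> k x"
  shows "(\<lambda>x. F (k x)) \<in> borel_measurable M"
  unfolding F_def using f_measurable[OF assms] by measurable

lemma slope_measurable:
  assumes [measurable]: "k \<in> borel_measurable M" and "0 < c" "\<And>x. c \<le> k x"
  shows "(\<lambda>x. slope (k x)) \<in> borel_measurable M"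
proof -
  \<comment> \<open>The slope is monotone on the positive reals only; truncation at \<open>c\<close>
    extends this to all reals without changing the values used.\<close>
  have "mono (\<lambda>t. slope (max c t))" using assms(2) by (auto simp: mono_def intro!: slope_mono)
  then have "(\<lambda>t. slope (max c t)) \<in> borel_measurable borel" by (rule borel_measurable_mono)
  then have "(\<lambda>x. slope (max c (k x))) \<in> borel_measurable M" by measurable
  moreover have "max c (k x) = k x" for x using assms(3)[of x] by (simp add: max_def)
  ultimately show ?thesis by simp
qed

end

section \<open>The dual integrand\<close>

locale dro = generator f for f +
  fixes S :: "'a::euclidean_space set" and d :: "'a \<Rightarrow> 'a \<Rightarrow> real"
    and loss :: "'x \<Rightarrow> 'a \<Rightarrow> real" and x0 :: 'x and P' :: "'a measure"
  assumes compact_S: "compact S" and P': "P' \<in> borel_probs S"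
    and loss_nonneg: "\<And>\<xi>. \<xi> \<in> S \<Longrightarrow> 0 \<le> loss x0 \<xi>"
    and loss_le: "\<And>\<xi>. \<xi> \<in> S \<Longrightarrow> loss x0 \<xi> \<le> max_loss S loss x0"
    and usc_loss: "usc_on S (loss x0)"
    and d_nonneg: "\<And>\<xi> \<xi>'. \<xi> \<in> S \<Longrightarrow> \<xi>' \<in> S \<Longrightarrow> 0 \<le> d \<xi> \<xi>'"
    and lsc_d: "lsc_on (S \<times> S) (\<lambda>(\<xi>, \<xi>'). d \<xi> \<xi>')"
    and d_refl: "\<And>\<xi>. \<xi> \<in> S \<Longrightarrow> d \<xi> \<xi> = 0"
begin

abbreviation "l \<equiv> loss x0"
abbreviation "L \<equiv> max_loss S loss x0"

definition M :: "'a measure" where "M = restrict_space borel S"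

lemma space_M [simp]: "space M = S"
  by (simp add: M_def space_restrict_space)

lemma closed_S: "closed S"
  using compact_S by (rule compact_imp_closed)

lemma borel_probs_iff: "P \<in> borel_probs S \<longleftrightarrow> sets P = sets M \<and> prob_space P"
  by (simp add: borel_probs_def space_prob_algebra M_def)

sublocale P': prob_space P'
  using P' by (simp add: borel_probs_iff)

lemma sets_P' [measurable_cong]: "sets P' = sets M"
  using P' by (simp add: borel_probs_iff)

lemma space_P' [simp]: "space P' = S"
  using sets_eq_imp_space_eq[OF sets_P'] by simp

lemma S_ne: "S \<noteq> {}"
  using P'.not_empty by simp

lemma closed_sets_M: "closed C \<Longrightarrow> C \<subseteq> S \<Longrightarrow> C \<in> sets M"
  using closed_S by (simp add: M_def sets_restrict_space_iff borel_closed)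

lemma pair_measurable_borel: "(\<lambda>p. p) \<in> M \<Otimes>\<^sub>M M \<rightarrow>\<^sub>M borel"
proof -
  have [measurable]: "(\<lambda>x. x) \<in> M \<rightarrow>\<^sub>M borel"
    unfolding M_def by (rule measurable_restrict_space1) simp
  have "(\<lambda>p. (fst p, snd p)) \<in> M \<Otimes>\<^sub>M M \<rightarrow>\<^sub>M borel \<Otimes>\<^sub>M borel"
    by (intro measurable_Pair) measurable
  then show ?thesis by (simp add: borel_prod)
qed

lemma closed_sets_MM: "closed C \<Longrightarrow> C \<subseteq> S \<times> S \<Longrightarrow> C \<in> sets (M \<Otimes>\<^sub>M M)"
  using measurable_sets[OF pair_measurable_borel, of C]
  by (simp add: space_pair_measure Int_absorb2)

lemma closed_l: "closed {\<xi>\<in>S. c \<le> l \<xi>}"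
  using closed_superlevel_usc[OF closed_S usc_loss] .

lemma closed_d: "closed {p\<in>S \<times> S. d (fst p) (snd p) \<le> c}"
  using closed_sublevel_lsc[OF closed_Times[OF closed_S closed_S] lsc_d, of c]
  by (simp add: case_prod_unfold)

lemma l_measurable [measurable]: "l \<in> borel_measurable M"
proof (rule borel_measurableI_ge)
  show "{\<xi>\<in>space M. y \<le> l \<xi>} \<in> sets M" for y
    using closed_l by (intro closed_sets_M) auto
qed

lemma d_measurable: "(\<lambda>p. d (fst p) (snd p)) \<in> borel_measurable (M \<Otimes>\<^sub>M M)"
proof (rule borel_measurableI_le)
  show "{p\<in>space (M \<Otimes>\<^sub>M M). d (fst p) (snd p) \<le> y} \<in> sets (M \<Otimes>\<^sub>M M)" for y
    using closed_d[of y] by (intro closed_sets_MM) (auto simp: space_pair_measure)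
qed

lemma d_measurable2 [measurable]:
  assumes "X \<in> N \<rightarrow>\<^sub>M M" "Y \<in> N \<rightarrow>\<^sub>M M"
  shows "(\<lambda>\<omega>. d (X \<omega>) (Y \<omega>)) \<in> borel_measurable N"
  using measurable_compose[OF measurable_Pair[OF assms] d_measurable] by simp

text \<open>Written with the real-valued \<open>F\<close> in place of \<open>f\<close>, it is in
  general the intended value only for \<open>t > 0\<close>.\<close>

definition W :: "real \<Rightarrow> real \<Rightarrow> real \<Rightarrow> real \<Rightarrow> 'a \<Rightarrow> 'a \<Rightarrow> real" where
  "W \<eta> lam \<gamma> t \<xi> \<xi>' = (l \<xi>' - \<eta>) * t - lam * F t - \<gamma> * d \<xi> \<xi>'"

text \<open>Joint upper semicontinuity, cut down to pairs within transport radius \<open>n\<close>.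
  In this form both the measurability of \<open>g\<close> and the measurable maximisers follow from
  projections of closed sets.\<close>

lemma closed_W:
  assumes "0 < t" "0 \<le> \<gamma>"
  shows "closed {p\<in>S \<times> S. d (fst p) (snd p) \<le> n \<and> c \<le> W \<eta> lam \<gamma> t (fst p) (snd p)}"
proof -
  have 1: "closed {p\<in>S \<times> S. c \<le> l (snd p)}" for c
  proof -
    have "{p\<in>S \<times> S. c \<le> l (snd p)} = S \<times> {\<xi>\<in>S. c \<le> l \<xi>}" by auto
    then show ?thesis using closed_l closed_S by (simp add: closed_Times)
  qed
  have 2: "closed {p\<in>S \<times> S. c \<le> l (snd p) * t + (- \<eta> * t - lam * F t)}" for c
    by (rule closed_superlevel_scale[OF 1 assms(1)])
  have 3: "closed {p\<in>S \<times> S. c \<le> - \<gamma> * d (fst p) (snd p)}" for c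
  proof (cases "\<gamma> = 0")
    case True
    then show ?thesis using closed_Times[OF closed_S closed_S] by (cases "c \<le> 0") auto
  next
    case False
    then have "{p\<in>S \<times> S. c \<le> - \<gamma> * d (fst p) (snd p)} = {p\<in>S \<times> S. d (fst p) (snd p) \<le> - c / \<gamma>}"
      using assms(2) by (auto simp: field_simps)
    then show ?thesis using closed_d by simp
  qed
  have "{p\<in>S \<times> S. d (fst p) (snd p) \<le> n \<and> c \<le> W \<eta> lam \<gamma> t (fst p) (snd p)} =
    {p\<in>S \<times> S. d (fst p) (snd p) \<le> n} \<inter>
    {p\<in>S \<times> S. c \<le> (l (snd p) * t + (- \<eta> * t - lam * F t)) + (- \<gamma> * d (fst p) (snd p))}"
    unfolding W_def by (auto simp: algebra_simps)
  then show ?thesis using closed_d closed_superlevel_add[OF 2 3] by (simp add: closed_Int)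
qed

text \<open>Projections of Borel sets need not be Borel; compactness of \<open>S \<times> S\<close>
  makes the projection of a closed set closed.\<close>

lemma projection_sets_M:
  assumes "closed C" "C \<subseteq> S \<times> S"
  shows "fst ` C \<in> sets M"
proof (rule closed_sets_M)
  have "compact C" using compact_Times[OF compact_S compact_S] assms
    by (metis compact_Int_closed Int_absorb1)
  then have "compact (fst ` C)" by (intro compact_continuous_image continuous_intros)
  then show "closed (fst ` C)" by (rule compact_imp_closed)
qed (use assms in auto)

lemma W_projection:
  assumes "0 < t" "0 \<le> \<gamma>" "closed K"
  shows "{\<xi>\<in>S. \<exists>\<xi>'\<in>S \<inter> K. d \<xi> \<xi>' \<le> n \<and> c \<le> W \<eta> lam \<gamma> t \<xi> \<xi>'} \<in> sets M"
proof -
  have "{\<xi>\<in>S. \<exists>\<xi>'\<in>S \<inter> K. d \<xi> \<xi>' \<le> n \<and> c \<le> W \<eta> lam \<gamma> t \<xi> \<xi>'} =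
    fst ` ({p\<in>S \<times> S. d (fst p) (snd p) \<le> n \<and> c \<le> W \<eta> lam \<gamma> t (fst p) (snd p)} \<inter> UNIV \<times> K)"
    by (force simp: image_iff)
  also have "\<dots> \<in> sets M"
    using closed_W[OF assms(1,2)] assms(3) by (intro projection_sets_M closed_Int closed_Times) auto
  finally show ?thesis .
qed

text \<open>\<open>D\<close> lists the admissible transport radii: \<open>range real\<close> imposes no restriction, while \<open>{0}\<close>
  only allows transport along pairs of zero cost, as needed for \<open>\<epsilon> = 0\<close>.\<close>

definition g :: "real set \<Rightarrow> real \<Rightarrow> real \<Rightarrow> real \<Rightarrow> 'a \<Rightarrow> ereal" where
  "g D \<eta> lam \<gamma> \<xi> = (SUP (t, \<xi>')\<in>{(t, \<xi>'). t \<in> \<rat> \<and> 0 < t \<and> \<xi>' \<in> S \<and> (\<exists>n\<in>D. d \<xi> \<xi>' \<le> n)}.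
     ereal (W \<eta> lam \<gamma> t \<xi> \<xi>'))"

lemma g_upper:
  "t \<in> \<rat> \<Longrightarrow> 0 < t \<Longrightarrow> \<xi>' \<in> S \<Longrightarrow> n \<in> D \<Longrightarrow> d \<xi> \<xi>' \<le> n \<Longrightarrow> ereal (W \<eta> lam \<gamma> t \<xi> \<xi>') \<le> g D \<eta> lam \<gamma> \<xi>"
  unfolding g_def by (rule SUP_upper2[of "(t, \<xi>')"]) auto

lemma g_least:
  "(\<And>t \<xi>' n. t \<in> \<rat> \<Longrightarrow> 0 < t \<Longrightarrow> \<xi>' \<in> S \<Longrightarrow> n \<in> D \<Longrightarrow> d \<xi> \<xi>' \<le> n \<Longrightarrow> ereal (W \<eta> lam \<gamma> t \<xi> \<xi>') \<le> c)
    \<Longrightarrow> g D \<eta> lam \<gamma> \<xi> \<le> c"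
  unfolding g_def by (rule SUP_least) auto

lemma less_g_iff:
  "c < g D \<eta> lam \<gamma> \<xi> \<longleftrightarrow>
    (\<exists>t\<in>\<rat> \<inter> {0<..}. \<exists>n\<in>D. \<exists>\<xi>'\<in>S. d \<xi> \<xi>' \<le> n \<and> c < ereal (W \<eta> lam \<gamma> t \<xi> \<xi>'))"
  unfolding g_def less_SUP_iff by (auto simp: Bex_def)

text \<open>Staying put with density 1 has the value \<open>l \<xi> - \<eta>\<close>. The resulting
  constant minorant keeps the extended integrals of \<open>g\<close> well behaved.\<close>

lemma g_lower: "\<xi> \<in> S \<Longrightarrow> 0 \<in> D \<Longrightarrow> ereal (- \<eta>) \<le> g D \<eta> lam \<gamma> \<xi>"
  by (rule order_trans[OF _ g_upper[of 1 \<xi> 0]]) (auto simp: d_refl W_def loss_nonneg)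

text \<open>A strict bound \<open>c < W\<close> is replaced by \<open>q \<le> W\<close> with a
  rational \<open>q\<close> above \<open>c\<close>, so that only countable unions of projections of
  closed sets occur.\<close>

lemma g_measurable [measurable]:
  assumes "countable D" "0 \<le> \<gamma>"
  shows "g D \<eta> lam \<gamma> \<in> borel_measurable M"
proof (rule borel_measurableI_greater)
  fix c
  define R where "R = \<rat> \<inter> {q. c < ereal q}"
  have less_iff: "(c < ereal w) \<longleftrightarrow> (\<exists>q\<in>R. q \<le> w)" for w
    unfolding R_def
  proof
    assume "c < ereal w"
    then obtain r where r: "c < ereal r" "r < w"
      using ereal_dense2[of c "ereal w"] by auto
    obtain q where "q \<in> \<rat>" "r < q" "q < w" using Rats_dense_in_real[OF r(2)] by auto
    then show "\<exists>q\<in>\<rat> \<inter> {q. c < ereal q}. q \<le> w"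
      using r(1) by (intro bexI[of _ q]) (auto intro: less_trans)
  qed (auto intro: less_le_trans)
  define T where "T = \<rat> \<inter> {0::real<..}"
  have "c < g D \<eta> lam \<gamma> \<xi> \<longleftrightarrow>
      (\<exists>t\<in>T. \<exists>n\<in>D. \<exists>q\<in>R. \<exists>\<xi>'\<in>S \<inter> UNIV. d \<xi> \<xi>' \<le> n \<and> q \<le> W \<eta> lam \<gamma> t \<xi> \<xi>')" for \<xi>
    unfolding less_g_iff less_iff T_def[symmetric] Int_UNIV_right by blast
  then have "{\<xi>\<in>space M. c < g D \<eta> lam \<gamma> \<xi>} = (\<Union>t\<in>T. \<Union>n\<in>D. \<Union>q\<in>R.
    {\<xi>\<in>S. \<exists>\<xi>'\<in>S \<inter> UNIV. d \<xi> \<xi>' \<le> n \<and> q \<le> W \<eta> lam \<gamma> t \<xi> \<xi>'})"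
    by (simp only: space_M) blast
  also have "\<dots> \<in> sets M"
    using assms countable_rat unfolding T_def R_def
    by (intro sets.countable_UN' image_subsetI W_projection countable_Int1) auto
  finally show "{\<xi>\<in>space M. c < g D \<eta> lam \<gamma> \<xi>} \<in> sets M" .
qed

text \<open>The points within cost \<open>\<delta>\<close> form a compact set containing
  \<open>\<xi>\<close>, so the real supremum in \<open>inflated_loss\<close> is a maximum.\<close>

lemma inflated_loss_attained:
  assumes "\<xi> \<in> S" "0 \<le> \<delta>"
  obtains \<xi>' where "\<xi>' \<in> S" "d \<xi> \<xi>' \<le> \<delta>" "inflated_loss S d loss \<delta> x0 \<xi> = l \<xi>'"
    "\<And>\<xi>''. \<xi>'' \<in> S \<Longrightarrow> d \<xi> \<xi>'' \<le> \<delta> \<Longrightarrow> l \<xi>'' \<le> l \<xi>'"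
proof -
  define K where "K = {\<xi>'\<in>S. d \<xi> \<xi>' \<le> \<delta>}"
  have K_eq: "K = (\<lambda>\<xi>'. (\<xi>, \<xi>')) -` {p\<in>S \<times> S. d (fst p) (snd p) \<le> \<delta>}" using assms(1) by (auto simp: K_def)
  have "closed K" unfolding K_eq by (rule closed_vimage[OF closed_d]) (intro continuous_intros)
  have K: "compact K" using compact_S \<open>closed K\<close> unfolding K_def
    by (metis (no_types, lifting) K_def compact_Int_closed Int_absorb1 mem_Collect_eq subsetI)
  have "K \<noteq> {}" using assms by (auto simp: K_def d_refl)
  moreover have "closed {\<xi>'\<in>K. c \<le> l \<xi>'}" for c
  proof -
    have "{\<xi>'\<in>K. c \<le> l \<xi>'} = K \<inter> {\<xi>'\<in>S. c \<le> l \<xi>'}" by (auto simp: K_def)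
    then show ?thesis using closed_l \<open>closed K\<close> by (simp add: closed_Int)
  qed
  ultimately obtain \<xi>' where \<xi>': "\<xi>' \<in> K" "\<And>y. y \<in> K \<Longrightarrow> l y \<le> l \<xi>'"
    using attains_max[OF K, of l] by blast
  show ?thesis
  proof (rule that[of \<xi>'])
    show "inflated_loss S d loss \<delta> x0 \<xi> = l \<xi>'"
      unfolding inflated_loss_def by (rule cSup_eq_maximum) (use \<xi>' in \<open>auto simp: K_def\<close>)
  qed (use \<xi>' in \<open>auto simp: K_def\<close>)
qed

text \<open>The pointwise inequality behind weak duality. The density value \<open>t = 0\<close>
  occurs for general \<open>P\<close> but not in \<open>g\<close>, so the left side is approximated
  from below at positive rationals; \<open>range real\<close> admits every cost, since some natural
  number exceeds it.\<close>

lemma conjugate_le_g: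
  assumes "\<xi>' \<in> S" "0 \<le> lam" "0 \<le> t"
  shows "ereal ((l \<xi>' - \<eta>) * t) - ereal lam * f t \<le> g (range real) \<eta> lam \<gamma> \<xi> + ereal (\<gamma> * d \<xi> \<xi>')"
    (is "_ \<le> ?rhs + _")
proof (rule dense_le)
  fix y assume "y < ereal ((l \<xi>' - \<eta>) * t) - ereal lam * f t"
  then obtain q where q: "q \<in> \<rat>" "0 < q" "y < ereal ((l \<xi>' - \<eta>) * q - lam * F q)"
    using positive_rational_approx[of t lam y "l \<xi>' - \<eta>"] assms(2,3) by auto
  obtain n :: nat where "d \<xi> \<xi>' \<le> real n" using real_arch_simple by blast
  then have "ereal (W \<eta> lam \<gamma> q \<xi> \<xi>') \<le> ?rhs" using q assms(1) by (intro g_upper) auto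
  then have "ereal ((l \<xi>' - \<eta>) * q - lam * F q) \<le> ?rhs + ereal (\<gamma> * d \<xi> \<xi>')"
    unfolding W_def by (cases ?rhs) (auto simp: algebra_simps)
  then show "y \<le> ?rhs + ereal (\<gamma> * d \<xi> \<xi>')" using q(3) by auto
qed

text \<open>A maximiser of the loss within cost \<open>\<delta>\<close> may cost less, and charging
  its true cost only increases the value. Conversely the pair \<open>\<xi>\<close>,
  \<open>\<xi>'\<close> is represented by the radius \<open>d \<xi> \<xi>'\<close>, which is why
  \<open>\<Delta>\<close> must contain all values of \<open>d\<close>.\<close>

lemma integrand_eq_g:
  assumes \<Delta>: "\<Delta> \<subseteq> {0..}" "\<And>\<xi> \<xi>'. \<xi> \<in> S \<Longrightarrow> \<xi>' \<in> S \<Longrightarrow> d \<xi> \<xi>' \<in> \<Delta>"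
    and "0 \<le> lam" "0 \<le> \<gamma>" and \<xi>: "\<xi> \<in> S"
  shows "(SUP \<delta>\<in>\<Delta>. conjugate_perspective f lam (inflated_loss S d loss \<delta> x0 \<xi> - \<eta>) - ereal (\<delta> * \<gamma>))
    = g (range real) \<eta> lam \<gamma> \<xi>" (is "?lhs = ?rhs")
proof (rule antisym)
  show "?lhs \<le> ?rhs"
  proof (rule SUP_least)
    fix \<delta> assume "\<delta> \<in> \<Delta>"
    then have \<delta>: "0 \<le> \<delta>" using \<Delta> by auto
    obtain \<xi>' where \<xi>': "\<xi>' \<in> S" "d \<xi> \<xi>' \<le> \<delta>" "inflated_loss S d loss \<delta> x0 \<xi> = l \<xi>'"
      using inflated_loss_attained[OF \<xi> \<delta>] by blast
    have "d \<xi> \<xi>' * \<gamma> \<le> \<delta> * \<gamma>" using \<xi>'(2) assms(4) by (rule mult_right_mono)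
    then have "?rhs + ereal (\<gamma> * d \<xi> \<xi>') \<le> ?rhs + ereal (\<delta> * \<gamma>)"
      by (intro add_left_mono) (simp add: mult.commute)
    then have "conjugate_perspective f lam (l \<xi>' - \<eta>) \<le> ?rhs + ereal (\<delta> * \<gamma>)"
      unfolding conjugate_perspective_def
      by (intro SUP_least order_trans[OF conjugate_le_g[OF \<xi>'(1) assms(3)]]) simp
    then show "conjugate_perspective f lam (inflated_loss S d loss \<delta> x0 \<xi> - \<eta>) - ereal (\<delta> * \<gamma>) \<le> ?rhs"
      unfolding \<xi>'(3) by (simp add: ereal_minus_le)
  qed
next
  show "?rhs \<le> ?lhs"
  proof (rule g_least)
    fix t :: real and \<xi>' n assume t: "t \<in> \<rat>" "0 < t" "\<xi>' \<in> S"
    define \<delta> where "\<delta> = d \<xi> \<xi>'"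
    have \<delta>: "\<delta> \<in> \<Delta>" "0 \<le> \<delta>" using \<Delta> \<xi> t(3) unfolding \<delta>_def by auto
    obtain \<xi>'' where \<xi>'': "inflated_loss S d loss \<delta> x0 \<xi> = l \<xi>''" "l \<xi>' \<le> l \<xi>''"
      using inflated_loss_attained[OF \<xi> \<delta>(2)] t(3) unfolding \<delta>_def by (metis order_refl)
    have "(l \<xi>' - \<eta>) * t \<le> (l \<xi>'' - \<eta>) * t" using \<xi>''(2) t(2) by (intro mult_right_mono) auto
    then have "ereal (W \<eta> lam \<gamma> t \<xi> \<xi>') \<le> (ereal ((l \<xi>'' - \<eta>) * t) - ereal lam * f t) - ereal (\<delta> * \<gamma>)"
      using t(2) unfolding W_def \<delta>_def by (simp add: f_eq_F mult.commute)
    also have "\<dots> \<le> conjugate_perspective f lam (l \<xi>'' - \<eta>) - ereal (\<delta> * \<gamma>)"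
      unfolding conjugate_perspective_def using t(2) by (intro ereal_minus_mono SUP_upper) auto
    also have "\<dots> \<le> ?lhs" unfolding \<xi>''(1)[symmetric] by (rule SUP_upper[OF \<delta>(1)])
    finally show "ereal (W \<eta> lam \<gamma> t \<xi> \<xi>') \<le> ?lhs" .
  qed
qed

section \<open>Weak duality\<close>

lemma AE_couplings_fst:
  assumes "\<pi> \<in> couplings P' Q" "AE \<xi> in P'. R \<xi>"
  shows "AE p in \<pi>. R (fst p)"
proof (rule AE_distrD[of fst \<pi> P' R])
  show "fst \<in> \<pi> \<rightarrow>\<^sub>M P'" using assms(1) by (subst measurable_cong_sets[of \<pi> "P' \<Otimes>\<^sub>M Q"]) (auto simp: couplings_def)
  have "distr \<pi> P' fst = P'" using assms(1) by (simp add: couplings_def)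
  then show "AE \<xi> in distr \<pi> P' fst. R \<xi>" using assms(2) by (simp only:)
qed

lemma AE_couplings_snd:
  assumes "\<pi> \<in> couplings P' Q" "AE \<xi> in Q. R \<xi>"
  shows "AE p in \<pi>. R (snd p)"
proof (rule AE_distrD[of snd \<pi> Q R])
  show "snd \<in> \<pi> \<rightarrow>\<^sub>M Q" using assms(1) by (subst measurable_cong_sets[of \<pi> "P' \<Otimes>\<^sub>M Q"]) (auto simp: couplings_def)
  have "distr \<pi> Q snd = Q" using assms(1) by (simp add: couplings_def)
  then show "AE \<xi> in distr \<pi> Q snd. R \<xi>" using assms(2) by (simp only:)
qed

lemma integral_couplings:
  fixes u :: "'a \<Rightarrow> real"
  assumes "\<pi> \<in> couplings P' Q"
  shows "integrable P' u \<Longrightarrow> integrable \<pi> (\<lambda>p. u (fst p)) \<and> (\<integral>p. u (fst p) \<partial>\<pi>) = (\<integral>\<xi>. u \<xi> \<partial>P')"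
    and "integrable Q u \<Longrightarrow> integrable \<pi> (\<lambda>p. u (snd p)) \<and> (\<integral>p. u (snd p) \<partial>\<pi>) = (\<integral>\<xi>. u \<xi> \<partial>Q)"
proof -
  have sets: "sets \<pi> = sets (P' \<Otimes>\<^sub>M Q)" and 1: "distr \<pi> P' fst = P'" and 2: "distr \<pi> Q snd = Q"
    using assms by (auto simp: couplings_def)
  have m: "fst \<in> \<pi> \<rightarrow>\<^sub>M P'" "snd \<in> \<pi> \<rightarrow>\<^sub>M Q"
    by (subst measurable_cong_sets[OF sets refl], simp)+
  show "integrable \<pi> (\<lambda>p. u (fst p)) \<and> (\<integral>p. u (fst p) \<partial>\<pi>) = (\<integral>\<xi>. u \<xi> \<partial>P')" if "integrable P' u"
    using integrable_distr[OF m(1), of u] integral_distr[OF m(1), of u] that 1 by simp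
  show "integrable \<pi> (\<lambda>p. u (snd p)) \<and> (\<integral>p. u (snd p) \<partial>\<pi>) = (\<integral>\<xi>. u \<xi> \<partial>Q)" if "integrable Q u"
    using integrable_distr[OF m(2), of u] integral_distr[OF m(2), of u] that 2 by simp
qed

lemma l_integrable:
  assumes "finite_measure P" "sets P = sets M"
  shows "integrable P l"
proof -
  interpret finite_measure P by fact
  have "space P = S" using sets_eq_imp_space_eq[OF assms(2)] by simp
  then show ?thesis using loss_nonneg loss_le assms(2)
    by (intro integrable_const_bound[of _ L] AE_I2) (auto simp: measurable_cong_sets[OF assms(2) refl])
qed

text \<open>Collects what is used of the chosen decomposition and of \<open>RN_deriv\<close>: a null
  set \<open>N\<close> outside which \<open>P\<close> has the real density \<open>k\<close>,
  expressed through integrals. Both directions of the duality rely on it.\<close>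

lemma f_divergence_density:
  assumes P: "P \<in> borel_probs S" and Q: "Q \<in> borel_probs S"
  obtains N k where "N \<in> null_sets Q" "k \<in> borel_measurable Q" "\<And>\<xi>. 0 \<le> k \<xi>"
    "\<And>u. integrable P u \<Longrightarrow> integrable Q (\<lambda>\<xi>. k \<xi> * u \<xi>) \<and>
       (\<integral>\<xi>. k \<xi> * u \<xi> \<partial>Q) = (\<integral>\<xi>. u \<xi> * indicator (S - N) \<xi> \<partial>P)"
    "f_divergence f Q P = ereal_integral Q (\<lambda>\<xi>. f (k \<xi>)) + recession f * ereal (measure P N)"
proof -
  interpret P: prob_space P using P by (simp add: borel_probs_iff)
  interpret Q: prob_space Q using Q by (simp add: borel_probs_iff)
  have sets [measurable_cong]: "sets P = sets M" "sets Q = sets M" using P Q by (simp_all add: borel_probs_iff)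
  have space: "space P = S" "space Q = S" using sets by (auto dest!: sets_eq_imp_space_eq)
  obtain N Pc where N: "N \<in> null_sets Q" and Pc: "Pc = density P (indicator (space P - N))"
    and ac: "absolutely_continuous Q Pc" and div_eq: "f_divergence f Q P =
      ereal_integral Q (\<lambda>\<xi>. f (enn2real (RN_deriv Q Pc \<xi>))) + recession f * ereal (measure P N)"
    using f_divergence_decomposition[of Q P f] sets P.finite_measure_axioms Q.finite_measure_axioms by metis
  have NM: "N \<in> sets P" using N sets by auto
  have Pc_r: "Pc = density P (\<lambda>\<xi>. ennreal (indicator (space P - N) \<xi>))" unfolding Pc
    by (intro density_cong) (use NM in \<open>auto split: split_indicator\<close>)
  have sets_Pc: "sets Pc = sets M" using sets by (simp add: Pc)
  have "finite_measure Pc" unfolding Pc using NM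
    by (intro P.finite_measure_restricted) auto
  then interpret Pc: finite_measure Pc .
  define k where "k \<xi> = enn2real (RN_deriv Q Pc \<xi>)" for \<xi>
  have k_meas [measurable]: "k \<in> borel_measurable Q" unfolding k_def by measurable
  have k_nn: "0 \<le> k \<xi>" for \<xi> by (simp add: k_def)
  have "density Q (RN_deriv Q Pc) = Pc"
    using ac sets sets_Pc by (intro Q.density_RN_deriv) auto
  \<comment> \<open>\<open>Pc\<close> is finite, so its derivative is almost everywhere finite and
    \<open>enn2real\<close> discards nothing.\<close>
  moreover have "AE \<xi> in Q. RN_deriv Q Pc \<xi> \<noteq> \<infinity>"
    using ac sets sets_Pc Pc.sigma_finite_measure_axioms by (intro Q.RN_deriv_finite) auto
  then have "density Q (RN_deriv Q Pc) = density Q (\<lambda>\<xi>. ennreal (k \<xi>))"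
    by (intro density_cong) (auto elim!: eventually_mono simp: k_def top.not_eq_extremum)
  ultimately have Pc_k: "Pc = density Q (\<lambda>\<xi>. ennreal (k \<xi>))" by simp
  have int_k: "integrable Q (\<lambda>\<xi>. k \<xi> * u \<xi>) \<and> (\<integral>\<xi>. k \<xi> * u \<xi> \<partial>Q) = (\<integral>\<xi>. u \<xi> * indicator (S - N) \<xi> \<partial>P)"
    if u: "integrable P u" for u
  proof -
    have um: "u \<in> borel_measurable Q" "u \<in> borel_measurable P"
      using borel_measurable_integrable[OF u] by (simp_all add: measurable_cong_sets[OF sets(1) refl] measurable_cong_sets[OF sets(2) refl])
    have "integrable Pc u" unfolding Pc_r using u um NM
      by (subst integrable_real_density) (auto intro!: integrable_real_mult_indicator simp: mult.commute)
    then have "integrable Q (\<lambda>\<xi>. k \<xi> * u \<xi>)"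
      unfolding Pc_k using um k_nn by (subst (asm) integrable_real_density) auto
    moreover have "(\<integral>\<xi>. u \<xi> \<partial>Pc) = (\<integral>\<xi>. k \<xi> * u \<xi> \<partial>Q)"
      unfolding Pc_k using um k_nn by (subst integral_real_density) auto
    moreover have "(\<integral>\<xi>. u \<xi> \<partial>Pc) = (\<integral>\<xi>. u \<xi> * indicator (S - N) \<xi> \<partial>P)"
      unfolding Pc_r space using um NM space by (subst integral_real_density) (auto simp: mult.commute)
    ultimately show ?thesis by simp
  qed
  show ?thesis
    by (rule that[OF N k_meas k_nn int_k]) (simp_all only: div_eq k_def)
qed

lemma weak_duality_coupling:
  assumes P: "P \<in> borel_probs S" and Q: "Q \<in> borel_probs S" and \<pi>: "\<pi> \<in> couplings P' Q"
    and cost: "(\<integral>\<^sup>+(\<xi>, \<xi>'). ennreal (d \<xi> \<xi>') \<partial>\<pi>) \<le> ennreal e" "0 \<le> e"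
    and div: "f_divergence f Q P \<le> ereal r"
    and dual: "0 \<le> lam" "0 \<le> \<gamma>" "recession f = \<infinity> \<or> ereal (L - \<eta>) \<le> recession f * ereal lam"
    and G: "integrable P' G" "AE \<xi> in P'. g (range real) \<eta> lam \<gamma> \<xi> = ereal (G \<xi>)"
  shows "(\<integral>\<xi>. l \<xi> \<partial>P) \<le> (\<integral>\<xi>. G \<xi> \<partial>P') + (r * lam + \<eta> + e * \<gamma>)"
proof -
  interpret P: prob_space P using P by (simp add: borel_probs_iff)
  interpret Q: prob_space Q using Q by (simp add: borel_probs_iff)
  have sets [measurable_cong]: "sets P = sets M" "sets Q = sets M" using P Q by (simp_all add: borel_probs_iff)
  have space: "space P = S" "space Q = S" using sets by (auto dest!: sets_eq_imp_space_eq)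
  obtain N k where N: "N \<in> null_sets Q" and k_meas [measurable]: "k \<in> borel_measurable Q"
    and k_nn: "\<And>\<xi>. 0 \<le> k \<xi>"
    and int_k: "\<And>u. integrable P u \<Longrightarrow> integrable Q (\<lambda>\<xi>. k \<xi> * u \<xi>) \<and>
       (\<integral>\<xi>. k \<xi> * u \<xi> \<partial>Q) = (\<integral>\<xi>. u \<xi> * indicator (S - N) \<xi> \<partial>P)"
    and div_eq: "f_divergence f Q P = ereal_integral Q (\<lambda>\<xi>. f (k \<xi>)) + recession f * ereal (measure P N)"
    by (rule f_divergence_density[OF P Q]) blast
  have NM: "N \<in> sets P" using N sets by auto
  define m where "m = measure P N"
  have m_nn: "0 \<le> m" by (simp add: m_def)
  have k1: "integrable Q k" "(\<integral>\<xi>. k \<xi> \<partial>Q) = 1 - m"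
  proof -
    have "(\<integral>\<xi>. indicator (S - N) \<xi> \<partial>P) = measure P (S - N)" using NM space by (simp add: Int_absorb2)
    also have "\<dots> = 1 - m" using P.prob_compl[OF NM] space by (simp add: m_def)
    finally show "integrable Q k" "(\<integral>\<xi>. k \<xi> \<partial>Q) = 1 - m" using int_k[of "\<lambda>_. 1"] by simp_all
  qed
  have intlP: "integrable P l" using P.finite_measure_axioms sets(1) by (rule l_integrable)
  note kl = int_k[OF intlP]
  \<comment> \<open>The singular part sits on \<open>N\<close>, where the loss is bounded by
    \<open>L\<close>.\<close>
  have lP: "(\<integral>\<xi>. l \<xi> \<partial>P) \<le> (\<integral>\<xi>. k \<xi> * l \<xi> \<partial>Q) + L * m"
  proof -
    have i1: "integrable P (\<lambda>\<xi>. l \<xi> * indicator (S - N) \<xi>)" "integrable P (\<lambda>\<xi>. L * indicator N \<xi>)"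
      using NM space intlP sets.top[of P]
      by (auto intro!: integrable_real_mult_indicator sets.Diff simp: less_top[symmetric])
    have "(\<integral>\<xi>. l \<xi> \<partial>P) \<le> (\<integral>\<xi>. l \<xi> * indicator (S - N) \<xi> + L * indicator N \<xi> \<partial>P)"
      using loss_le space by (intro integral_mono intlP Bochner_Integration.integrable_add i1) (auto split: split_indicator)
    also have "\<dots> = (\<integral>\<xi>. k \<xi> * l \<xi> \<partial>Q) + L * m"
      using i1 kl NM sets.sets_into_space[OF NM] by (simp add: m_def Int_absorb2)
    finally show ?thesis .
  qed
  \<comment> \<open>The tangent of \<open>f\<close> at 1 is an integrable minorant of
    \<open>f (k \<xi>)\<close>, and an infinite integral would contradict the divergence
    bound.\<close>
  obtain v where v: "integrable Q v" "AE \<xi> in Q. f (k \<xi>) = ereal (v \<xi>)"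
    "ereal_integral Q (\<lambda>\<xi>. f (k \<xi>)) = ereal (\<integral>\<xi>. v \<xi> \<partial>Q)"
  proof (rule ereal_integral_bounded_below)
    show "(\<lambda>\<xi>. f (k \<xi>)) \<in> borel_measurable Q" using k_nn by (intro f_measurable) auto
    show "integrable Q (\<lambda>\<xi>. F 1 + slope 1 * (k \<xi> - 1))" using k1 by simp
    show "AE \<xi> in Q. ereal (F 1 + slope 1 * (k \<xi> - 1)) \<le> f (k \<xi>)" using k_nn by (intro AE_I2 f_subgradient) auto
    show "ereal_integral Q (\<lambda>\<xi>. f (k \<xi>)) \<noteq> \<infinity>"
    proof
      assume "ereal_integral Q (\<lambda>\<xi>. f (k \<xi>)) = \<infinity>"
      then show False using div div_eq recession_not_minf by simp
    qed
  qed
  have div': "ereal (\<integral>\<xi>. v \<xi> \<partial>Q) + recession f * ereal m \<le> ereal r"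
    using div div_eq v(3) by (simp add: m_def)
  \<comment> \<open>The dual constraint pays for the singular mass: \<open>(L - \<eta>) * m\<close>
    is at most \<open>lam\<close> times the recession term. With infinite recession slope a finite
    divergence leaves no singular mass.\<close>
  have sing: "lam * (\<integral>\<xi>. v \<xi> \<partial>Q) + (L - \<eta>) * m \<le> lam * r"
  proof (cases "recession f")
    case (real \<rho>)
    then have "(L - \<eta>) * m \<le> \<rho> * lam * m" using dual(3) m_nn by (intro mult_right_mono) auto
    moreover have "lam * ((\<integral>\<xi>. v \<xi> \<partial>Q) + \<rho> * m) \<le> lam * r"
      using div' real dual(1) by (intro mult_left_mono) auto
    ultimately show ?thesis by (simp add: algebra_simps)
  next
    case PInf
    then have "m = 0" using div' m_nn by (cases "m = 0") auto
    then show ?thesis using div' dual(1) by (auto intro: mult_left_mono simp flip: zero_ereal_def)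
  next
    case MInf
    then show ?thesis using recession_not_minf by simp
  qed
  have sets_\<pi>: "sets \<pi> = sets (M \<Otimes>\<^sub>M M)"
    using \<pi> sets sets_P' by (auto simp: couplings_def cong: sets_pair_measure_cong)
  then have space_\<pi>: "space \<pi> = S \<times> S" using sets_eq_imp_space_eq[OF sets_\<pi>] by (simp add: space_pair_measure)
  have dm: "(\<lambda>p. d (fst p) (snd p)) \<in> borel_measurable \<pi>"
    using d_measurable by (simp add: measurable_cong_sets[OF sets_\<pi> refl])
  have d_fin: "(\<integral>\<^sup>+p. ennreal (d (fst p) (snd p)) \<partial>\<pi>) \<le> ennreal e" using cost(1) by (simp add: case_prod_unfold)
  have d_int: "integrable \<pi> (\<lambda>p. d (fst p) (snd p))"
  proof (rule integrableI_bounded[OF dm])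
    have "(\<integral>\<^sup>+p. ennreal (norm (d (fst p) (snd p))) \<partial>\<pi>) = (\<integral>\<^sup>+p. ennreal (d (fst p) (snd p)) \<partial>\<pi>)"
      using d_nonneg space_\<pi> by (intro nn_integral_cong) auto
    then show "(\<integral>\<^sup>+p. ennreal (norm (d (fst p) (snd p))) \<partial>\<pi>) < \<infinity>" using d_fin by (simp add: le_less_trans)
  qed
  have d_le: "(\<integral>p. d (fst p) (snd p) \<partial>\<pi>) \<le> e"
  proof -
    have "ennreal (\<integral>p. d (fst p) (snd p) \<partial>\<pi>) \<le> ennreal e"
      using d_fin d_nonneg space_\<pi> by (subst nn_integral_eq_integral[OF d_int, symmetric]) auto
    then show ?thesis using cost(2) by (simp add: ennreal_le_iff)
  qed
  \<comment> \<open>The part of the Lagrangian at density \<open>k\<close> that depends on the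
    target point alone, so that the second marginal of the coupling integrates it.\<close>
  define h where "h \<xi> = k \<xi> * l \<xi> - \<eta> * k \<xi> - lam * v \<xi>" for \<xi>
  have h: "integrable Q h" "(\<integral>\<xi>. h \<xi> \<partial>Q) = (\<integral>\<xi>. k \<xi> * l \<xi> \<partial>Q) - \<eta> * (1 - m) - lam * (\<integral>\<xi>. v \<xi> \<partial>Q)"
    unfolding h_def using kl k1 v(1) by simp_all
  have "(\<integral>p. h (snd p) - \<gamma> * d (fst p) (snd p) \<partial>\<pi>) \<le> (\<integral>p. G (fst p) \<partial>\<pi>)"
  proof (rule integral_mono_AE)
    show "integrable \<pi> (\<lambda>p. h (snd p) - \<gamma> * d (fst p) (snd p))"
      using integral_couplings(2)[OF \<pi> h(1)] d_int by simp
    show "integrable \<pi> (\<lambda>p. G (fst p))" using integral_couplings(1)[OF \<pi> G(1)] by simp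
    have "AE p in \<pi>. p \<in> S \<times> S" using space_\<pi> by (intro AE_I2) auto
    with AE_couplings_fst[OF \<pi> G(2)] AE_couplings_snd[OF \<pi> v(2)]
    show "AE p in \<pi>. h (snd p) - \<gamma> * d (fst p) (snd p) \<le> G (fst p)"
    proof eventually_elim
      fix p assume p: "g (range real) \<eta> lam \<gamma> (fst p) = ereal (G (fst p))"
        "f (k (snd p)) = ereal (v (snd p))" "p \<in> S \<times> S"
      then show "h (snd p) - \<gamma> * d (fst p) (snd p) \<le> G (fst p)"
        using conjugate_le_g[of "snd p" lam "k (snd p)" \<eta> \<gamma> "fst p"] dual(1) k_nn
        by (auto simp: h_def algebra_simps)
    qed
  qed
  also have "(\<integral>p. G (fst p) \<partial>\<pi>) = (\<integral>\<xi>. G \<xi> \<partial>P')" using integral_couplings(1)[OF \<pi> G(1)] by simp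
  also have "(\<integral>p. h (snd p) - \<gamma> * d (fst p) (snd p) \<partial>\<pi>) = (\<integral>\<xi>. h \<xi> \<partial>Q) - \<gamma> * (\<integral>p. d (fst p) (snd p) \<partial>\<pi>)"
    using integral_couplings(2)[OF \<pi> h(1)] d_int by simp
  finally have "(\<integral>\<xi>. k \<xi> * l \<xi> \<partial>Q) - \<eta> * (1 - m) - lam * (\<integral>\<xi>. v \<xi> \<partial>Q) - \<gamma> * (\<integral>p. d (fst p) (snd p) \<partial>\<pi>)
      \<le> (\<integral>\<xi>. G \<xi> \<partial>P')" unfolding h(2) .
  moreover have "\<gamma> * (\<integral>p. d (fst p) (snd p) \<partial>\<pi>) \<le> \<gamma> * e" using d_le dual(2) by (rule mult_left_mono)
  ultimately show ?thesis using lP sing by (simp add: algebra_simps)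
qed

lemma g_finite_integral:
  assumes "0 \<in> D" "countable D" "0 \<le> \<gamma>" "ereal_integral P' (g D \<eta> lam \<gamma>) \<noteq> \<infinity>"
  obtains G where "integrable P' G" "AE \<xi> in P'. g D \<eta> lam \<gamma> \<xi> = ereal (G \<xi>)"
    "ereal_integral P' (g D \<eta> lam \<gamma>) = ereal (\<integral>\<xi>. G \<xi> \<partial>P')"
proof (rule ereal_integral_bounded_below[OF _ _ _ assms(4)])
  show "g D \<eta> lam \<gamma> \<in> borel_measurable P'"
    using g_measurable[OF assms(2,3)] by (simp add: measurable_cong_sets[OF sets_P' refl])
  show "integrable P' (\<lambda>_. - \<eta>)" by simp
  show "AE \<xi> in P'. ereal (- \<eta>) \<le> g D \<eta> lam \<gamma> \<xi>" using assms(1) by (intro AE_I2 g_lower) auto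
qed

lemma weak_duality:
  assumes P: "P \<in> borel_probs S" and div: "smoothed_divergence S f d \<epsilon> P' P \<le> ereal r"
    and \<epsilon>: "0 \<le> \<epsilon>"
    and dual: "0 \<le> lam" "0 \<le> \<gamma>" "recession f = \<infinity> \<or> ereal (L - \<eta>) \<le> recession f * ereal lam"
  shows "ereal (\<integral>\<xi>. l \<xi> \<partial>P) \<le>
    ereal_integral P' (g (range real) \<eta> lam \<gamma>) + ereal (r * lam + \<eta> + \<epsilon> * \<gamma>)"
proof (cases "ereal_integral P' (g (range real) \<eta> lam \<gamma>) = \<infinity>")
  case False
  obtain G where G: "integrable P' G" "AE \<xi> in P'. g (range real) \<eta> lam \<gamma> \<xi> = ereal (G \<xi>)"
    "ereal_integral P' (g (range real) \<eta> lam \<gamma>) = ereal (\<integral>\<xi>. G \<xi> \<partial>P')"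
  proof (rule g_finite_integral[OF _ _ dual(2) False])
    show "0 \<in> range real" by (rule range_eqI[of _ _ 0]) simp
    show "countable (range real)" by simp
  qed
  have "(\<integral>\<xi>. l \<xi> \<partial>P) \<le> (\<integral>\<xi>. G \<xi> \<partial>P') + (r * lam + \<eta> + \<epsilon> * \<gamma>)"
  proof (rule field_le_epsilon)
    fix e :: real assume "0 < e"
    \<comment> \<open>Neither infimum need be attained, so \<open>r\<close> and
      \<open>\<epsilon>\<close> are both enlarged by \<open>\<tau>\<close>; its size keeps the
      change \<open>\<tau> * (lam + \<gamma>)\<close> of the bound at most \<open>e\<close>.\<close>
    define \<tau> where "\<tau> = e / (lam + \<gamma> + 1)"
    have \<tau>: "0 < \<tau>" using \<open>0 < e\<close> dual unfolding \<tau>_def by (intro divide_pos_pos) auto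
    have "\<tau> * (lam + \<gamma>) \<le> \<tau> * (lam + \<gamma> + 1)" using \<tau> by (intro mult_left_mono) auto
    also have "\<dots> = e" using dual by (simp add: \<tau>_def)
    finally have \<tau>e: "\<tau> * lam + \<tau> * \<gamma> \<le> e" by (simp add: algebra_simps)
    have "smoothed_divergence S f d \<epsilon> P' P < ereal (r + \<tau>)" using div \<tau> by (auto intro: le_less_trans)
    then obtain Q where Q: "Q \<in> borel_probs S" "transport_cost d P' Q \<le> ennreal \<epsilon>"
      "f_divergence f Q P < ereal (r + \<tau>)"
      unfolding smoothed_divergence_def Inf_less_iff by auto
    have "transport_cost d P' Q < ennreal (\<epsilon> + \<tau>)"
      using Q(2) \<epsilon> \<tau> by (auto intro!: le_less_trans[OF Q(2)] ennreal_lessI)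
    then obtain \<pi> where \<pi>: "\<pi> \<in> couplings P' Q" "(\<integral>\<^sup>+(\<xi>, \<xi>'). ennreal (d \<xi> \<xi>') \<partial>\<pi>) < ennreal (\<epsilon> + \<tau>)"
      unfolding transport_cost_def by (auto simp: INF_less_iff)
    have "(\<integral>\<xi>. l \<xi> \<partial>P) \<le> (\<integral>\<xi>. G \<xi> \<partial>P') + ((r + \<tau>) * lam + \<eta> + (\<epsilon> + \<tau>) * \<gamma>)"
      by (rule weak_duality_coupling[OF P Q(1) \<pi>(1) less_imp_le[OF \<pi>(2)] _ less_imp_le[OF Q(3)] dual G(1,2)])
         (use \<epsilon> \<tau> in auto)
    then show "(\<integral>\<xi>. l \<xi> \<partial>P) \<le> (\<integral>\<xi>. G \<xi> \<partial>P') + (r * lam + \<eta> + \<epsilon> * \<gamma>) + e"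
      using \<tau>e by (simp add: algebra_simps)
  qed
  then show ?thesis using G(3) by simp
qed simp

section \<open>Attainable primal values\<close>

lemma max_loss_attained:
  obtains \<xi> where "\<xi> \<in> S" "l \<xi> = L"
proof -
  obtain \<xi> where \<xi>: "\<xi> \<in> S" "\<forall>y\<in>S. l y \<le> l \<xi>"
    using attains_max[OF compact_S S_ne closed_l] by blast
  then have "L = l \<xi>" unfolding max_loss_def by (intro cSup_eq_maximum) auto
  then show ?thesis using \<xi> that by auto
qed

text \<open>On a randomisation space \<open>\<Omega>\<close>, \<open>Q\<close> is the law of
  \<open>T\<close>, and \<open>P\<close> is the law of \<open>T\<close> under density
  \<open>h\<close> plus mass \<open>m\<close> at a maximiser of the loss. Apart from the atom, the
  density of \<open>P\<close> with respect to \<open>Q\<close> is the conditional expectation of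
  \<open>h\<close> given \<open>T\<close>; integrating the subgradient inequality at that density
  gives Jensen's inequality without conditional expectations.\<close>

lemma primal_bound:
  fixes X T :: "'w \<Rightarrow> 'a" and h :: "'w \<Rightarrow> real"
  assumes "prob_space \<Omega>" and [measurable]: "X \<in> \<Omega> \<rightarrow>\<^sub>M M" "T \<in> \<Omega> \<rightarrow>\<^sub>M M" "h \<in> borel_measurable \<Omega>"
    and X: "distr \<Omega> M X = P'"
    and h: "0 < c" "\<And>\<omega>. c \<le> h \<omega>" "\<And>\<omega>. h \<omega> \<le> H"
    and m: "0 \<le> m" "recession f = \<infinity> \<and> m = 0 \<or> recession f = ereal \<rho>"
    and mass: "(\<integral>\<omega>. h \<omega> \<partial>\<Omega>) + m = 1"
    and div: "(\<integral>\<omega>. F (h \<omega>) \<partial>\<Omega>) + \<rho> * m \<le> r"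
    and cost: "integrable \<Omega> (\<lambda>\<omega>. d (X \<omega>) (T \<omega>))" "(\<integral>\<omega>. d (X \<omega>) (T \<omega>) \<partial>\<Omega>) \<le> \<epsilon>"
  shows "ereal ((\<integral>\<omega>. h \<omega> * l (T \<omega>) \<partial>\<Omega>) + L * m) \<le> predictor S f d \<epsilon> r loss x0 P'"
proof -
  interpret \<Omega>: prob_space \<Omega> by fact
  obtain \<xi>s where \<xi>s: "\<xi>s \<in> S" "l \<xi>s = L" by (rule max_loss_attained)
  have sing: "{\<xi>s} \<in> sets M" using \<xi>s by (intro closed_sets_M) auto
  have TS: "T \<omega> \<in> S" "X \<omega> \<in> S" if "\<omega> \<in> space \<Omega>" for \<omega>
    using measurable_space[OF assms(3) that] measurable_space[OF assms(2) that] by auto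
  have h_nn: "0 \<le> h \<omega>" for \<omega> using h(1) h(2)[of \<omega>] by simp
  have int_h: "integrable \<Omega> (\<lambda>\<omega>. h \<omega> * u \<omega>)" if [measurable]: "u \<in> borel_measurable \<Omega>"
    and u: "\<And>\<omega>. \<omega> \<in> space \<Omega> \<Longrightarrow> \<bar>u \<omega>\<bar> \<le> B" for u B
  proof (rule \<Omega>.integrable_const_bound[of _ "H * B"])
    show "AE \<omega> in \<Omega>. norm (h \<omega> * u \<omega>) \<le> H * B"
      using h(3) h_nn u by (intro AE_I2) (auto simp: abs_mult intro!: mult_mono order_trans[OF h_nn h(3)])
  qed measurable
  have int_b: "integrable \<Omega> u" if [measurable]: "u \<in> borel_measurable \<Omega>"
    and u: "\<And>\<omega>. \<omega> \<in> space \<Omega> \<Longrightarrow> \<bar>u \<omega>\<bar> \<le> B" for u :: "'w \<Rightarrow> real" and B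
    using u by (intro \<Omega>.integrable_const_bound[of _ B] AE_I2) auto
  have h_int: "integrable \<Omega> h" using int_h[of "\<lambda>_. 1" 1] by simp
  define Q where "Q = distr \<Omega> M T"
  define P1 where "P1 = distr (density \<Omega> (\<lambda>\<omega>. ennreal (h \<omega>))) M T"
  define P2 where "P2 = density (return M \<xi>s) (\<lambda>_. ennreal m)"
  have sets1: "sets P1 = sets M" "sets P2 = sets M" by (simp_all add: P1_def P2_def)
  obtain P where P: "sets P = sets P1" "\<And>A. A \<in> sets P1 \<Longrightarrow> emeasure P A = emeasure P1 A + emeasure P2 A"
    by (rule measure_sum_exists[of P2 P1]) (use sets1 in auto)
  have setsP: "sets P = sets M" "sets P1 = sets P" "sets P2 = sets P" using P(1) sets1 by auto
  have space_P: "space P = S" using sets_eq_imp_space_eq[OF setsP(1)] by simp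
  have int_P: "integrable P u \<and> (\<integral>\<xi>. u \<xi> \<partial>P) = (\<integral>\<omega>. h \<omega> * u (T \<omega>) \<partial>\<Omega>) + m * u \<xi>s"
    if um [measurable]: "u \<in> borel_measurable M" and u: "\<And>\<xi>. \<xi> \<in> S \<Longrightarrow> \<bar>u \<xi>\<bar> \<le> B" for u B
  proof -
    have i: "integrable \<Omega> (\<lambda>\<omega>. h \<omega> * u (T \<omega>))" using u TS by (intro int_h[of _ B]) auto
    have i1: "integrable P1 u" "(\<integral>\<xi>. u \<xi> \<partial>P1) = (\<integral>\<omega>. h \<omega> * u (T \<omega>) \<partial>\<Omega>)"
      unfolding P1_def using i h_nn
      by (simp_all add: integrable_distr_eq integral_distr integrable_real_density integral_real_density)
    have r: "integrable (return M \<xi>s) u" "(\<integral>\<xi>. u \<xi> \<partial>return M \<xi>s) = u \<xi>s"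
    proof -
      interpret R: prob_space "return M \<xi>s" using \<xi>s by (intro prob_space_return) simp
      show "integrable (return M \<xi>s) u" using u by (intro R.integrable_const_bound[of _ B] AE_I2) auto
      show "(\<integral>\<xi>. u \<xi> \<partial>return M \<xi>s) = u \<xi>s" using \<xi>s by (intro integral_return) auto
    qed
    have i2: "integrable P2 u" "(\<integral>\<xi>. u \<xi> \<partial>P2) = m * u \<xi>s"
      unfolding P2_def using r m(1) by (simp_all add: integrable_real_density integral_real_density)
    show ?thesis
      using integral_measure_sum[OF setsP(2,3) _ i1(1) i2(1)] P(2) setsP i1(2) i2(2) by simp
  qed
  have "emeasure P S = 1"
  proof -
    have "emeasure P1 S = (\<integral>\<^sup>+\<omega>. ennreal (h \<omega>) \<partial>\<Omega>)"
      unfolding P1_def using sets.top[of M]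
      by (subst emeasure_distr) (auto simp: emeasure_density TS vimage_def intro!: nn_integral_cong split: split_indicator)
    also have "\<dots> = ennreal (\<integral>\<omega>. h \<omega> \<partial>\<Omega>)" using h_int h_nn by (intro nn_integral_eq_integral) auto
    finally have "emeasure P S = ennreal (\<integral>\<omega>. h \<omega> \<partial>\<Omega>) + ennreal m"
      using P(2)[of S] sets1 sets.top[of M] \<xi>s by (simp add: P2_def emeasure_density_const)
    also have "\<dots> = ennreal 1" using m(1) h_nn mass by (subst ennreal_plus[symmetric]) (auto intro!: integral_nonneg_AE)
    finally show ?thesis by simp
  qed
  then have P_prob: "P \<in> borel_probs S" using setsP(1) space_P by (auto simp: borel_probs_iff intro!: prob_spaceI)
  have Q_prob: "Q \<in> borel_probs S" unfolding borel_probs_iff Q_def by (auto intro!: \<Omega>.prob_space_distr)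
  interpret P: prob_space P using P_prob by (simp add: borel_probs_iff)
  interpret Q: prob_space Q using Q_prob by (simp add: borel_probs_iff)
  have sets_Q [measurable_cong]: "sets Q = sets M" by (simp add: Q_def)
  have space_Q: "space Q = S" using sets_eq_imp_space_eq[OF sets_Q] by simp
  have int_Q: "(\<integral>\<xi>. u \<xi> \<partial>Q) = (\<integral>\<omega>. u (T \<omega>) \<partial>\<Omega>)" if "u \<in> borel_measurable M" for u :: "'a \<Rightarrow> real"
    unfolding Q_def using that by (intro integral_distr) auto
  have transport: "transport_cost d P' Q \<le> ennreal \<epsilon>"
  proof -
    define \<pi> where "\<pi> = distr \<Omega> (M \<Otimes>\<^sub>M M) (\<lambda>\<omega>. (X \<omega>, T \<omega>))"
    have "\<pi> \<in> couplings P' Q"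
      unfolding couplings_def
    proof (intro CollectI conjI)
      show "sets \<pi> = sets (P' \<Otimes>\<^sub>M Q)" unfolding \<pi>_def using sets_P' sets_Q
        by (simp cong: sets_pair_measure_cong)
      have "distr \<pi> P' fst = distr \<pi> M fst" using sets_P' by (intro distr_cong) auto
      also have "\<dots> = distr \<Omega> M X" unfolding \<pi>_def by (subst distr_distr) (auto simp: comp_def)
      finally show "distr \<pi> P' fst = P'" using X by simp
      have "distr \<pi> Q snd = distr \<pi> M snd" using sets_Q by (intro distr_cong) auto
      also have "\<dots> = distr \<Omega> M T" unfolding \<pi>_def by (subst distr_distr) (auto simp: comp_def)
      finally show "distr \<pi> Q snd = Q" by (simp add: Q_def)
    qed
    then have "transport_cost d P' Q \<le> (\<integral>\<^sup>+(\<xi>, \<xi>'). ennreal (d \<xi> \<xi>') \<partial>\<pi>)"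
      unfolding transport_cost_def by (rule INF_lower)
    also have "\<dots> = (\<integral>\<^sup>+p. ennreal (d (fst p) (snd p)) \<partial>\<pi>)" by (simp add: case_prod_unfold)
    also have "\<dots> = (\<integral>\<^sup>+\<omega>. ennreal (d (X \<omega>) (T \<omega>)) \<partial>\<Omega>)"
      unfolding \<pi>_def using d_measurable by (subst nn_integral_distr) auto
    also have "\<dots> = ennreal (\<integral>\<omega>. d (X \<omega>) (T \<omega>) \<partial>\<Omega>)"
      using cost(1) TS d_nonneg by (intro nn_integral_eq_integral AE_I2) auto
    also have "\<dots> \<le> ennreal \<epsilon>" using cost(2) by (rule ennreal_leI)
    finally show ?thesis .
  qed
  obtain N k where N: "N \<in> null_sets Q" and k_meas [measurable]: "k \<in> borel_measurable Q"
    and k_nn: "\<And>\<xi>. 0 \<le> k \<xi>"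
    and int_k: "\<And>u. integrable P u \<Longrightarrow> integrable Q (\<lambda>\<xi>. k \<xi> * u \<xi>) \<and>
       (\<integral>\<xi>. k \<xi> * u \<xi> \<partial>Q) = (\<integral>\<xi>. u \<xi> * indicator (S - N) \<xi> \<partial>P)"
    and div_eq: "f_divergence f Q P = ereal_integral Q (\<lambda>\<xi>. f (k \<xi>)) + recession f * ereal (measure P N)"
    by (rule f_divergence_density[OF P_prob Q_prob]) blast
  have NM [measurable]: "N \<in> sets M" using N sets_Q by auto
  have T_N: "AE \<omega> in \<Omega>. T \<omega> \<notin> N"
  proof (rule AE_distrD[of T \<Omega> M])
    show "AE \<xi> in distr \<Omega> M T. \<xi> \<notin> N" using N unfolding Q_def by (rule AE_not_in)
  qed simp
  \<comment> \<open>\<open>b\<close> is 1 if the atom counts in the absolutely continuous part, and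
    0 if \<open>\<xi>s\<close> lies in \<open>N\<close>, so that it counts as singular.\<close>
  define b where "b = (indicator (S - N) \<xi>s :: real)"
  have int_k_u: "integrable Q (\<lambda>\<xi>. k \<xi> * u \<xi>)"
    "(\<integral>\<xi>. k \<xi> * u \<xi> \<partial>Q) = (\<integral>\<omega>. h \<omega> * u (T \<omega>) \<partial>\<Omega>) + m * (u \<xi>s * b)"
    if um [measurable]: "u \<in> borel_measurable M" and u: "\<And>\<xi>. \<xi> \<in> S \<Longrightarrow> \<bar>u \<xi>\<bar> \<le> B" for u B
  proof -
    show "integrable Q (\<lambda>\<xi>. k \<xi> * u \<xi>)" using int_P[OF um u] int_k[of u] by auto
    have SN [measurable]: "S - N \<in> sets M" using NM sets.compl_sets[of N M] by simp
    have "(\<integral>\<xi>. k \<xi> * u \<xi> \<partial>Q) = (\<integral>\<xi>. u \<xi> * indicator (S - N) \<xi> \<partial>P)" using int_P[OF um u] int_k[of u] by auto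
    also have "\<dots> = (\<integral>\<omega>. h \<omega> * (u (T \<omega>) * indicator (S - N) (T \<omega>)) \<partial>\<Omega>) + m * (u \<xi>s * b)"
      unfolding b_def
    proof (rule int_P[THEN conjunct2])
      show "\<bar>u \<xi> * indicator (S - N) \<xi>\<bar> \<le> B" if "\<xi> \<in> S" for \<xi>
        using u[OF that] by (cases "\<xi> \<in> N") (auto simp: that)
    qed measurable
    also have "(\<integral>\<omega>. h \<omega> * (u (T \<omega>) * indicator (S - N) (T \<omega>)) \<partial>\<Omega>) = (\<integral>\<omega>. h \<omega> * u (T \<omega>) \<partial>\<Omega>)"
    proof (rule integral_cong_AE)
      have "AE \<omega> in \<Omega>. T \<omega> \<in> S" using TS by (intro AE_I2) auto
      with T_N show "AE \<omega> in \<Omega>. h \<omega> * (u (T \<omega>) * indicator (S - N) (T \<omega>)) = h \<omega> * u (T \<omega>)"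
        by eventually_elim auto
    qed measurable
    finally show "(\<integral>\<xi>. k \<xi> * u \<xi> \<partial>Q) = (\<integral>\<omega>. h \<omega> * u (T \<omega>) \<partial>\<Omega>) + m * (u \<xi>s * b)" .
  qed
  have k_int: "integrable Q k" using int_k_u(1)[of "\<lambda>_. 1" 1] by simp
  have b: "0 \<le> b" "b \<le> 1" by (auto simp: b_def indicator_def)
  have intQ_ind: "integrable Q (indicator A :: 'a \<Rightarrow> real)" if "A \<in> sets M" for A
    using that by (intro Q.integrable_const_bound[of _ 1] AE_I2) (auto simp: sets_Q split: split_indicator)
  have intk_ind: "integrable Q (\<lambda>\<xi>. k \<xi> * indicator A \<xi>)" if "A \<in> sets M" for A
    using that by (intro int_k_u(1)[of _ 1]) (auto split: split_indicator)
  \<comment> \<open>Averages of \<open>h\<close> stay above \<open>c\<close>, and the atom can only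
    add mass.\<close>
  have ge: "AE \<xi> in Q. 0 \<le> k \<xi> - c"
  proof (rule Q.density_nonneg)
    fix A assume "A \<in> sets Q"
    then have A [measurable]: "A \<in> sets M" by (simp add: sets_Q)
    have "c * (\<integral>\<omega>. indicator A (T \<omega>) \<partial>\<Omega>) \<le> (\<integral>\<omega>. h \<omega> * indicator A (T \<omega>) \<partial>\<Omega>)"
      unfolding integral_mult_right_zero[symmetric] using h
      by (intro integral_mono int_h[of _ 1] integrable_mult_right int_b[of _ 1]) (auto simp: indicator_def)
    also have "\<dots> \<le> (\<integral>\<xi>. k \<xi> * indicator A \<xi> \<partial>Q)"
      using m(1) b by (subst int_k_u(2)[OF borel_measurable_indicator[OF A], of 1]) (auto split: split_indicator)
    finally have "0 \<le> (\<integral>\<xi>. k \<xi> * indicator A \<xi> \<partial>Q) - c * (\<integral>\<xi>. indicator A \<xi> \<partial>Q)"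
      using int_Q[of "indicator A"] by simp
    also have "\<dots> = (\<integral>\<xi>. k \<xi> * indicator A \<xi> - c * indicator A \<xi> \<partial>Q)"
      using intk_ind[OF A] intQ_ind[OF A] by simp
    also have "\<dots> = set_lebesgue_integral Q A (\<lambda>\<xi>. k \<xi> - c)"
      by (simp add: set_lebesgue_integral_def algebra_simps)
    finally show "0 \<le> set_lebesgue_integral Q A (\<lambda>\<xi>. k \<xi> - c)" .
  qed (use k_int in simp)
  \<comment> \<open>The upper bound \<open>H\<close> can fail only at \<open>\<xi>s\<close>, where
    the atom raises the density, so this point is removed.\<close>
  have le: "AE \<xi> in Q. 0 \<le> indicator (S - {\<xi>s}) \<xi> * (H - k \<xi>)"
  proof (rule Q.density_nonneg)
    fix A assume "A \<in> sets Q"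
    then have A [measurable]: "A \<in> sets M" by (simp add: sets_Q)
    define A' where "A' = A - {\<xi>s}"
    have A' [measurable]: "A' \<in> sets M" using sing by (simp add: A'_def)
    have "(\<integral>\<xi>. k \<xi> * indicator A' \<xi> \<partial>Q) = (\<integral>\<omega>. h \<omega> * indicator A' (T \<omega>) \<partial>\<Omega>)"
      by (subst int_k_u(2)[OF borel_measurable_indicator[OF A'], of 1]) (auto simp: A'_def split: split_indicator)
    also have "\<dots> \<le> H * (\<integral>\<omega>. indicator A' (T \<omega>) \<partial>\<Omega>)"
      unfolding integral_mult_right_zero[symmetric] using h
      by (intro integral_mono int_h[of _ 1] integrable_mult_right int_b[of _ 1]) (auto simp: indicator_def)
    finally have "0 \<le> H * (\<integral>\<xi>. indicator A' \<xi> \<partial>Q) - (\<integral>\<xi>. k \<xi> * indicator A' \<xi> \<partial>Q)"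
      using int_Q[of "indicator A'"] by simp
    also have "\<dots> = (\<integral>\<xi>. H * indicator A' \<xi> - k \<xi> * indicator A' \<xi> \<partial>Q)"
      using intk_ind[OF A'] intQ_ind[OF A'] by simp
    finally have "0 \<le> (\<integral>\<xi>. H * indicator A' \<xi> - k \<xi> * indicator A' \<xi> \<partial>Q)" .
    also have "\<dots> = set_lebesgue_integral Q A (\<lambda>\<xi>. indicator (S - {\<xi>s}) \<xi> * (H - k \<xi>))"
      unfolding set_lebesgue_integral_def
      by (intro Bochner_Integration.integral_cong) (auto simp: A'_def indicator_def space_Q)
    finally show "0 \<le> set_lebesgue_integral Q A (\<lambda>\<xi>. indicator (S - {\<xi>s}) \<xi> * (H - k \<xi>))" .
  next
    have "S - {\<xi>s} \<in> sets Q" using sing sets.compl_sets[of "{\<xi>s}" M] by (simp add: sets_Q)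
    then show "integrable Q (\<lambda>\<xi>. indicator (S - {\<xi>s}) \<xi> * (H - k \<xi>))"
      using k_int integrable_mult_indicator[of "S - {\<xi>s}" Q "\<lambda>\<xi>. H - k \<xi>"] by simp
  qed
  \<comment> \<open>At \<open>\<xi>s\<close> the density is a single number, so including
    \<open>k \<xi>s\<close> in the maximum bounds it there too. Clamping to \<open>[c, K]\<close>
    gives a version along which \<open>F\<close> and the slopes are bounded everywhere.\<close>
  define K where "K = max c (max H (k \<xi>s))"
  define k' where "k' \<xi> = max c (min K (k \<xi>))" for \<xi>
  have K: "c \<le> K" by (simp add: K_def)
  have k'_meas [measurable]: "k' \<in> borel_measurable M"
  proof -
    have "k \<in> borel_measurable M" using k_meas by (simp add: measurable_cong_sets[OF sets_Q refl])
    then show ?thesis unfolding k'_def by measurable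
  qed
  have k': "c \<le> k' \<xi>" "k' \<xi> \<le> K" for \<xi> using K by (auto simp: k'_def)
  have k'_pos: "0 < k' \<xi>" for \<xi> using k'(1)[of \<xi>] h(1) by simp
  have "AE \<xi> in Q. \<xi> \<in> S" using space_Q by (intro AE_I2) auto
  with ge le have kk': "AE \<xi> in Q. k \<xi> = k' \<xi>"
  proof eventually_elim
    fix \<xi> assume "0 \<le> k \<xi> - c" "0 \<le> indicator (S - {\<xi>s}) \<xi> * (H - k \<xi>)" "\<xi> \<in> S"
    then show "k \<xi> = k' \<xi>" by (cases "\<xi> = \<xi>s") (auto simp: k'_def K_def)
  qed
  obtain BF where BF: "\<And>t. c \<le> t \<Longrightarrow> t \<le> max H K \<Longrightarrow> \<bar>F t\<bar> \<le> BF" using F_bounded[OF h(1), of "max H K"] by blast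
  define a where "a \<xi> = slope (k' \<xi>)" for \<xi>
  have a_meas [measurable]: "a \<in> borel_measurable M"
    unfolding a_def by (rule slope_measurable[OF k'_meas h(1) k'(1)])
  have F_meas [measurable]: "(\<lambda>\<xi>. F (k' \<xi>)) \<in> borel_measurable M"
    using k'_pos by (intro F_measurable) (auto intro: less_imp_le)
  define Ba where "Ba = max \<bar>slope c\<bar> \<bar>slope K\<bar>"
  have Ba: "\<bar>a \<xi>\<bar> \<le> Ba" for \<xi>
    using slope_mono[OF h(1) k'(1)[of \<xi>]] slope_mono[OF k'_pos k'(2), of \<xi>] by (auto simp: a_def Ba_def)
  \<comment> \<open>\<open>v \<xi> + a \<xi> * t\<close> is the tangent of \<open>F\<close> at
    \<open>k' \<xi>\<close>: it is exact at \<open>t = k' \<xi>\<close> and a minorant at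
    \<open>t = h \<omega>\<close>.\<close>
  define v where "v \<xi> = F (k' \<xi>) - a \<xi> * k' \<xi>" for \<xi>
  have v_meas [measurable]: "v \<in> borel_measurable M" unfolding v_def by measurable
  have Bv: "\<bar>v \<xi>\<bar> \<le> BF + Ba * K" for \<xi>
  proof -
    have "\<bar>a \<xi> * k' \<xi>\<bar> \<le> Ba * K" unfolding abs_mult using Ba[of \<xi>] k'[of \<xi>] k'_pos[of \<xi>]
      by (intro mult_mono) auto
    moreover have "\<bar>F (k' \<xi>)\<bar> \<le> BF" using k'[of \<xi>] by (intro BF) auto
    ultimately show ?thesis unfolding v_def by linarith
  qed
  have intQ: "integrable Q u" if "u \<in> borel_measurable M" "\<And>\<xi>. \<bar>u \<xi>\<bar> \<le> B" for u :: "'a \<Rightarrow> real" and B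
    using that by (intro Q.integrable_const_bound[of _ B] AE_I2) (auto simp: measurable_cong_sets[OF sets_Q refl])
  have FQ: "integrable Q (\<lambda>\<xi>. F (k' \<xi>))" using k' by (intro intQ[of _ BF] BF max.coboundedI2) auto
  have "(\<integral>\<xi>. F (k' \<xi>) \<partial>Q) = (\<integral>\<xi>. v \<xi> + k \<xi> * a \<xi> \<partial>Q)"
  proof (rule integral_cong_AE)
    show "AE \<xi> in Q. F (k' \<xi>) = v \<xi> + k \<xi> * a \<xi>" using kk' by eventually_elim (simp add: v_def)
  qed measurable
  also have "\<dots> = (\<integral>\<xi>. v \<xi> \<partial>Q) + (\<integral>\<xi>. k \<xi> * a \<xi> \<partial>Q)"
    using Bv Ba by (intro Bochner_Integration.integral_add intQ[of _ "BF + Ba * K"] int_k_u(1)[of _ Ba]) auto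
  also have "\<dots> = (\<integral>\<omega>. v (T \<omega>) \<partial>\<Omega>) + (\<integral>\<omega>. h \<omega> * a (T \<omega>) \<partial>\<Omega>) + m * (a \<xi>s * b)"
    using Ba by (subst int_k_u(2)[of _ Ba]) (auto simp: int_Q)
  also have "(\<integral>\<omega>. v (T \<omega>) \<partial>\<Omega>) + (\<integral>\<omega>. h \<omega> * a (T \<omega>) \<partial>\<Omega>) = (\<integral>\<omega>. v (T \<omega>) + h \<omega> * a (T \<omega>) \<partial>\<Omega>)"
    using Bv Ba by (intro Bochner_Integration.integral_add[symmetric] int_b[of _ "BF + Ba * K"] int_h[of _ Ba]) auto
  also have "\<dots> \<le> (\<integral>\<omega>. F (h \<omega>) \<partial>\<Omega>)"
  proof (rule integral_mono)
    show "integrable \<Omega> (\<lambda>\<omega>. v (T \<omega>) + h \<omega> * a (T \<omega>))"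
      using Bv Ba by (intro Bochner_Integration.integrable_add int_b[of _ "BF + Ba * K"] int_h[of _ Ba]) auto
    show "integrable \<Omega> (\<lambda>\<omega>. F (h \<omega>))"
      using h h_nn by (intro int_b[of _ BF] BF F_measurable max.coboundedI1) auto
    show "v (T \<omega>) + h \<omega> * a (T \<omega>) \<le> F (h \<omega>)" for \<omega>
      using F_subgradient[OF k'_pos[of "T \<omega>"], of "h \<omega>"] h(1) h(2)[of \<omega>]
      by (simp add: v_def a_def algebra_simps)
  qed
  finally have FQ_le: "(\<integral>\<xi>. F (k' \<xi>) \<partial>Q) \<le> (\<integral>\<omega>. F (h \<omega>) \<partial>\<Omega>) + m * (a \<xi>s * b)" by simp
  have PN: "measure P N = m * (1 - b)"
  proof -
    have "measure P N = (\<integral>\<xi>. indicator N \<xi> \<partial>P)" using NM setsP sets.sets_into_space[OF NM] space_P by (simp add: Int_absorb2)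
    also have "\<dots> = (\<integral>\<omega>. h \<omega> * indicator N (T \<omega>) \<partial>\<Omega>) + m * indicator N \<xi>s"
      using int_P[of "indicator N" 1] by (simp add: indicator_def)
    also have "(\<integral>\<omega>. h \<omega> * indicator N (T \<omega>) \<partial>\<Omega>) = (\<integral>\<omega>. 0 \<partial>\<Omega>)"
      using T_N by (intro integral_cong_AE) (auto elim!: eventually_mono)
    finally show ?thesis using \<xi>s by (simp add: b_def indicator_def)
  qed
  have "f_divergence f Q P = ereal (\<integral>\<xi>. F (k' \<xi>) \<partial>Q) + recession f * ereal (m * (1 - b))"
  proof -
    have "ereal_integral Q (\<lambda>\<xi>. f (k \<xi>)) = ereal_integral Q (\<lambda>\<xi>. ereal (F (k' \<xi>)))"
      by (rule ereal_integral_cong_AE, use kk' in eventually_elim) (simp add: f_eq_F k'_pos)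
    then show ?thesis using div_eq PN ereal_integral_ereal[OF FQ] by simp
  qed
  also have "\<dots> \<le> ereal r"
    using m(2)
  proof
    assume "recession f = \<infinity> \<and> m = 0"
    then show ?thesis using FQ_le div by (simp flip: zero_ereal_def)
  next
    assume rec: "recession f = ereal \<rho>"
    \<comment> \<open>An absorbed atom adds at most \<open>a \<xi>s * m\<close> to the divergence
      instead of \<open>\<rho> * m\<close>, and no slope exceeds the recession slope.\<close>
    have "a \<xi>s \<le> \<rho>" using slope_le_recession[OF k'_pos[of \<xi>s]] rec by (simp add: a_def)
    then have "m * b * a \<xi>s \<le> m * b * \<rho>" using m(1) b by (intro mult_left_mono) auto
    then show ?thesis using FQ_le div rec by (simp add: algebra_simps)
  qed
  finally have div_le: "f_divergence f Q P \<le> ereal r" .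
  have "smoothed_divergence S f d \<epsilon> P' P \<le> ereal r"
    unfolding smoothed_divergence_def using Q_prob transport by (intro Inf_lower2[OF _ div_le]) auto
  then have "ereal (\<integral>\<xi>. l \<xi> \<partial>P) \<le> predictor S f d \<epsilon> r loss x0 P'"
    unfolding predictor_def using P_prob by (intro Sup_upper) auto
  moreover have "(\<integral>\<xi>. l \<xi> \<partial>P) = (\<integral>\<omega>. h \<omega> * l (T \<omega>) \<partial>\<Omega>) + m * L"
    using int_P[of l L] loss_nonneg loss_le \<xi>s by (simp add: abs_le_iff)
  ultimately show ?thesis by (simp add: mult.commute)
qed

section \<open>Transport plans and their mixtures\<close>

text \<open>The positive bounds on \<open>h\<close> keep \<open>F (h \<xi>)\<close> bounded, and one
  common radius from \<open>D\<close> keeps the cost bounded; \<open>D = {0}\<close> forces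
  zero-cost transport.\<close>

definition plan :: "real set \<Rightarrow> ('a \<Rightarrow> 'a) \<Rightarrow> ('a \<Rightarrow> real) \<Rightarrow> bool" where
  "plan D T h \<longleftrightarrow> T \<in> M \<rightarrow>\<^sub>M M \<and> h \<in> borel_measurable M \<and>
     (\<exists>c>0. \<exists>H. \<forall>\<xi>. c \<le> h \<xi> \<and> h \<xi> \<le> H) \<and> (\<exists>n\<in>D. \<forall>\<xi>\<in>S. d \<xi> (T \<xi>) \<le> n)"

definition plan_values :: "('a \<Rightarrow> 'a) \<Rightarrow> ('a \<Rightarrow> real) \<Rightarrow> real \<times> real \<times> real \<times> real" where
  "plan_values T h = (\<integral>\<xi>. h \<xi> * l (T \<xi>) \<partial>P', \<integral>\<xi>. h \<xi> \<partial>P', \<integral>\<xi>. F (h \<xi>) \<partial>P', \<integral>\<xi>. d \<xi> (T \<xi>) \<partial>P')"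

text \<open>A mixture of two plans is in general not a plan, because \<open>T\<close> is a map; the
  hull stands for randomised plans.\<close>

definition attainable :: "real set \<Rightarrow> (real \<times> real \<times> real \<times> real) set" where
  "attainable D = convex hull {plan_values T h | T h. plan D T h}"

lemma plan_integrable:
  assumes "plan D T h"
  shows "integrable P' (\<lambda>\<xi>. h \<xi> * l (T \<xi>))" "integrable P' h" "integrable P' (\<lambda>\<xi>. F (h \<xi>))"
    "integrable P' (\<lambda>\<xi>. d \<xi> (T \<xi>))"
proof -
  obtain c H n where [measurable]: "T \<in> M \<rightarrow>\<^sub>M M" "h \<in> borel_measurable M"
    and h: "0 < c" "\<And>\<xi>. c \<le> h \<xi>" "\<And>\<xi>. h \<xi> \<le> H" and n: "\<And>\<xi>. \<xi> \<in> S \<Longrightarrow> d \<xi> (T \<xi>) \<le> n"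
    using assms unfolding plan_def by blast
  have TS: "T \<xi> \<in> S" if "\<xi> \<in> S" for \<xi> using measurable_space[of T M M \<xi>] that by simp
  have h_nn: "0 \<le> h \<xi>" for \<xi> using h(1) h(2)[of \<xi>] by simp
  show "integrable P' (\<lambda>\<xi>. h \<xi> * l (T \<xi>))"
  proof (rule P'.integrable_const_bound[of _ "H * L"])
    have "\<bar>h \<xi> * l (T \<xi>)\<bar> \<le> H * L" if "\<xi> \<in> S" for \<xi>
      unfolding abs_mult using h(3)[of \<xi>] h_nn[of \<xi>] loss_nonneg[OF TS[OF that]] loss_le[OF TS[OF that]]
      by (intro mult_mono) auto
    then show "AE \<xi> in P'. norm (h \<xi> * l (T \<xi>)) \<le> H * L" by (intro AE_I2) simp
  qed measurable
  show "integrable P' h" using h h_nn by (intro P'.integrable_const_bound[of _ H] AE_I2) auto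
  obtain BF where BF: "\<And>t. c \<le> t \<Longrightarrow> t \<le> H \<Longrightarrow> \<bar>F t\<bar> \<le> BF" using F_bounded[OF h(1), of H] by blast
  have [measurable]: "(\<lambda>\<xi>. F (h \<xi>)) \<in> borel_measurable M" using h_nn by (intro F_measurable) auto
  show "integrable P' (\<lambda>\<xi>. F (h \<xi>))" using h BF by (intro P'.integrable_const_bound[of _ BF] AE_I2) auto
  show "integrable P' (\<lambda>\<xi>. d \<xi> (T \<xi>))"
    using n d_nonneg TS by (intro P'.integrable_const_bound[of _ n] AE_I2) auto
qed

lemma plan_const: "0 \<in> D \<Longrightarrow> 0 < t \<Longrightarrow> plan D (\<lambda>\<xi>. \<xi>) (\<lambda>_. t)"
  unfolding plan_def by (auto simp: d_refl)

lemma attainable_const: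
  assumes "0 \<in> D" "0 < t"
  shows "(t * (\<integral>\<xi>. l \<xi> \<partial>P'), t, F t, 0) \<in> attainable D"
proof -
  have "(\<integral>\<xi>. d \<xi> \<xi> \<partial>P') = (\<integral>\<xi>. 0 \<partial>P')" by (rule Bochner_Integration.integral_cong) (auto simp: d_refl)
  then have "plan_values (\<lambda>\<xi>. \<xi>) (\<lambda>_. t) = (t * (\<integral>\<xi>. l \<xi> \<partial>P'), t, F t, 0)"
    using P'.prob_space by (simp add: plan_values_def)
  then show ?thesis unfolding attainable_def using plan_const[OF assms] by (intro hull_inc) (auto intro!: exI)
qed

text \<open>A finite convex combination of plans is realised by drawing the index of the plan
  independently of the starting point; on this product space the randomised map and density fit
  \<open>primal_bound\<close>.\<close>

lemma attainable_le_predictor: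
  assumes y: "(x, q, v, e) \<in> attainable D" and m: "0 \<le> m" "recession f = \<infinity> \<and> m = 0 \<or> recession f = ereal \<rho>"
    and mass: "q + m = 1" and div: "v + \<rho> * m \<le> r" and cost: "e \<le> \<epsilon>"
  shows "ereal (x + L * m) \<le> predictor S f d \<epsilon> r loss x0 P'"
proof -
  obtain k u z where kuz: "\<forall>i\<in>{1::nat..k}. 0 \<le> u i \<and> z i \<in> {plan_values T h | T h. plan D T h}"
    "sum u {1..k} = 1" "(\<Sum>i = 1..k. u i *\<^sub>R z i) = (x, q, v, e)"
    using y unfolding attainable_def convex_hull_indexed by blast
  define I where "I = {1..k}"
  have u_sum: "sum u I = 1" using kuz(2) by (simp only: I_def)
  have I: "finite I" "I \<noteq> {}"
  proof -
    show "finite I" by (simp add: I_def)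
    show "I \<noteq> {}" using u_sum by (metis sum.empty zero_neq_one)
  qed
  have "\<forall>i\<in>I. \<exists>T h. z i = plan_values T h \<and> plan D T h" using kuz(1) unfolding I_def by blast
  then obtain T h where Th: "\<And>i. i \<in> I \<Longrightarrow> z i = plan_values (T i) (h i)" "\<And>i. i \<in> I \<Longrightarrow> plan D (T i) (h i)" by metis
  have T_meas [measurable]: "T i \<in> M \<rightarrow>\<^sub>M M" and h_meas [measurable]: "h i \<in> borel_measurable M" if "i \<in> I" for i
    using Th(2)[OF that] by (auto simp: plan_def)
  have "\<forall>i\<in>I. \<exists>c H n. 0 < c \<and> (\<forall>\<xi>. c \<le> h i \<xi> \<and> h i \<xi> \<le> H) \<and> (\<forall>\<xi>\<in>S. d \<xi> (T i \<xi>) \<le> n)"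
    using Th(2) unfolding plan_def by blast
  then obtain c H n where cHn: "\<And>i. i \<in> I \<Longrightarrow> 0 < c i" "\<And>i \<xi>. i \<in> I \<Longrightarrow> c i \<le> h i \<xi>" "\<And>i \<xi>. i \<in> I \<Longrightarrow> h i \<xi> \<le> H i"
    "\<And>i \<xi>. i \<in> I \<Longrightarrow> \<xi> \<in> S \<Longrightarrow> d \<xi> (T i \<xi>) \<le> n i"
    by metis
  define c0 where "c0 = Min (c ` I)"
  define H0 where "H0 = Max (H ` I)"
  define n0 where "n0 = Max (n ` I)"
  have c0: "0 < c0" unfolding c0_def using I cHn(1) by (subst Min_gr_iff) auto
  have c0_le: "c0 \<le> h i \<xi>" if "i \<in> I" for i \<xi>
    unfolding c0_def using I that by (intro order_trans[OF Min_le cHn(2)]) auto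
  have H0_ge: "h i \<xi> \<le> H0" if "i \<in> I" for i \<xi>
    unfolding H0_def using I that by (intro order_trans[OF cHn(3) Max_ge]) auto
  have n0_ge: "d \<xi> (T i \<xi>) \<le> n0" if "i \<in> I" "\<xi> \<in> S" for i \<xi>
    unfolding n0_def using I that by (intro order_trans[OF cHn(4) Max_ge]) auto
  have TS: "T i \<xi> \<in> S" if "i \<in> I" "\<xi> \<in> S" for i \<xi>
    using measurable_space[OF T_meas[OF that(1)], of \<xi>] that(2) by simp
  obtain BF where BF: "\<And>t. c0 \<le> t \<Longrightarrow> t \<le> H0 \<Longrightarrow> \<bar>F t\<bar> \<le> BF" using F_bounded[OF c0, of H0] by blast
  define J where "J = point_measure I (\<lambda>i. ennreal (u i))"
  have u: "0 \<le> u i" if "i \<in> I" for i using kuz(1) that by (auto simp: I_def)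
  have "prob_space J" unfolding J_def
  proof (rule prob_space_point_measure[OF I(1)])
    show "(\<Sum>i\<in>I. ennreal (u i)) = 1" using sum_ennreal[of I u] u u_sum by simp
  qed simp
  then interpret J: prob_space J .
  have sets_J [measurable_cong]: "sets J = sets (count_space I)" by (simp add: J_def sets_point_measure)
  have space_J: "space J = I" by (simp add: J_def space_point_measure)
  interpret PJ: pair_prob_space P' J ..
  define \<Omega> where "\<Omega> = P' \<Otimes>\<^sub>M J"
  have space_\<Omega>: "space \<Omega> = S \<times> I" by (simp add: \<Omega>_def space_pair_measure space_J)
  have meas: "\<phi> \<in> \<Omega> \<rightarrow>\<^sub>M K" if \<phi>: "\<And>i. i \<in> I \<Longrightarrow> (\<lambda>\<xi>. \<phi> (\<xi>, i)) \<in> M \<rightarrow>\<^sub>M K" for \<phi> :: "'a \<times> nat \<Rightarrow> 'k" and K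
  proof -
    have "(\<lambda>p. (\<lambda>i p. \<phi> (fst p, i)) (snd p) p) \<in> \<Omega> \<rightarrow>\<^sub>M K"
    proof (rule measurable_compose_countable'[where I = I])
      show "(\<lambda>p. \<phi> (fst p, i)) \<in> \<Omega> \<rightarrow>\<^sub>M K" if "i \<in> I" for i
        using measurable_compose[OF _ \<phi>[OF that], of fst \<Omega>] unfolding \<Omega>_def by measurable
      show "snd \<in> \<Omega> \<rightarrow>\<^sub>M count_space I" unfolding \<Omega>_def by measurable
    qed (use I in \<open>simp add: countable_finite\<close>)
    then show ?thesis by simp
  qed
  have int: "integrable \<Omega> \<phi> \<and> (\<integral>p. \<phi> p \<partial>\<Omega>) = (\<Sum>i\<in>I. u i * (\<integral>\<xi>. \<phi> (\<xi>, i) \<partial>P'))"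
    if \<phi>: "\<And>i. i \<in> I \<Longrightarrow> (\<lambda>\<xi>. \<phi> (\<xi>, i)) \<in> borel_measurable M"
      "\<And>i \<xi>. i \<in> I \<Longrightarrow> \<xi> \<in> S \<Longrightarrow> \<bar>\<phi> (\<xi>, i)\<bar> \<le> B" for \<phi> :: "'a \<times> nat \<Rightarrow> real" and B
  proof -
    have i: "integrable \<Omega> \<phi>"
      unfolding \<Omega>_def
    proof (rule PJ.integrable_const_bound[of _ B])
      show "AE p in P' \<Otimes>\<^sub>M J. norm (\<phi> p) \<le> B"
        using \<phi>(2) space_\<Omega> by (intro AE_I2) (auto simp: \<Omega>_def)
      show "\<phi> \<in> borel_measurable (P' \<Otimes>\<^sub>M J)" using meas[OF \<phi>(1)] by (simp add: \<Omega>_def)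
    qed
    have "(\<integral>p. \<phi> p \<partial>\<Omega>) = (\<integral>\<xi>. (\<integral>i. \<phi> (\<xi>, i) \<partial>J) \<partial>P')"
      using PJ.integral_fst'[of \<phi>] i by (simp add: \<Omega>_def)
    also have "\<dots> = (\<integral>\<xi>. (\<Sum>i\<in>I. u i * \<phi> (\<xi>, i)) \<partial>P')"
      unfolding J_def using I u by (simp add: lebesgue_integral_point_measure_finite)
    also have "\<dots> = (\<Sum>i\<in>I. (\<integral>\<xi>. u i * \<phi> (\<xi>, i) \<partial>P'))"
    proof (rule Bochner_Integration.integral_sum)
      fix j assume j: "j \<in> I"
      have "integrable P' (\<lambda>\<xi>. \<phi> (\<xi>, j))"
        using \<phi>(2)[OF j] \<phi>(1)[OF j]
        by (intro P'.integrable_const_bound[of _ B] AE_I2) (auto simp: measurable_cong_sets[OF sets_P' refl])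
      then show "integrable P' (\<lambda>\<xi>. u j * \<phi> (\<xi>, j))" by simp
    qed
    finally show ?thesis using i by simp
  qed
  define T' where "T' p = T (snd p) (fst p)" for p
  \<comment> \<open>\<open>primal_bound\<close> asks for the bounds at every point, including
    indices outside \<open>I\<close>; the default \<open>c0\<close> meets them there.\<close>
  define h' where "h' p = (if snd p \<in> I then h (snd p) (fst p) else c0)" for p
  have c0_H0: "c0 \<le> H0" using I c0_le H0_ge by (metis all_not_in_conv order_trans)
  have h': "c0 \<le> h' p" "h' p \<le> H0" for p using c0_le H0_ge c0_H0 by (auto simp: h'_def)
  have F_meas: "(\<lambda>\<xi>. F (h i \<xi>)) \<in> borel_measurable M" if "i \<in> I" for i
    using c0_le[OF that] c0 h_meas[OF that] by (intro F_measurable) (auto intro: order_trans[OF less_imp_le])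
  have int_hl: "(\<integral>p. h' p * l (T' p) \<partial>\<Omega>) = (\<Sum>i\<in>I. u i * (\<integral>\<xi>. h i \<xi> * l (T i \<xi>) \<partial>P'))"
    and int_h: "(\<integral>p. h' p \<partial>\<Omega>) = (\<Sum>i\<in>I. u i * (\<integral>\<xi>. h i \<xi> \<partial>P'))"
    and int_F: "(\<integral>p. F (h' p) \<partial>\<Omega>) = (\<Sum>i\<in>I. u i * (\<integral>\<xi>. F (h i \<xi>) \<partial>P'))"
    and int_d: "integrable \<Omega> (\<lambda>p. d (fst p) (T' p)) \<and> (\<integral>p. d (fst p) (T' p) \<partial>\<Omega>) = (\<Sum>i\<in>I. u i * (\<integral>\<xi>. d \<xi> (T i \<xi>) \<partial>P'))"
  proof -
    have hl: "\<bar>h i \<xi> * l (T i \<xi>)\<bar> \<le> H0 * L" if "i \<in> I" "\<xi> \<in> S" for i \<xi>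
      unfolding abs_mult using c0 c0_le[OF that(1), of \<xi>] H0_ge[OF that(1), of \<xi>]
        loss_nonneg[OF TS[OF that]] loss_le[OF TS[OF that]] by (intro mult_mono) auto
    show "(\<integral>p. h' p * l (T' p) \<partial>\<Omega>) = (\<Sum>i\<in>I. u i * (\<integral>\<xi>. h i \<xi> * l (T i \<xi>) \<partial>P'))"
      using int[of "\<lambda>p. h' p * l (T' p)" "H0 * L"] hl h_meas T_meas by (simp add: h'_def T'_def)
    show "(\<integral>p. h' p \<partial>\<Omega>) = (\<Sum>i\<in>I. u i * (\<integral>\<xi>. h i \<xi> \<partial>P'))"
      using int[of h' H0] c0 c0_le H0_ge h_meas by (simp add: h'_def abs_le_iff) (smt (verit) c0_le)
    show "(\<integral>p. F (h' p) \<partial>\<Omega>) = (\<Sum>i\<in>I. u i * (\<integral>\<xi>. F (h i \<xi>) \<partial>P'))"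
      using int[of "\<lambda>p. F (h' p)" BF] BF c0_le H0_ge F_meas by (simp add: h'_def)
    show "integrable \<Omega> (\<lambda>p. d (fst p) (T' p)) \<and> (\<integral>p. d (fst p) (T' p) \<partial>\<Omega>) = (\<Sum>i\<in>I. u i * (\<integral>\<xi>. d \<xi> (T i \<xi>) \<partial>P'))"
      using int[of "\<lambda>p. d (fst p) (T' p)" n0] n0_ge d_nonneg TS T_meas by (simp add: T'_def)
  qed
  have sums: "(\<Sum>i\<in>I. u i * (\<integral>\<xi>. h i \<xi> * l (T i \<xi>) \<partial>P')) = x" "(\<Sum>i\<in>I. u i * (\<integral>\<xi>. h i \<xi> \<partial>P')) = q"
    "(\<Sum>i\<in>I. u i * (\<integral>\<xi>. F (h i \<xi>) \<partial>P')) = v" "(\<Sum>i\<in>I. u i * (\<integral>\<xi>. d \<xi> (T i \<xi>) \<partial>P')) = e"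
  proof -
    have "(\<Sum>i\<in>I. u i *\<^sub>R plan_values (T i) (h i)) = (x, q, v, e)"
      using kuz(3) Th(1) unfolding I_def by simp
    then show "(\<Sum>i\<in>I. u i * (\<integral>\<xi>. h i \<xi> * l (T i \<xi>) \<partial>P')) = x" "(\<Sum>i\<in>I. u i * (\<integral>\<xi>. h i \<xi> \<partial>P')) = q"
    "(\<Sum>i\<in>I. u i * (\<integral>\<xi>. F (h i \<xi>) \<partial>P')) = v" "(\<Sum>i\<in>I. u i * (\<integral>\<xi>. d \<xi> (T i \<xi>) \<partial>P')) = e"
      by (simp_all add: plan_values_def prod_eq_iff fst_sum snd_sum)
  qed
  have "ereal ((\<integral>p. h' p * l (T' p) \<partial>\<Omega>) + L * m) \<le> predictor S f d \<epsilon> r loss x0 P'"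
  proof (rule primal_bound[where c = c0 and H = H0 and X = fst and \<rho> = \<rho>])
    show "prob_space \<Omega>" unfolding \<Omega>_def by unfold_locales
    show "fst \<in> \<Omega> \<rightarrow>\<^sub>M M" by (rule meas) simp
    show "T' \<in> \<Omega> \<rightarrow>\<^sub>M M" using T_meas by (intro meas) (simp add: T'_def)
    show "h' \<in> borel_measurable \<Omega>" using h_meas by (intro meas) (simp add: h'_def)
    have "distr \<Omega> M fst = distr (P' \<Otimes>\<^sub>M J) P' fst" unfolding \<Omega>_def using sets_P' by (intro distr_cong) auto
    then show "distr \<Omega> M fst = P'" using J.distr_pair_fst[of P'] by simp
  qed (use c0 h' m mass div cost int_hl int_h int_F int_d sums in simp_all)
  then show ?thesis using int_hl sums(1) by simp
qed

section \<open>Strong duality\<close>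

text \<open>The maximisers of \<open>W\<close> within radius \<open>n\<close> form a compact
  correspondence. They miss a closed set \<open>K\<close> iff some rational level is reached within
  radius \<open>n\<close> but not by points of \<open>K\<close> there, and each of the two
  conditions describes a projection of a closed set.\<close>

lemma W_selection:
  assumes t: "0 < t" and \<gamma>: "0 \<le> \<gamma>" and n: "0 \<le> n"
  obtains T where "T \<in> M \<rightarrow>\<^sub>M M" "\<And>\<xi>. \<xi> \<in> S \<Longrightarrow> d \<xi> (T \<xi>) \<le> n"
    "\<And>\<xi> \<xi>'. \<xi> \<in> S \<Longrightarrow> \<xi>' \<in> S \<Longrightarrow> d \<xi> \<xi>' \<le> n \<Longrightarrow> W \<eta> lam \<gamma> t \<xi> \<xi>' \<le> W \<eta> lam \<gamma> t \<xi> (T \<xi>)"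
proof -
  define w where "w = W \<eta> lam \<gamma> t"
  define C where "C c \<xi> = {\<xi>'\<in>S. d \<xi> \<xi>' \<le> n \<and> c \<le> w \<xi> \<xi>'}" for c \<xi>
  define A where "A \<xi> = {\<xi>'\<in>S. d \<xi> \<xi>' \<le> n \<and> (\<forall>\<xi>''\<in>S. d \<xi> \<xi>'' \<le> n \<longrightarrow> w \<xi> \<xi>'' \<le> w \<xi> \<xi>')}" for \<xi>
  have C_closed: "closed (C c \<xi>)" if "\<xi> \<in> S" for c \<xi>
  proof -
    have eq: "C c \<xi> = (\<lambda>\<xi>'. (\<xi>, \<xi>')) -` {p\<in>S \<times> S. d (fst p) (snd p) \<le> n \<and> c \<le> w (fst p) (snd p)}"
      using that by (auto simp: C_def)
    show ?thesis unfolding eq w_def by (rule closed_vimage[OF closed_W[OF t \<gamma>]]) (intro continuous_intros)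
  qed
  have C_compact: "compact (C c \<xi>)" if "\<xi> \<in> S" for c \<xi>
  proof -
    have "C c \<xi> = S \<inter> C c \<xi>" by (auto simp: C_def)
    then show ?thesis using compact_Int_closed[OF compact_S C_closed[OF that]] by metis
  qed
  \<comment> \<open>Writing the maximisers as a superlevel set at the maximal level makes them
    compact. The search starts at the level of \<open>\<xi>\<close> itself, which lies within radius
    \<open>n\<close>.\<close>
  have max: "\<exists>\<xi>'\<in>S. d \<xi> \<xi>' \<le> n \<and> A \<xi> = C (w \<xi> \<xi>') \<xi> \<and> \<xi>' \<in> A \<xi>" if \<xi>: "\<xi> \<in> S" for \<xi>
  proof -
    have in_C: "\<xi> \<in> C (w \<xi> \<xi>) \<xi>" using \<xi> n by (simp add: C_def d_refl)
    have "{\<xi>'\<in>C (w \<xi> \<xi>) \<xi>. c \<le> w \<xi> \<xi>'} = C (w \<xi> \<xi>) \<xi> \<inter> C c \<xi>" for c by (auto simp: C_def)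
    then have "closed {\<xi>'\<in>C (w \<xi> \<xi>) \<xi>. c \<le> w \<xi> \<xi>'}" for c using C_closed[OF \<xi>] by (simp add: closed_Int)
    then obtain \<xi>' where \<xi>': "\<xi>' \<in> C (w \<xi> \<xi>) \<xi>" "\<forall>y\<in>C (w \<xi> \<xi>) \<xi>. w \<xi> y \<le> w \<xi> \<xi>'"
      using attains_max[OF C_compact[OF \<xi>], of "w \<xi> \<xi>" "w \<xi>"] in_C by blast
    have ge: "w \<xi> \<xi> \<le> w \<xi> \<xi>'" using \<xi>'(1) by (simp add: C_def)
    have le: "w \<xi> y \<le> w \<xi> \<xi>'" if "y \<in> S" "d \<xi> y \<le> n" for y
      using \<xi>'(2) that ge by (cases "w \<xi> \<xi> \<le> w \<xi> y") (auto simp: C_def)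
    have \<xi>'2: "\<xi>' \<in> S" "d \<xi> \<xi>' \<le> n" using \<xi>'(1) by (auto simp: C_def)
    have "A \<xi> = C (w \<xi> \<xi>') \<xi>"
    proof (intro equalityI subsetI)
      fix y assume "y \<in> A \<xi>"
      then show "y \<in> C (w \<xi> \<xi>') \<xi>" using \<xi>'2 unfolding A_def C_def by blast
    next
      fix y assume y: "y \<in> C (w \<xi> \<xi>') \<xi>"
      then have "w \<xi> z \<le> w \<xi> y" if "z \<in> S" "d \<xi> z \<le> n" for z
        using le[OF that] by (simp add: C_def)
      then show "y \<in> A \<xi>" using y unfolding A_def C_def by blast
    qed
    moreover have "\<xi>' \<in> A \<xi>" using \<xi>'2 le unfolding A_def by blast
    ultimately show ?thesis using \<xi>'2 by blast
  qed
  have "compact_correspondence M A"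
    unfolding compact_correspondence_def
  proof (intro conjI ballI allI impI)
    fix \<xi> assume "\<xi> \<in> space M"
    then have \<xi>: "\<xi> \<in> S" by simp
    show "A \<xi> \<noteq> {}" using max[OF \<xi>] by blast
    show "compact (A \<xi>)" using max[OF \<xi>] C_compact[OF \<xi>] by metis
  next
    fix K :: "'a set" assume K: "closed K"
    define E where "E K q = {\<xi>\<in>S. \<exists>\<xi>'\<in>S \<inter> K. d \<xi> \<xi>' \<le> n \<and> q \<le> w \<xi> \<xi>'}" for K q
    have iff: "A \<xi> \<inter> K = {} \<longleftrightarrow> (\<exists>q\<in>\<rat>. \<xi> \<in> E UNIV q \<and> \<xi> \<notin> E K q)" if \<xi>: "\<xi> \<in> S" for \<xi>
    proof -
      obtain \<xi>m where \<xi>m: "\<xi>m \<in> S" "d \<xi> \<xi>m \<le> n" "A \<xi> = C (w \<xi> \<xi>m) \<xi>" "\<xi>m \<in> A \<xi>" using max[OF \<xi>] by blast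
      show ?thesis
      proof
        assume empty: "A \<xi> \<inter> K = {}"
        show "\<exists>q\<in>\<rat>. \<xi> \<in> E UNIV q \<and> \<xi> \<notin> E K q"
        \<comment> \<open>Any level below the maximum would serve in place of
          \<open>w \<xi> \<xi>m - 1\<close>: it cuts out a compact set on which the best value over
          \<open>K\<close> is attained, unless \<open>K\<close> is missed there.\<close>
        proof (cases "C (w \<xi> \<xi>m - 1) \<xi> \<inter> K = {}")
          case True
          obtain q where q: "q \<in> \<rat>" "w \<xi> \<xi>m - 1 < q" "q < w \<xi> \<xi>m"
            using Rats_dense_in_real[of "w \<xi> \<xi>m - 1" "w \<xi> \<xi>m"] by auto
          have "\<xi> \<in> E UNIV q" unfolding E_def using \<xi> \<xi>m q(3) by (auto intro!: bexI[of _ \<xi>m])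
          moreover have "\<xi> \<notin> E K q"
          proof
            assume "\<xi> \<in> E K q"
            then obtain y where "y \<in> S" "y \<in> K" "d \<xi> y \<le> n" "q \<le> w \<xi> y" by (auto simp: E_def)
            then have "y \<in> C (w \<xi> \<xi>m - 1) \<xi> \<inter> K" using q(2) by (simp add: C_def)
            then show False using True by blast
          qed
          ultimately show ?thesis using q(1) by blast
        next
          case False
          have "{\<xi>'\<in>C (w \<xi> \<xi>m - 1) \<xi> \<inter> K. c \<le> w \<xi> \<xi>'} = C (w \<xi> \<xi>m - 1) \<xi> \<inter> C c \<xi> \<inter> K" for c by (auto simp: C_def)
          then have "closed {\<xi>'\<in>C (w \<xi> \<xi>m - 1) \<xi> \<inter> K. c \<le> w \<xi> \<xi>'}" for c
            using C_closed[OF \<xi>] K by (simp add: closed_Int)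
          then obtain y where y: "y \<in> C (w \<xi> \<xi>m - 1) \<xi> \<inter> K" "\<forall>z\<in>C (w \<xi> \<xi>m - 1) \<xi> \<inter> K. w \<xi> z \<le> w \<xi> y"
            using attains_max[OF compact_Int_closed[OF C_compact[OF \<xi>] K] False, of "w \<xi>"] by blast
          have y2: "w \<xi> \<xi>m - 1 \<le> w \<xi> y" "y \<in> S" "d \<xi> y \<le> n" "y \<in> K" using y(1) by (auto simp: C_def)
          have "w \<xi> y < w \<xi> \<xi>m"
          proof (rule ccontr)
            assume "\<not> w \<xi> y < w \<xi> \<xi>m"
            then have "y \<in> A \<xi>" unfolding \<xi>m(3) using y2 by (simp add: C_def)
            then show False using empty y2(4) by blast
          qed
          then obtain q where q: "q \<in> \<rat>" "w \<xi> y < q" "q < w \<xi> \<xi>m" using Rats_dense_in_real by blast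
          have "\<xi> \<in> E UNIV q" unfolding E_def using \<xi> \<xi>m q(3) by (auto intro!: bexI[of _ \<xi>m])
          moreover have "\<xi> \<notin> E K q"
          proof
            assume "\<xi> \<in> E K q"
            then obtain z where z: "z \<in> S" "z \<in> K" "d \<xi> z \<le> n" "q \<le> w \<xi> z" by (auto simp: E_def)
            then have "z \<in> C (w \<xi> \<xi>m - 1) \<xi> \<inter> K" using q y2(1) by (simp add: C_def)
            then have "w \<xi> z \<le> w \<xi> y" using y(2) by blast
            then show False using q z by simp
          qed
          ultimately show ?thesis using q(1) by blast
        qed
      next
        assume "\<exists>q\<in>\<rat>. \<xi> \<in> E UNIV q \<and> \<xi> \<notin> E K q"
        then obtain q y where q: "y \<in> S" "d \<xi> y \<le> n" "q \<le> w \<xi> y" "\<xi> \<notin> E K q" by (auto simp: E_def)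
        have "z \<notin> K" if "z \<in> A \<xi>" for z
        proof
          assume "z \<in> K"
          have z: "z \<in> S" "d \<xi> z \<le> n" "w \<xi> y \<le> w \<xi> z" using that q(1,2) unfolding A_def by blast+
          then have "q \<le> w \<xi> z" using q(3) by simp
          then have "\<xi> \<in> E K q" unfolding E_def using \<xi> z \<open>z \<in> K\<close> by blast
          then show False using q(4) by blast
        qed
        then show "A \<xi> \<inter> K = {}" by blast
      qed
    qed
    have "{\<xi>\<in>space M. A \<xi> \<inter> K = {}} = {\<xi>\<in>S. \<exists>q\<in>\<rat>. \<xi> \<in> E UNIV q \<and> \<xi> \<notin> E K q}"
      unfolding space_M by (intro Collect_cong conj_cong refl iff)
    also have "\<dots> = (\<Union>q\<in>\<rat>. E UNIV q - E K q)" by (auto simp: E_def)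
    also have "\<dots> \<in> sets M"
      unfolding E_def w_def
      by (intro sets.countable_UN'[OF countable_rat] image_subsetI sets.Diff W_projection t \<gamma> K closed_UNIV)
    finally show "{\<xi>\<in>space M. A \<xi> \<inter> K = {}} \<in> sets M" .
  qed
  then obtain T where T: "T \<in> borel_measurable M" "\<And>\<xi>. \<xi> \<in> space M \<Longrightarrow> T \<xi> \<in> A \<xi>"
    by (rule compact_correspondence_selection) blast
  show ?thesis
  proof (rule that[of T])
    have "T \<in> space M \<rightarrow> S" using T(2) by (auto simp: A_def)
    then show "T \<in> M \<rightarrow>\<^sub>M M" using T(1) measurable_restrict_space2[of T M S borel] by (simp add: M_def)
  qed (use T(2) in \<open>auto simp: A_def w_def\<close>)
qed

lemma plan_W:
  assumes "plan D T h"
  shows "integrable P' (\<lambda>\<xi>. W \<eta> lam \<gamma> (h \<xi>) \<xi> (T \<xi>))"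
    "(\<integral>\<xi>. W \<eta> lam \<gamma> (h \<xi>) \<xi> (T \<xi>) \<partial>P') =
      (\<integral>\<xi>. h \<xi> * l (T \<xi>) \<partial>P') - \<eta> * (\<integral>\<xi>. h \<xi> \<partial>P') - lam * (\<integral>\<xi>. F (h \<xi>) \<partial>P') - \<gamma> * (\<integral>\<xi>. d \<xi> (T \<xi>) \<partial>P')"
proof -
  have eq: "W \<eta> lam \<gamma> (h \<xi>) \<xi> (T \<xi>) = h \<xi> * l (T \<xi>) - \<eta> * h \<xi> - lam * F (h \<xi>) - \<gamma> * d \<xi> (T \<xi>)" for \<xi>
    by (simp add: W_def algebra_simps)
  note plan_integrable[OF assms, simp]
  show "integrable P' (\<lambda>\<xi>. W \<eta> lam \<gamma> (h \<xi>) \<xi> (T \<xi>))" unfolding eq by simp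
  show "(\<integral>\<xi>. W \<eta> lam \<gamma> (h \<xi>) \<xi> (T \<xi>) \<partial>P') =
      (\<integral>\<xi>. h \<xi> * l (T \<xi>) \<partial>P') - \<eta> * (\<integral>\<xi>. h \<xi> \<partial>P') - lam * (\<integral>\<xi>. F (h \<xi>) \<partial>P') - \<gamma> * (\<integral>\<xi>. d \<xi> (T \<xi>) \<partial>P')"
    unfolding eq by simp
qed

text \<open>The bounds combine by minimum and maximum, and \<open>D\<close> contains the larger of
  two of its radii. Uniform bounds survive finitely many gluings, which is what running maxima
  need.\<close>

lemma plan_If:
  assumes "plan D T1 h1" "plan D T2 h2" and B: "{\<xi>\<in>S. B \<xi>} \<in> sets M"
  shows "plan D (\<lambda>\<xi>. if B \<xi> then T1 \<xi> else T2 \<xi>) (\<lambda>\<xi>. if B \<xi> then h1 \<xi> else h2 \<xi>)"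
proof -
  obtain c1 H1 n1 where 1: "T1 \<in> M \<rightarrow>\<^sub>M M" "h1 \<in> borel_measurable M" "0 < c1" "\<And>\<xi>. c1 \<le> h1 \<xi>" "\<And>\<xi>. h1 \<xi> \<le> H1"
    "n1 \<in> D" "\<And>\<xi>. \<xi> \<in> S \<Longrightarrow> d \<xi> (T1 \<xi>) \<le> n1" using assms(1) unfolding plan_def by blast
  obtain c2 H2 n2 where 2: "T2 \<in> M \<rightarrow>\<^sub>M M" "h2 \<in> borel_measurable M" "0 < c2" "\<And>\<xi>. c2 \<le> h2 \<xi>" "\<And>\<xi>. h2 \<xi> \<le> H2"
    "n2 \<in> D" "\<And>\<xi>. \<xi> \<in> S \<Longrightarrow> d \<xi> (T2 \<xi>) \<le> n2" using assms(2) unfolding plan_def by blast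
  show ?thesis
    unfolding plan_def
  proof (intro conjI)
    show "(\<lambda>\<xi>. if B \<xi> then T1 \<xi> else T2 \<xi>) \<in> M \<rightarrow>\<^sub>M M" "(\<lambda>\<xi>. if B \<xi> then h1 \<xi> else h2 \<xi>) \<in> borel_measurable M"
      using B 1 2 by (auto intro!: measurable_If)
    show "\<exists>c>0. \<exists>H. \<forall>\<xi>. c \<le> (if B \<xi> then h1 \<xi> else h2 \<xi>) \<and> (if B \<xi> then h1 \<xi> else h2 \<xi>) \<le> H"
      using 1 2 by (intro exI[of _ "min c1 c2"] exI[of _ "max H1 H2"] conjI allI)
        (auto intro: min.coboundedI1 min.coboundedI2 max.coboundedI1 max.coboundedI2)
    show "\<exists>n\<in>D. \<forall>\<xi>\<in>S. d \<xi> (if B \<xi> then T1 \<xi> else T2 \<xi>) \<le> n"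
    proof (rule bexI[of _ "max n1 n2"])
      show "max n1 n2 \<in> D" using 1(6) 2(6) by (simp add: max_def)
      show "\<forall>\<xi>\<in>S. d \<xi> (if B \<xi> then T1 \<xi> else T2 \<xi>) \<le> max n1 n2"
        using 1(7) 2(7) by (auto intro: max.coboundedI1 max.coboundedI2)
    qed
  qed
qed

lemma ereal_integral_g_le:
  assumes D: "countable D" "0 \<in> D" "D \<subseteq> {0..}" and \<gamma>: "0 \<le> \<gamma>"
    and le: "\<And>T h. plan D T h \<Longrightarrow> (\<integral>\<xi>. W \<eta> lam \<gamma> (h \<xi>) \<xi> (T \<xi>) \<partial>P') \<le> B"
  shows "ereal_integral P' (g D \<eta> lam \<gamma>) \<le> ereal B"
proof -
  \<comment> \<open>Densities and radii are enumerated together; one selected maximiser per pair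
    suffices for the supremum defining \<open>g\<close>.\<close>
  define A where "A = (\<rat> \<inter> {0::real<..}) \<times> D"
  have A: "countable A" "A \<noteq> {}"
  proof -
    show "countable A" unfolding A_def using D(1) countable_rat by (intro countable_SIGMA countable_Int1)
    have "(1, 0) \<in> A" using D(2) by (simp add: A_def)
    then show "A \<noteq> {}" by blast
  qed
  define t where "t j = fst (from_nat_into A j)" for j
  define n where "n j = snd (from_nat_into A j)" for j
  have tn: "0 < t j" "t j \<in> \<rat>" "n j \<in> D" "0 \<le> n j" for j
    using from_nat_into[OF A(2), of j] D(3) by (auto simp: A_def t_def n_def mem_Times_iff)
  have onto: "\<exists>j. t j = s \<and> n j = k" if "s \<in> \<rat>" "0 < s" "k \<in> D" for s k
  proof -
    have "(s, k) \<in> A" using that by (simp add: A_def)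
    then obtain j where "from_nat_into A j = (s, k)" using from_nat_into_surj[OF A(1)] by blast
    then show ?thesis unfolding t_def n_def by (intro exI[of _ j]) simp
  qed
  have "\<exists>T. T \<in> M \<rightarrow>\<^sub>M M \<and> (\<forall>\<xi>\<in>S. d \<xi> (T \<xi>) \<le> n j) \<and>
    (\<forall>\<xi>\<in>S. \<forall>\<xi>'\<in>S. d \<xi> \<xi>' \<le> n j \<longrightarrow> W \<eta> lam \<gamma> (t j) \<xi> \<xi>' \<le> W \<eta> lam \<gamma> (t j) \<xi> (T \<xi>))" for j
    using W_selection[OF tn(1)[of j] \<gamma> tn(4)[of j], where \<eta> = \<eta> and lam = lam] by metis
  then obtain T where T: "\<And>j. T j \<in> M \<rightarrow>\<^sub>M M" "\<And>j \<xi>. \<xi> \<in> S \<Longrightarrow> d \<xi> (T j \<xi>) \<le> n j"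
    "\<And>j \<xi> \<xi>'. \<xi> \<in> S \<Longrightarrow> \<xi>' \<in> S \<Longrightarrow> d \<xi> \<xi>' \<le> n j \<Longrightarrow> W \<eta> lam \<gamma> (t j) \<xi> \<xi>' \<le> W \<eta> lam \<gamma> (t j) \<xi> (T j \<xi>)"
    by metis
  define w where "w j \<xi> = W \<eta> lam \<gamma> (t j) \<xi> (T j \<xi>)" for j \<xi>
  have plan_j: "plan D (T j) (\<lambda>_. t j)" for j
    unfolding plan_def
  proof (intro conjI)
    show "\<exists>c>0. \<exists>H. \<forall>\<xi>::'a. c \<le> t j \<and> t j \<le> H" using tn(1)[of j] by (intro exI[of _ "t j"]) auto
    show "\<exists>n\<in>D. \<forall>\<xi>\<in>S. d \<xi> (T j \<xi>) \<le> n" using T(2) tn(3) by (intro bexI[of _ "n j"]) auto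
  qed (simp_all add: T(1))
  have w_meas: "w j \<in> borel_measurable M" for j
    using borel_measurable_integrable[OF plan_W(1)[OF plan_j[of j], of \<eta> lam \<gamma>]]
    by (simp add: w_def[abs_def] measurable_cong_sets[OF sets_P' refl])
  define G where "G N \<xi> = Max ((\<lambda>j. w j \<xi>) ` {..N})" for N \<xi>
  have G_Suc: "G (Suc N) \<xi> = max (w (Suc N) \<xi>) (G N \<xi>)" for N \<xi>
    unfolding G_def by (simp add: atMost_Suc)
  \<comment> \<open>At each point the plan follows the best of the first selections, so the running
    maximum \<open>G N\<close> is itself the Lagrangian of one plan and inherits the bound
    \<open>B\<close>.\<close>
  have ex: "\<exists>T' h'. plan D T' h' \<and> (\<forall>\<xi>. W \<eta> lam \<gamma> (h' \<xi>) \<xi> (T' \<xi>) = G N \<xi>)" for N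
  proof (induction N)
    case 0
    show ?case using plan_j[of 0] by (intro exI[of _ "T 0"] exI[of _ "\<lambda>_. t 0"]) (simp add: G_def w_def)
  next
    case (Suc N)
    then obtain T' h' where p: "plan D T' h'" and eq: "\<And>\<xi>. W \<eta> lam \<gamma> (h' \<xi>) \<xi> (T' \<xi>) = G N \<xi>" by blast
    have [measurable]: "G N \<in> borel_measurable M"
      using borel_measurable_integrable[OF plan_W(1)[OF p, of \<eta> lam \<gamma>]]
      by (simp add: eq measurable_cong_sets[OF sets_P' refl])
    note w_meas[measurable]
    have "{\<xi>\<in>space M. G N \<xi> < w (Suc N) \<xi>} \<in> sets M" by measurable
    then have m: "{\<xi>\<in>S. G N \<xi> < w (Suc N) \<xi>} \<in> sets M" by simp
    show ?case
      by (rule exI, rule exI, rule conjI[OF plan_If[OF plan_j[of "Suc N"] p m]])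
         (simp add: G_Suc eq w_def[symmetric] max_def)
  qed
  show ?thesis
  proof (rule ereal_integral_SUP_le[where G = G])
    fix N
    obtain T' h' where p: "plan D T' h'" and eq: "\<And>\<xi>. W \<eta> lam \<gamma> (h' \<xi>) \<xi> (T' \<xi>) = G N \<xi>" using ex by blast
    show "integrable P' (G N)" using plan_W(1)[OF p, of \<eta> lam \<gamma>] by (simp add: eq)
    show "(\<integral>\<xi>. G N \<xi> \<partial>P') \<le> B" using le[OF p] by (simp add: eq)
  next
    show "mono (\<lambda>N. G N \<xi>)" for \<xi> by (intro incseq_SucI) (simp add: G_Suc)
  next
    fix \<xi> assume "\<xi> \<in> space P'"
    then have \<xi>: "\<xi> \<in> S" by simp
    have TS: "T j \<xi> \<in> S" for j using measurable_space[OF T(1), of \<xi> j] \<xi> by simp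
    show "g D \<eta> lam \<gamma> \<xi> = (SUP N. ereal (G N \<xi>))"
    proof (rule antisym)
      show "g D \<eta> lam \<gamma> \<xi> \<le> (SUP N. ereal (G N \<xi>))"
      proof (rule g_least)
        fix s k :: real and \<xi>' assume s: "s \<in> \<rat>" "0 < s" "\<xi>' \<in> S" "k \<in> D" "d \<xi> \<xi>' \<le> k"
        obtain j where j: "t j = s" "n j = k" using onto s by blast
        have "W \<eta> lam \<gamma> s \<xi> \<xi>' \<le> w j \<xi>" using T(3)[of \<xi> \<xi>' j] \<xi> s j by (simp add: w_def)
        also have "w j \<xi> \<le> G j \<xi>" unfolding G_def by (intro Max_ge) auto
        finally show "ereal (W \<eta> lam \<gamma> s \<xi> \<xi>') \<le> (SUP N. ereal (G N \<xi>))"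
          by (intro SUP_upper2[of j]) auto
      qed
      show "(SUP N. ereal (G N \<xi>)) \<le> g D \<eta> lam \<gamma> \<xi>"
      proof (rule SUP_least)
        fix N
        have "G N \<xi> \<in> (\<lambda>j. w j \<xi>) ` {..N}" unfolding G_def by (intro Max_in) auto
        then obtain j where "G N \<xi> = w j \<xi>" by blast
        then show "ereal (G N \<xi>) \<le> g D \<eta> lam \<gamma> \<xi>"
          using g_upper[OF tn(2)[of j] tn(1)[of j] TS[of j] tn(3)[of j] T(2)[OF \<xi>, of j]] by (simp add: w_def)
      qed
    qed
  qed
qed

text \<open>\<open>D\<close>, \<open>V\<close> and the budget \<open>e\<close> are left free, so
  that a vanishing transport budget can be treated with \<open>D = {0}\<close> and a positive
  \<open>e\<close>.\<close>

lemma strong_duality_core: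
  assumes D: "countable D" "0 \<in> D" "D \<subseteq> {0..}" and r: "0 < r" and e: "0 < e"
    and \<rho>: "recession f = \<infinity> \<or> recession f = ereal \<rho>"
    and bound: "\<And>x q v c m. (x, q, v, c) \<in> attainable D \<Longrightarrow> 0 \<le> m \<Longrightarrow> (recession f = \<infinity> \<longrightarrow> m = 0) \<Longrightarrow>
      q + m = 1 \<Longrightarrow> v + \<rho> * m \<le> r \<Longrightarrow> c \<le> e \<Longrightarrow> x + L * m \<le> V"
  obtains \<eta> lam \<gamma> where "0 \<le> lam" "0 \<le> \<gamma>" "recession f = \<infinity> \<or> ereal (L - \<eta>) \<le> recession f * ereal lam"
    "ereal_integral P' (g D \<eta> lam \<gamma>) \<le> ereal (V - (r * lam + \<eta> + e * \<gamma>))"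
proof -
  have conv: "convex (attainable D)" by (simp add: attainable_def)
  obtain \<eta> lam \<gamma> where 1: "0 \<le> lam" "0 \<le> \<gamma>" "\<not> recession f = \<infinity> \<Longrightarrow> L - \<eta> \<le> \<rho> * lam"
    "\<And>x q v c. (x, q, v, c) \<in> attainable D \<Longrightarrow> x - \<eta> * q - lam * v - \<gamma> * c + (r * lam + \<eta> + e * \<gamma>) \<le> V"
    using lagrange_multipliers[OF conv attainable_const[OF D(2)] F_1 r e, of "recession f = \<infinity>" \<rho> L V] bound by metis
  show ?thesis
  proof (rule that[OF 1(1,2)])
    show "recession f = \<infinity> \<or> ereal (L - \<eta>) \<le> recession f * ereal lam" using \<rho> 1(3) by auto
    show "ereal_integral P' (g D \<eta> lam \<gamma>) \<le> ereal (V - (r * lam + \<eta> + e * \<gamma>))"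
    proof (rule ereal_integral_g_le[OF D 1(2)])
      fix T h assume p: "plan D T h"
      have "plan_values T h \<in> attainable D" unfolding attainable_def using p by (intro hull_inc) blast
      then show "(\<integral>\<xi>. W \<eta> lam \<gamma> (h \<xi>) \<xi> (T \<xi>) \<partial>P') \<le> V - (r * lam + \<eta> + e * \<gamma>)"
        using 1(4) unfolding plan_values_def by (fastforce simp: plan_W(2)[OF p])
    qed
  qed
qed

text \<open>For an infinite recession slope \<open>\<rho>\<close> is an arbitrary number; it is then
  multiplied by the mass \<open>m = 0\<close>.\<close>

lemma recession_cases: obtains \<rho> where "recession f = \<infinity> \<or> recession f = ereal \<rho>"
  using recession_not_minf by (cases "recession f") auto

text \<open>Separation needs a real value \<open>V\<close>. The reference measure itself, with
  density 1 and no transport, gives the lower bound; the loss being at most \<open>L\<close> gives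
  the upper one.\<close>

lemma predictor_real:
  assumes "0 < r" "0 \<le> \<epsilon>"
  obtains V where "predictor S f d \<epsilon> r loss x0 P' = ereal V"
proof -
  obtain \<rho> where \<rho>: "recession f = \<infinity> \<or> recession f = ereal \<rho>" by (rule recession_cases)
  have 0: "(1 * (\<integral>\<xi>. l \<xi> \<partial>P'), 1, 0, 0) \<in> attainable {0}"
    using attainable_const[of "{0}" 1] by simp
  have "ereal ((\<integral>\<xi>. l \<xi> \<partial>P') + L * 0) \<le> predictor S f d \<epsilon> r loss x0 P'"
    using attainable_le_predictor[OF 0, of 0 \<rho> r \<epsilon>] \<rho> assms by auto
  moreover have "predictor S f d \<epsilon> r loss x0 P' \<le> ereal L"
    unfolding predictor_def
  proof (rule Sup_least)
    fix y assume "y \<in> {ereal (\<integral>\<xi>. l \<xi> \<partial>P) | P. P \<in> borel_probs S \<and> smoothed_divergence S f d \<epsilon> P' P \<le> ereal r}"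
    then obtain P where y: "y = ereal (\<integral>\<xi>. l \<xi> \<partial>P)" and P: "P \<in> borel_probs S" by blast
    interpret P: prob_space P using P by (simp add: borel_probs_iff)
    have sets: "sets P = sets M" using P by (simp add: borel_probs_iff)
    have "(\<integral>\<xi>. l \<xi> \<partial>P) \<le> (\<integral>\<xi>. L \<partial>P)"
      using loss_le sets_eq_imp_space_eq[OF sets]
      by (intro integral_mono l_integrable[OF P.finite_measure_axioms sets]) auto
    then show "y \<le> ereal L" using y P.prob_space by simp
  qed
  ultimately show ?thesis using that by (cases "predictor S f d \<epsilon> r loss x0 P'") auto
qed

lemma strong_duality_positive:
  assumes r: "0 < r" and \<epsilon>: "0 < \<epsilon>"
  obtains \<eta> lam \<gamma> where "0 \<le> lam" "0 \<le> \<gamma>" "recession f = \<infinity> \<or> ereal (L - \<eta>) \<le> recession f * ereal lam"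
    "ereal_integral P' (g (range real) \<eta> lam \<gamma>) + ereal (r * lam + \<eta> + \<epsilon> * \<gamma>) \<le> predictor S f d \<epsilon> r loss x0 P'"
proof -
  obtain \<rho> where \<rho>: "recession f = \<infinity> \<or> recession f = ereal \<rho>" by (rule recession_cases)
  obtain V where V: "predictor S f d \<epsilon> r loss x0 P' = ereal V" using predictor_real[OF r, of \<epsilon>] \<epsilon> by auto
  have D: "countable (range real)" "0 \<in> range real" "range real \<subseteq> {0..}"
    by (simp, rule range_eqI[of _ _ 0], simp, auto)
  have bound: "x + L * m \<le> V" if "(x, q, v, c) \<in> attainable (range real)" "0 \<le> m" "recession f = \<infinity> \<longrightarrow> m = 0"
    "q + m = 1" "v + \<rho> * m \<le> r" "c \<le> \<epsilon>" for x q v c m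
  proof -
    have "ereal (x + L * m) \<le> predictor S f d \<epsilon> r loss x0 P'"
      by (rule attainable_le_predictor[OF that(1,2) _ that(4-6)]) (use that(3) \<rho> in auto)
    then show ?thesis using V by simp
  qed
  obtain \<eta> lam \<gamma> where 1: "0 \<le> lam" "0 \<le> \<gamma>" "recession f = \<infinity> \<or> ereal (L - \<eta>) \<le> recession f * ereal lam"
    "ereal_integral P' (g (range real) \<eta> lam \<gamma>) \<le> ereal (V - (r * lam + \<eta> + \<epsilon> * \<gamma>))"
  proof (rule strong_duality_core[OF D r \<epsilon> \<rho>, of V])
    fix x q v c m :: real
    assume "(x, q, v, c) \<in> attainable (range real)" "0 \<le> m" "recession f = \<infinity> \<longrightarrow> m = 0"
      "q + m = 1" "v + \<rho> * m \<le> r" "c \<le> \<epsilon>"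
    then show "x + L * m \<le> V" by (rule bound)
  qed blast
  show ?thesis
    by (rule that[OF 1(1-3)]) (use 1(4) V in \<open>cases "ereal_integral P' (g (range real) \<eta> lam \<gamma>)"; auto\<close>)
qed

section \<open>The zero transport budget\<close>

text \<open>The set of points with loss at least \<open>c + \<delta>\<close> is compact and
  \<open>d \<xi>\<close> is lower semicontinuous, so its least cost from \<open>\<xi>\<close> is
  attained. That cost is positive by \<open>max\<close>, and half of it serves. As \<open>d\<close>
  need not be a metric, a small cost by itself does not mean a small distance.\<close>

lemma usc_radius:
  assumes \<xi>: "\<xi> \<in> S" and \<delta>: "0 < \<delta>"
    and max: "\<And>\<xi>'. \<xi>' \<in> S \<Longrightarrow> d \<xi> \<xi>' \<le> 0 \<Longrightarrow> l \<xi>' \<le> c"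
  obtains \<delta>1 where "0 < \<delta>1" "\<And>\<xi>'. \<xi>' \<in> S \<Longrightarrow> d \<xi> \<xi>' \<le> \<delta>1 \<Longrightarrow> l \<xi>' \<le> c + \<delta>"
proof -
  define K where "K = {\<xi>'\<in>S. c + \<delta> \<le> l \<xi>'}"
  show ?thesis
  proof (cases "K = {}")
    case True
    then have "l \<xi>' \<le> c + \<delta>" if "\<xi>' \<in> S" for \<xi>' using that unfolding K_def by (auto simp: not_le intro: less_imp_le)
    then show ?thesis by (intro that[of 1]) auto
  next
    case False
    have "K = S \<inter> K" by (auto simp: K_def)
    moreover have clK: "closed K" unfolding K_def by (rule closed_l)
    ultimately have "compact K" using compact_Int_closed[OF compact_S] by metis
    moreover have "closed {y\<in>K. a \<le> - d \<xi> y}" for a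
    proof -
      have eq: "{y\<in>K. a \<le> - d \<xi> y} = K \<inter> (\<lambda>\<xi>'. (\<xi>, \<xi>')) -` {p\<in>S \<times> S. d (fst p) (snd p) \<le> - a}"
        using \<xi> by (auto simp: K_def)
      show ?thesis unfolding eq
        by (rule closed_Int[OF clK closed_vimage[OF closed_d]]) (intro continuous_intros)
    qed
    ultimately obtain y where y: "y \<in> K" "\<forall>z\<in>K. - d \<xi> z \<le> - d \<xi> y"
      using attains_max[OF _ False, of "\<lambda>z. - d \<xi> z"] by blast
    have yS: "y \<in> S" "c + \<delta> \<le> l y" using y(1) by (auto simp: K_def)
    have pos: "0 < d \<xi> y" using max[OF yS(1)] yS(2) \<delta> by (cases "d \<xi> y \<le> 0") auto
    show ?thesis
    proof (rule that[of "d \<xi> y / 2"])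
      show "0 < d \<xi> y / 2" using pos by simp
      fix z assume z: "z \<in> S" "d \<xi> z \<le> d \<xi> y / 2"
      show "l z \<le> c + \<delta>"
      proof (rule ccontr)
        assume "\<not> l z \<le> c + \<delta>"
        then have "z \<in> K" using z by (simp add: K_def)
        then have "d \<xi> y \<le> d \<xi> z" using y(2) by simp
        then show False using z(2) pos by simp
      qed
    qed
  qed
qed

text \<open>For \<open>\<epsilon> = 0\<close> the transport constraint has no interior point. Restricting to zero-cost transport
  yields multipliers for the remaining constraints; after a perturbation making them strictly
  feasible, the integrand for \<open>\<gamma> \<longlongrightarrow> \<infinity>\<close> falls below the zero-cost one.\<close>

lemma strong_duality_zero:
  assumes r: "0 < r" and \<kappa>: "0 < \<kappa>"
  obtains \<eta> lam \<gamma> where "0 \<le> lam" "0 \<le> \<gamma>" "recession f = \<infinity> \<or> ereal (L - \<eta>) \<le> recession f * ereal lam"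
    "ereal_integral P' (g (range real) \<eta> lam \<gamma>) + ereal (r * lam + \<eta>) \<le> predictor S f d 0 r loss x0 P' + ereal \<kappa>"
proof -
  obtain \<rho> where \<rho>: "recession f = \<infinity> \<or> recession f = ereal \<rho>" by (rule recession_cases)
  obtain V where V: "predictor S f d 0 r loss x0 P' = ereal V" using predictor_real[OF r, of 0] by auto
  have cost0: "c = 0" if "(x, q, v, c) \<in> attainable {0}" for x q v c
  proof -
    have "convex {y. snd (snd (snd y)) = (0::real)}" by (intro convexI) auto
    moreover have "plan_values T h \<in> {y. snd (snd (snd y)) = 0}" if "plan {0} T h" for T h
    proof -
      have "T \<in> M \<rightarrow>\<^sub>M M" "\<And>\<xi>. \<xi> \<in> S \<Longrightarrow> d \<xi> (T \<xi>) \<le> 0" using that by (auto simp: plan_def)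
      then have "d \<xi> (T \<xi>) = 0" if "\<xi> \<in> S" for \<xi>
        using d_nonneg[OF that, of "T \<xi>"] measurable_space[of T M M \<xi>] that by force
      then have "(\<integral>\<xi>. d \<xi> (T \<xi>) \<partial>P') = (\<integral>\<xi>. 0 \<partial>P')" by (intro Bochner_Integration.integral_cong) auto
      then show ?thesis by (simp add: plan_values_def)
    qed
    ultimately have "attainable {0} \<subseteq> {y. snd (snd (snd y)) = 0}" unfolding attainable_def by (intro hull_minimal) auto
    then show ?thesis using that by auto
  qed
  \<comment> \<open>All attainable costs are 0, so the budget 1 admits nothing new but supplies the
    Slater slack.\<close>
  have bound: "x + L * m \<le> V" if "(x, q, v, c) \<in> attainable {0}" "0 \<le> m" "recession f = \<infinity> \<longrightarrow> m = 0"
    "q + m = 1" "v + \<rho> * m \<le> r" "c \<le> 1" for x q v c m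
  proof -
    have "ereal (x + L * m) \<le> predictor S f d 0 r loss x0 P'"
      by (rule attainable_le_predictor[OF that(1,2) _ that(4,5)]) (use that(3) \<rho> cost0[OF that(1)] in auto)
    then show ?thesis using V by simp
  qed
  have D: "countable {0::real}" "0 \<in> {0::real}" "{0::real} \<subseteq> {0..}" by auto
  obtain \<eta> lam \<gamma> where mult: "0 \<le> lam" "0 \<le> \<gamma>" "recession f = \<infinity> \<or> ereal (L - \<eta>) \<le> recession f * ereal lam"
    "ereal_integral P' (g {0} \<eta> lam \<gamma>) \<le> ereal (V - (r * lam + \<eta> + 1 * \<gamma>))"
  proof (rule strong_duality_core[OF D r zero_less_one \<rho>, of V])
    fix x q v c m :: real
    assume "(x, q, v, c) \<in> attainable {0}" "0 \<le> m" "recession f = \<infinity> \<longrightarrow> m = 0"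
      "q + m = 1" "v + \<rho> * m \<le> r" "c \<le> 1"
    then show "x + L * m \<le> V" by (rule bound)
  qed blast
  have "ereal_integral P' (g {0} \<eta> lam \<gamma>) \<noteq> \<infinity>" using mult(4) by auto
  then obtain G where G: "integrable P' G" "AE \<xi> in P'. g {0} \<eta> lam \<gamma> \<xi> = ereal (G \<xi>)"
    "ereal_integral P' (g {0} \<eta> lam \<gamma>) = ereal (\<integral>\<xi>. G \<xi> \<partial>P')"
    using g_finite_integral[OF D(2,1) mult(2)] by blast
  have G_le: "(\<integral>\<xi>. G \<xi> \<partial>P') + (r * lam + \<eta>) \<le> V" using mult(2,4) G(3) by simp
  define s where "s = slope 1"
  define A where "A = \<bar>s\<bar>"
  \<comment> \<open>The denominator collects the losses of the perturbation:
    \<open>\<delta> * s \<le> \<delta> * A\<close> in the integrand, \<open>r * \<delta>\<close>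
    from \<open>lam'\<close>, and \<open>\<delta> * A + \<delta>\<close> from
    \<open>\<eta>'\<close>. The other half of \<open>\<kappa>\<close> is kept for the passage to
    large \<open>\<gamma>\<close>.\<close>
  define \<delta> where "\<delta> = \<kappa> / 2 / (A + r + A + 1)"
  have den: "0 < A + r + A + 1" using r by (simp add: A_def)
  have \<delta>: "0 < \<delta>" using \<kappa> den by (simp add: \<delta>_def)
  have \<delta>_eq: "\<delta> * (A + r + A + 1) = \<kappa> / 2" unfolding \<delta>_def using den by (intro nonzero_eq_divide_eq[THEN iffD1]) auto
  \<comment> \<open>Raising \<open>lam\<close> may hurt when slopes of \<open>f\<close> are
    negative; the term \<open>\<delta> * A\<close> in \<open>\<eta>'\<close> offsets this. The last
    \<open>\<delta>\<close> makes the constraint strict and later absorbs the slack of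
    \<open>usc_radius\<close>.\<close>
  define lam' where "lam' = lam + \<delta>"
  define \<eta>' where "\<eta>' = \<eta> + \<delta> * A + \<delta>"
  have lam': "0 < lam'" using mult(1) \<delta> by (simp add: lam'_def)
  have As: "- A \<le> s" "s \<le> A" by (auto simp: A_def)
  have strict: "ereal (L - \<eta>') < recession f * ereal lam'"
    using \<rho>
  proof
    assume "recession f = \<infinity>"
    then show ?thesis using lam' by simp
  next
    assume rec: "recession f = ereal \<rho>"
    have "s \<le> \<rho>" using slope_le_recession[of 1] rec by (simp add: s_def)
    then have "\<delta> * (- A) \<le> \<delta> * \<rho>" using As \<delta> by (intro mult_left_mono) auto
    moreover have "L - \<eta> \<le> \<rho> * lam" using mult(3) rec by simp
    ultimately show ?thesis using \<delta> by (simp add: rec \<eta>'_def lam'_def algebra_simps)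
  qed
  obtain B where B: "\<And>t. 0 \<le> t \<Longrightarrow> ereal ((L - \<eta>') * t) - ereal lam' * f t \<le> ereal B"
    using conjugate_bounded[OF lam' strict] by blast
  have W_le: "W \<eta>' lam' c t \<xi> \<xi>' \<le> B - c * d \<xi> \<xi>'" if "0 < t" "\<xi>' \<in> S" for c t \<xi> \<xi>'
  proof -
    have "(L - \<eta>') * t - lam' * F t \<le> B" using B[of t] that by (simp add: f_eq_F)
    moreover have "(l \<xi>' - \<eta>') * t \<le> (L - \<eta>') * t" using loss_le[OF that(2)] that(1) by (intro mult_right_mono) auto
    ultimately show ?thesis unfolding W_def by linarith
  qed
  have D': "countable (range real)" "0 \<in> range real" by (simp, rule range_eqI[of _ _ 0], simp)
  define U where "U n \<xi> = real_of_ereal (g (range real) \<eta>' lam' (real n) \<xi>)" for n \<xi>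
  have g_le: "g (range real) \<eta>' lam' (real n) \<xi> \<le> ereal B" if "\<xi> \<in> S" for n \<xi>
  proof (rule g_least)
    fix t k :: real and \<xi>' assume t: "0 < t" "\<xi>' \<in> S"
    have "0 \<le> real n * d \<xi> \<xi>'" using d_nonneg[OF that t(2)] by simp
    then have "W \<eta>' lam' (real n) t \<xi> \<xi>' \<le> B" using W_le[OF t, of "real n" \<xi>] by linarith
    then show "ereal (W \<eta>' lam' (real n) t \<xi> \<xi>') \<le> ereal B" by simp
  qed
  have U: "g (range real) \<eta>' lam' (real n) \<xi> = ereal (U n \<xi>)" "- \<eta>' \<le> U n \<xi>" "U n \<xi> \<le> B" if "\<xi> \<in> S" for n \<xi>
  proof -
    have le: "ereal (- \<eta>') \<le> g (range real) \<eta>' lam' (real n) \<xi>" by (rule g_lower[OF that D'(2)])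
    show e: "g (range real) \<eta>' lam' (real n) \<xi> = ereal (U n \<xi>)"
      using le g_le[OF that, of n] unfolding U_def by (cases "g (range real) \<eta>' lam' (real n) \<xi>") auto
    show "- \<eta>' \<le> U n \<xi>" "U n \<xi> \<le> B" using le g_le[OF that, of n] unfolding e by simp_all
  qed
  have U_meas: "U n \<in> borel_measurable M" for n
    using g_measurable[OF D'(1), of "real n" \<eta>' lam'] unfolding U_def[abs_def] by measurable
  have U_int: "integrable P' (U n)" for n
  proof (rule P'.integrable_const_bound[of _ "max \<bar>\<eta>'\<bar> \<bar>B\<bar>"])
    show "AE \<xi> in P'. norm (U n \<xi>) \<le> max \<bar>\<eta>'\<bar> \<bar>B\<bar>"
    proof (rule AE_I2)
      fix \<xi> assume "\<xi> \<in> space P'"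
      then have "- \<eta>' \<le> U n \<xi>" "U n \<xi> \<le> B" using U(2,3) by simp_all
      then show "norm (U n \<xi>) \<le> max \<bar>\<eta>'\<bar> \<bar>B\<bar>" by (simp add: abs_if max_def)
    qed
    show "U n \<in> borel_measurable P'" using U_meas by (simp add: measurable_cong_sets[OF sets_P' refl])
  qed
  \<comment> \<open>Targets within cost \<open>\<delta>1\<close> gain at most
    \<open>\<delta>\<close> in loss over zero-cost targets, which \<open>\<eta>'\<close> absorbs.
    For the others the penalty \<open>n * \<delta>1\<close> eventually outweighs the uniform bound
    \<open>B\<close>.\<close>
  have ev: "\<forall>\<^sub>F n in sequentially. U n \<xi> \<le> G \<xi> + \<delta> * s" if \<xi>: "\<xi> \<in> S" and G\<xi>: "g {0} \<eta> lam \<gamma> \<xi> = ereal (G \<xi>)" for \<xi>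
  proof -
    obtain \<xi>0 where \<xi>0: "\<xi>0 \<in> S" "d \<xi> \<xi>0 \<le> 0" "\<And>y. y \<in> S \<Longrightarrow> d \<xi> y \<le> 0 \<Longrightarrow> l y \<le> l \<xi>0"
      using inflated_loss_attained[OF \<xi>, of 0] by (metis order_refl)
    have d0: "d \<xi> \<xi>0 = 0" using \<xi>0(2) d_nonneg[OF \<xi> \<xi>0(1)] by simp
    obtain \<delta>1 where \<delta>1: "0 < \<delta>1" "\<And>y. y \<in> S \<Longrightarrow> d \<xi> y \<le> \<delta>1 \<Longrightarrow> l y \<le> l \<xi>0 + \<delta>"
      using usc_radius[OF \<xi> \<delta> \<xi>0(3)] by blast
    have G_ge: "- \<eta> \<le> G \<xi>" using g_lower[OF \<xi>, of "{0}" \<eta> lam \<gamma>] G\<xi> by simp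
    obtain N :: nat where N: "(B + \<eta> - \<delta> * s) / \<delta>1 \<le> real N" using real_arch_simple by blast
    have "U n \<xi> \<le> G \<xi> + \<delta> * s" if n: "N \<le> n" for n
    proof -
      have "(B + \<eta> - \<delta> * s) / \<delta>1 \<le> real n" using N n by (meson of_nat_le_iff order_trans)
      then have n\<delta>: "B - real n * \<delta>1 \<le> - \<eta> + \<delta> * s" using \<delta>1(1) by (simp add: field_simps)
      have "g (range real) \<eta>' lam' (real n) \<xi> \<le> ereal (G \<xi> + \<delta> * s)"
      proof (rule g_least)
        fix t k :: real and y assume t: "t \<in> \<rat>" "0 < t" and y: "y \<in> S"
        have "W \<eta>' lam' (real n) t \<xi> y \<le> G \<xi> + \<delta> * s"
        proof (cases "d \<xi> y \<le> \<delta>1")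
          case True
          have "(l y - \<eta>') * t \<le> (l \<xi>0 - \<eta> - \<delta> * A) * t"
            using \<delta>1(2)[OF y True] t(2) by (intro mult_right_mono) (auto simp: \<eta>'_def)
          moreover have "0 \<le> real n * d \<xi> y" using d_nonneg[OF \<xi> y] by simp
          ultimately have "W \<eta>' lam' (real n) t \<xi> y \<le> (l \<xi>0 - \<eta> - \<delta> * A) * t - lam' * F t"
            unfolding W_def by linarith
          also have "\<dots> = W \<eta> lam \<gamma> t \<xi> \<xi>0 + \<delta> * (- A * t - F t)"
            by (simp add: W_def d0 lam'_def algebra_simps)
          also have "W \<eta> lam \<gamma> t \<xi> \<xi>0 \<le> G \<xi>"
            using g_upper[OF t \<xi>0(1), of 0 "{0}" \<xi> \<eta> lam \<gamma>] G\<xi> d0 by simp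
          \<comment> \<open>The tangent of \<open>F\<close> at 1 is \<open>s * (t - 1)\<close>;
            since \<open>- A \<le> s\<close>, the effect of the perturbation is at most
            \<open>\<delta> * s\<close>, uniformly in \<open>t\<close>.\<close>
          also have "\<delta> * (- A * t - F t) \<le> \<delta> * s"
          proof (rule mult_left_mono)
            have "s * (t - 1) \<le> F t" using F_subgradient[of 1 t] t(2) by (simp add: s_def)
            moreover have "- A * t \<le> s * t" using As(1) t(2) by (intro mult_right_mono) auto
            ultimately show "- A * t - F t \<le> s" by (simp add: algebra_simps)
          qed (use \<delta> in simp)
          finally show ?thesis by simp
        next
          case False
          then have "real n * \<delta>1 \<le> real n * d \<xi> y" by (intro mult_left_mono) auto
          then show ?thesis using W_le[OF t(2) y, of "real n" \<xi>] n\<delta> G_ge by linarith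
        qed
        then show "ereal (W \<eta>' lam' (real n) t \<xi> y) \<le> ereal (G \<xi> + \<delta> * s)" by simp
      qed
      then show ?thesis using U(1)[OF \<xi>] by simp
    qed
    then show ?thesis unfolding eventually_sequentially by blast
  qed
  define G' where "G' \<xi> = G \<xi> + \<delta> * s" for \<xi>
  have G'_int: "integrable P' G'" unfolding G'_def using G(1) by simp
  \<comment> \<open>\<open>U n\<close> falls below \<open>G'\<close> only from a point-dependent
    \<open>n\<close> on, and need not converge to it. Its maximum with \<open>G'\<close> does
    converge, under domination, and bounds the integral of \<open>U n\<close>.\<close>
  have lim: "(\<lambda>n. \<integral>\<xi>. max (U n \<xi>) (G' \<xi>) \<partial>P') \<longlonglongrightarrow> (\<integral>\<xi>. G' \<xi> \<partial>P')"
  proof (rule integral_dominated_convergence[where w = "\<lambda>\<xi>. max \<bar>\<eta>'\<bar> \<bar>B\<bar> + \<bar>G' \<xi>\<bar>"])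
    have "AE \<xi> in P'. \<xi> \<in> S" by (intro AE_I2) simp
    with G(2) show "AE \<xi> in P'. (\<lambda>n. max (U n \<xi>) (G' \<xi>)) \<longlonglongrightarrow> G' \<xi>"
    proof eventually_elim
      fix \<xi> assume "g {0} \<eta> lam \<gamma> \<xi> = ereal (G \<xi>)" "\<xi> \<in> S"
      then have "\<forall>\<^sub>F n in sequentially. max (U n \<xi>) (G' \<xi>) = G' \<xi>"
        using ev[of \<xi>] by (auto elim!: eventually_mono simp: G'_def max_absorb2)
      then show "(\<lambda>n. max (U n \<xi>) (G' \<xi>)) \<longlonglongrightarrow> G' \<xi>" by (rule tendsto_eventually)
    qed
    show "AE \<xi> in P'. norm (max (U n \<xi>) (G' \<xi>)) \<le> max \<bar>\<eta>'\<bar> \<bar>B\<bar> + \<bar>G' \<xi>\<bar>" for n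
    proof (rule AE_I2)
      fix \<xi> assume "\<xi> \<in> space P'"
      then have "- \<eta>' \<le> U n \<xi>" "U n \<xi> \<le> B" using U(2,3) by simp_all
      then show "norm (max (U n \<xi>) (G' \<xi>)) \<le> max \<bar>\<eta>'\<bar> \<bar>B\<bar> + \<bar>G' \<xi>\<bar>" by (auto simp: max_def abs_if)
    qed
  qed (use borel_measurable_integrable[OF G'_int] borel_measurable_integrable[OF U_int] G'_int in \<open>auto intro!: borel_measurable_max\<close>)
  have "\<forall>\<^sub>F n in sequentially. (\<integral>\<xi>. max (U n \<xi>) (G' \<xi>) \<partial>P') < (\<integral>\<xi>. G' \<xi> \<partial>P') + \<kappa> / 2"
    using lim \<kappa> by (intro order_tendstoD(2)) auto
  then obtain n where n: "(\<integral>\<xi>. max (U n \<xi>) (G' \<xi>) \<partial>P') < (\<integral>\<xi>. G' \<xi> \<partial>P') + \<kappa> / 2"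
    using eventually_happens'[OF sequentially_bot] by blast
  have "(\<integral>\<xi>. U n \<xi> \<partial>P') \<le> (\<integral>\<xi>. max (U n \<xi>) (G' \<xi>) \<partial>P')"
    using U_int G'_int by (intro integral_mono integrable_max) auto
  also note n
  also have "(\<integral>\<xi>. G' \<xi> \<partial>P') = (\<integral>\<xi>. G \<xi> \<partial>P') + \<delta> * s" unfolding G'_def using G(1) P'.prob_space by simp
  finally have Un: "(\<integral>\<xi>. U n \<xi> \<partial>P') < (\<integral>\<xi>. G \<xi> \<partial>P') + \<delta> * s + \<kappa> / 2" .
  have "\<delta> * s \<le> \<delta> * A" using As \<delta> by (intro mult_left_mono) auto
  then have total: "(\<integral>\<xi>. U n \<xi> \<partial>P') + (r * lam' + \<eta>') \<le> V + \<kappa>"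
    using Un G_le \<delta>_eq by (simp add: lam'_def \<eta>'_def algebra_simps)
  have eq: "ereal_integral P' (g (range real) \<eta>' lam' (real n)) = ereal (\<integral>\<xi>. U n \<xi> \<partial>P')"
  proof -
    have "ereal_integral P' (g (range real) \<eta>' lam' (real n)) = ereal_integral P' (\<lambda>\<xi>. ereal (U n \<xi>))"
      using U(1) by (intro ereal_integral_cong_AE AE_I2) auto
    then show ?thesis using ereal_integral_ereal[OF U_int] by simp
  qed
  show ?thesis
  proof (rule that[of lam' "real n" \<eta>'])
    show "recession f = \<infinity> \<or> ereal (L - \<eta>') \<le> recession f * ereal lam'" using strict by auto
    show "ereal_integral P' (g (range real) \<eta>' lam' (real n)) + ereal (r * lam' + \<eta>')
      \<le> predictor S f d 0 r loss x0 P' + ereal \<kappa>"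
      using total by (simp add: eq V)
  qed (use lam' in auto)
qed

text \<open>\<open>\<Delta>\<close> enters only through \<open>integrand_eq_g\<close>, so any set of
  nonnegative radii containing all costs gives the same dual value. The error
  \<open>\<kappa>\<close> accommodates \<open>\<epsilon> = 0\<close>, where the multipliers are only
  nearly optimal.\<close>

lemma predictor_eq_dual_value:
  assumes r: "0 < r" and \<epsilon>: "0 \<le> \<epsilon>"
    and \<Delta>: "\<Delta> \<subseteq> {0..}" "\<And>\<xi> \<xi>'. \<xi> \<in> S \<Longrightarrow> \<xi>' \<in> S \<Longrightarrow> d \<xi> \<xi>' \<in> \<Delta>"
  shows "predictor S f d \<epsilon> r loss x0 P' = dual_value \<Delta> S f d \<epsilon> r loss x0 P'"
proof -
  define J where "J \<eta> lam \<gamma> = ereal_integral P' (g (range real) \<eta> lam \<gamma>) + ereal (r * lam + \<eta> + \<epsilon> * \<gamma>)" for \<eta> lam \<gamma> :: real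
  define feas where "feas \<eta> lam \<gamma> \<longleftrightarrow> 0 \<le> lam \<and> 0 \<le> \<gamma> \<and>
    (recession f = \<infinity> \<or> ereal (L - \<eta>) \<le> recession f * ereal lam)" for \<eta> lam \<gamma> :: real
  have J: "ereal_integral P' (\<lambda>\<xi>. SUP \<delta>\<in>\<Delta>. conjugate_perspective f lam (inflated_loss S d loss \<delta> x0 \<xi> - \<eta>) - ereal (\<delta> * \<gamma>))
      + ereal (r * lam + \<eta> + \<epsilon> * \<gamma>) = J \<eta> lam \<gamma>" if "feas \<eta> lam \<gamma>" for \<eta> lam \<gamma> :: real
    unfolding J_def using that integrand_eq_g[OF \<Delta>]
    by (intro arg_cong2[of _ _ _ _ "(+)"] ereal_integral_cong_AE AE_I2) (auto simp: feas_def)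
  have dual: "dual_value \<Delta> S f d \<epsilon> r loss x0 P' = Inf {J \<eta> lam \<gamma> | \<eta> lam \<gamma>. feas \<eta> lam \<gamma>}"
    unfolding dual_value_def feas_def[symmetric] using J by (intro arg_cong[of _ _ Inf]) (force intro: J[symmetric])
  show ?thesis
  proof (rule antisym)
    show "predictor S f d \<epsilon> r loss x0 P' \<le> dual_value \<Delta> S f d \<epsilon> r loss x0 P'"
      unfolding dual predictor_def
      using weak_duality[OF _ _ \<epsilon>] by (intro Sup_least Inf_greatest) (auto simp: J_def feas_def)
    show "dual_value \<Delta> S f d \<epsilon> r loss x0 P' \<le> predictor S f d \<epsilon> r loss x0 P'"
    proof (rule ereal_le_epsilon2)
      fix \<kappa> :: real assume \<kappa>: "0 < \<kappa>"
      have "\<exists>\<eta> lam \<gamma>. feas \<eta> lam \<gamma> \<and> J \<eta> lam \<gamma> \<le> predictor S f d \<epsilon> r loss x0 P' + ereal \<kappa>"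
      proof (cases "\<epsilon> = 0")
        case True
        obtain \<eta> lam \<gamma> where "0 \<le> lam" "0 \<le> \<gamma>" "recession f = \<infinity> \<or> ereal (L - \<eta>) \<le> recession f * ereal lam"
          "ereal_integral P' (g (range real) \<eta> lam \<gamma>) + ereal (r * lam + \<eta>) \<le> predictor S f d 0 r loss x0 P' + ereal \<kappa>"
          by (rule strong_duality_zero[OF r \<kappa>])
        then show ?thesis unfolding J_def feas_def using True by (intro exI[of _ \<eta>] exI[of _ lam] exI[of _ \<gamma>]) simp
      next
        case False
        then have "0 < \<epsilon>" using \<epsilon> by simp
        then obtain \<eta> lam \<gamma> where 1: "0 \<le> lam" "0 \<le> \<gamma>" "recession f = \<infinity> \<or> ereal (L - \<eta>) \<le> recession f * ereal lam"
          "J \<eta> lam \<gamma> \<le> predictor S f d \<epsilon> r loss x0 P'"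
          unfolding J_def by (rule strong_duality_positive[OF r])
        have "J \<eta> lam \<gamma> \<le> predictor S f d \<epsilon> r loss x0 P' + ereal \<kappa>"
          using 1(4) \<kappa> by (intro order_trans[OF 1(4)]) (simp add: ereal_le_add_self)
        then show ?thesis unfolding feas_def using 1 by blast
      qed
      then show "dual_value \<Delta> S f d \<epsilon> r loss x0 P' \<le> predictor S f d \<epsilon> r loss x0 P' + ereal \<kappa>"
        unfolding dual by (blast intro: Inf_lower2)
    qed
  qed
qed

end

text \<open>The radii must reach all transport costs, and \<open>{0..diameter \<Sigma>}\<close> can
  fall short: take two points at distance 1 with mutual cost 2 and losses 0 and 1, all reference
  mass at the first, \<open>\<epsilon> = 2\<close> and infinite recession slope. The predictor is 1,
  while \<open>\<eta> = lam = \<gamma> = 0\<close> bounds the dual value by 0. Hence that range is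
  paired with a bound on \<open>d\<close>, whereas \<open>{0..}\<close> covers every cost.\<close>

theorem theorem8p7:
  fixes \<Sigma> :: "(real ^ 'n) set"
    and X :: "(real ^ 'm) set"
    and loss :: "real ^ 'm \<Rightarrow> real ^ 'n \<Rightarrow> real"
    and f :: "real \<Rightarrow> ereal"
    and d :: "real ^ 'n \<Rightarrow> real ^ 'n \<Rightarrow> real"
  assumes "compact \<Sigma>"
    and "divergence_generator f"
    and "\<forall>x\<in>X. \<forall>\<xi>\<in>\<Sigma>. 0 \<le> loss x \<xi> \<and> loss x \<xi> \<le> max_loss \<Sigma> loss x"
    and "\<forall>x\<in>X. usc_on \<Sigma> (loss x)"
    and "\<forall>\<xi>\<in>\<Sigma>. \<forall>\<xi>'\<in>\<Sigma>. 0 \<le> d \<xi> \<xi>'"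
    and "lsc_on (\<Sigma> \<times> \<Sigma>) (\<lambda>(\<xi>, \<xi>'). d \<xi> \<xi>')"
    and "\<forall>\<xi>\<in>\<Sigma>. d \<xi> \<xi> = 0"
  shows "\<forall>x\<in>X. \<forall>P\<in>borel_probs \<Sigma>. \<forall>r>0. \<forall>\<epsilon>\<ge>0.
           ((\<forall>\<xi>\<in>\<Sigma>. \<forall>\<xi>'\<in>\<Sigma>. d \<xi> \<xi>' \<le> diameter \<Sigma>) \<longrightarrow>
              predictor \<Sigma> f d \<epsilon> r loss x P = dual_value {0..diameter \<Sigma>} \<Sigma> f d \<epsilon> r loss x P) \<and>
           predictor \<Sigma> f d \<epsilon> r loss x P = dual_value {0..} \<Sigma> f d \<epsilon> r loss x P"
proof (intro ballI allI impI)
  fix x P and r \<epsilon> :: real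
  assume x: "x \<in> X" and P: "P \<in> borel_probs \<Sigma>" and r: "0 < r" and \<epsilon>: "0 \<le> \<epsilon>"
  interpret dro f \<Sigma> d loss x P
    by unfold_locales (use assms x P in auto)
  show "((\<forall>\<xi>\<in>\<Sigma>. \<forall>\<xi>'\<in>\<Sigma>. d \<xi> \<xi>' \<le> diameter \<Sigma>) \<longrightarrow>
              predictor \<Sigma> f d \<epsilon> r loss x P = dual_value {0..diameter \<Sigma>} \<Sigma> f d \<epsilon> r loss x P) \<and>
           predictor \<Sigma> f d \<epsilon> r loss x P = dual_value {0..} \<Sigma> f d \<epsilon> r loss x P"
    using predictor_eq_dual_value[OF r \<epsilon>, of "{0..diameter \<Sigma>}"] predictor_eq_dual_value[OF r \<epsilon>, of "{0..}"] d_nonneg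
    by auto
qed

end
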